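(* Let $s\geq1$, $\sigma>0$ and $\eta_0\in G^{\sigma,s}(\mathbb{R})$ be given. Then there exist a time $T=T(\|\eta_0\|_{G^{\sigma,s}})>0$ and $\eta\in C([0,T];G^{\sigma,s}(\mathbb{R}))$ satisfying the initial value problem $$\begin{cases}\eta_t+\eta_x-\gamma_1 \eta_{xxt}+\gamma_2\eta_{xxx}+\delta_1 \eta_{xxxxt}+\delta_2\eta_{xxxxx}+\frac{3}{2}\eta \eta_x+\gamma (\eta^2)_{xxx}-\frac{7}{48}(\eta_x^2)_x-\frac{1}{8}(\eta^3)_x=0,\\ \eta(x,0)=\eta_0(x).\end{cases}$$
   Context: The coefficients of the equation are real and are given by $$\gamma_1=\tfrac12(b+d-\rho),\quad \gamma_2=\tfrac12(a+c+\rho),\quad \rho=b+d-\tfrac16,$$ $$\delta_1=\tfrac14\big[2(b_1+d_1)-(b-d+\rho)(\tfrac16-a-d)-d(c-a+\rho)\big],$$ $$\delta_2=\tfrac14\big[2(a_1+c_1)-(c-a+\rho)(\tfrac16-a)+\tfrac13\rho\big],\quad \gamma=\tfrac1{24}\big[5-9(b+d)+9\rho\big],$$ where $a,b,c,d,a_1,b_1,c_1,d_1$ are real parameters, and they satisfy $a+b+c+d=\frac13$, $\gamma_1+\gamma_2=\frac16$, $\gamma=\frac1{24}(5-18\gamma_1)$, $\delta_2-\delta_1=\frac{19}{360}-\frac16\gamma_1$, with $\gamma_1>0$ and $\delta_1>0$. With $\langle\xi\rangle=1+|\xi|$ and $\hat f(\xi)=\frac1{\sqrt{2\pi}}\int_{\mathbb{R}}e^{-ix\xi}f(x)\,dx$,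 for $\sigma>0$ and $s\in\mathbb{R}$ the analytic Gevrey class $G^{\sigma,s}=G^{\sigma,s}(\mathbb{R})$ is the subspace of $L^2(\mathbb{R})$ of functions with finite norm $$\|f\|_{G^{\sigma,s}}^2=\int_{\mathbb{R}}\langle\xi\rangle^{2s}e^{2\sigma\langle\xi\rangle}|\hat f(\xi)|^2\,d\xi.$$ *)

theory Defs
  imports "HOL-Analysis.Analysis"
begin

text \<open>Elements of \<open>L\<^sup>2(\<real>)\<close> are represented by Borel functions; two representatives of the
  same element agree almost everywhere.\<close>

definition L2 :: "(real \<Rightarrow> complex) set" where
  "L2 = {f \<in> borel_measurable lborel. integrable lborel (\<lambda>x. (cmod (f x))\<^sup>2)}"

definition truncated_fourier :: "real \<Rightarrow> (real \<Rightarrow> complex) \<Rightarrow> real \<Rightarrow> complex" where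
  "truncated_fourier R f \<xi> =
     (1 / sqrt (2 * pi)) *\<^sub>R
       (LINT x:{-R..R}|lborel. exp (- (\<i> * complex_of_real x * complex_of_real \<xi>)) * f x)"

text \<open>The integral defining \<open>f\<close>'s Fourier transform need not converge absolutely for
  \<open>f \<in> L2\<close> (the Gevrey class is not contained in \<open>L\<^sup>1\<close>). As usual, it is understood in the sense
  of Plancherel: as the limit in \<open>L\<^sup>2\<close> of the integrals over \<open>[-R, R]\<close>. The limit is unique
  only up to null sets, so \<open>fourier\<close> selects a representative. The distance is a nonnegative
  integral, which is infinite, rather than 0, when the difference is not square integrable.\<close>

definition has_fourier :: "(real \<Rightarrow> complex) \<Rightarrow> (real \<Rightarrow> complex) \<Rightarrow> bool" where
  "has_fourier f g \<longleftrightarrow> g \<in> L2 \<and>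
     ((\<lambda>R. \<integral>\<^sup>+ \<xi>. ennreal ((cmod (truncated_fourier R f \<xi> - g \<xi>))\<^sup>2) \<partial>lborel) \<longlongrightarrow> 0) at_top"

definition fourier :: "(real \<Rightarrow> complex) \<Rightarrow> real \<Rightarrow> complex" where
  "fourier f = (SOME g. has_fourier f g)"

definition bracket :: "real \<Rightarrow> real" where
  "bracket \<xi> = 1 + \<bar>\<xi>\<bar>"

definition gevrey_density :: "real \<Rightarrow> real \<Rightarrow> (real \<Rightarrow> complex) \<Rightarrow> real \<Rightarrow> real" where
  "gevrey_density \<sigma> s f \<xi> =
     bracket \<xi> powr (2 * s) * exp (2 * \<sigma> * bracket \<xi>) * (cmod (fourier f \<xi>))\<^sup>2"

definition gevrey :: "real \<Rightarrow> real \<Rightarrow> (real \<Rightarrow> complex) set" where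
  "gevrey \<sigma> s = {f \<in> L2. integrable lborel (gevrey_density \<sigma> s f)}"

definition gevrey_norm :: "real \<Rightarrow> real \<Rightarrow> (real \<Rightarrow> complex) \<Rightarrow> real" where
  "gevrey_norm \<sigma> s f = sqrt (LINT \<xi>|lborel. gevrey_density \<sigma> s f \<xi>)"

text \<open>A function of time and space is written \<open>u t x\<close>. The following is
  \<open>u \<in> C([0,T]; G\<^bsup>\<sigma>,s\<^esup>)\<close>.\<close>

definition gevrey_continuous ::
    "real \<Rightarrow> real \<Rightarrow> real \<Rightarrow> (real \<Rightarrow> real \<Rightarrow> complex) \<Rightarrow> bool" where
  "gevrey_continuous \<sigma> s T u \<longleftrightarrow>
     (\<forall>t\<in>{0..T}. u t \<in> gevrey \<sigma> s \<and>
        ((\<lambda>r. gevrey_norm \<sigma> s (\<lambda>x. u r x - u t x)) \<longlongrightarrow> 0) (at t within {0..T}))"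

definition Dx :: "nat \<Rightarrow> (real \<Rightarrow> complex) \<Rightarrow> real \<Rightarrow> complex" where
  "Dx n = ((\<lambda>f x. vector_derivative f (at x)) ^^ n)"

definition Dt :: "real \<Rightarrow> (real \<Rightarrow> real \<Rightarrow> complex) \<Rightarrow> real \<Rightarrow> real \<Rightarrow> complex" where
  "Dt T u t x = vector_derivative (\<lambda>r. u r x) (at t within {0..T})"

text \<open>Classical solutions on \<open>[0,T] \<times> \<real>\<close>, with one-sided time derivatives at the endpoints;
  every derivative occurring in the equation is required to exist (those of the nonlinear terms
  exist because \<open>u t\<close> is five times differentiable).\<close>

definition kdv_bbm_solution ::
    "real \<Rightarrow> real \<Rightarrow> real \<Rightarrow> real \<Rightarrow> real \<Rightarrow> real \<Rightarrow> (real \<Rightarrow> real \<Rightarrow> complex) \<Rightarrow> bool" where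
  "kdv_bbm_solution \<gamma>1 \<gamma>2 \<delta>1 \<delta>2 \<gamma> T u \<longleftrightarrow>
     (\<forall>t\<in>{0..T}. \<forall>x.
        (\<forall>n<5. Dx n (u t) differentiable (at x)) \<and>
        (\<forall>n\<in>{0,2,4}. (\<lambda>r. Dx n (u r) x) differentiable (at t within {0..T})) \<and>
        Dt T u t x + Dx 1 (u t) x
        - \<gamma>1 *\<^sub>R Dt T (\<lambda>r. Dx 2 (u r)) t x
        + \<gamma>2 *\<^sub>R Dx 3 (u t) x
        + \<delta>1 *\<^sub>R Dt T (\<lambda>r. Dx 4 (u r)) t x
        + \<delta>2 *\<^sub>R Dx 5 (u t) x
        + (3/2) * (u t x * Dx 1 (u t) x)
        + \<gamma> *\<^sub>R Dx 3 (\<lambda>y. (u t y)\<^sup>2) x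
        - (7/48) * Dx 1 (\<lambda>y. (Dx 1 (u t) y)\<^sup>2) x
        - (1/8) * Dx 1 (\<lambda>y. (u t y)^3) x = 0)"

end

theory Submission
  imports Defs "HOL-Probability.Levy"
begin

text \<open>The equation is solved on the Fourier side. Write \<open>\<eta>(t,x) = \<integral> e\<^bsup>ix\<xi>\<^esup> v(t,\<xi>) d\<xi>\<close>. Since
\<open>P(\<xi>) = 1 + \<gamma>1 \<xi>\<^sup>2 + \<delta>1 \<xi>\<^sup>4\<close> does not vanish, the equation becomes, for each frequency, the ordinary
differential equation \<open>v\<^sub>t = - \<i> \<phi> v + N v\<close> with a real dispersion relation \<open>\<phi>\<close> of at most linear growth and
\<open>N v = p1 (v * v) + p2 ((\<i>\<xi> v) * (\<i>\<xi> v)) + p3 (v * v * v)\<close>, where \<open>*\<close> is convolution, \<open>p1\<close> decays at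
least like \<open>1/\<langle>\<xi>\<rangle>\<close> and \<open>p2, p3\<close> at least like \<open>1/\<langle>\<xi>\<rangle>\<^sup>2\<close>.

The Gevrey weight \<open>w(\<xi>) = \<langle>\<xi>\<rangle>\<^sup>s e\<^bsup>\<sigma>\<langle>\<xi>\<rangle>\<^esup>\<close> is submultiplicative, \<open>w(\<xi> + \<eta>) \<le> w(\<xi>) w(\<eta>)\<close>, and so is
\<open>w/\<langle>\<xi>\<rangle>\<close> because \<open>s \<ge> 1\<close>. By Cauchy-Schwarz the convolution of two functions in the weighted \<open>L\<^sup>2\<close> space
is therefore pointwise bounded by a constant over the weight (\<open>conv_bound\<close>). With the decay of the
symbols this gives \<open>|N v| \<le> const \<cdot> \<beta>\<close> with \<open>\<beta> = 1/(\<langle>\<xi>\<rangle> w)\<close>, a function which again lies in the weighted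
space because \<open>1/\<langle>\<xi>\<rangle>\<close> is square integrable; the corresponding Lipschitz estimate is \<open>N_diff\<close>.
In other words, the nonlinear part of the solution lives in a weighted supremum norm, however rough
the profile of the data is in \<open>\<xi>\<close>. Substituting \<open>v = e\<^bsup>-it\<phi>\<^esup> (v0 + z)\<close>, a contraction argument for \<open>z\<close> in
this pointwise norm yields a solution on a time interval that depends only on the weighted norm of
\<open>v0\<close> (\<open>local_existence\<close>).

All \<open>v(t)\<close> are dominated by one function of the weighted space and are continuous in \<open>t\<close> for every
frequency, so continuity in \<open>G\<^bsup>\<sigma>,s\<^esup>\<close>, all derivatives in \<open>x\<close> and \<open>t\<close>, and hence the equation itself
follow by dominated convergence (\<open>gevrey_continuous_osc\<close>, \<open>solution_of_fourier_side\<close>). Reality of the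
solution is the symmetry \<open>v(t,-\<xi>) = cnj (v(t,\<xi>))\<close>, which the contraction preserves.

The passage between \<open>\<eta>\<close> and \<open>v\<close> requires the \<open>L\<^sup>2\<close> theory of the Fourier transform: existence of the
transform for every element of \<open>L\<^sup>2\<close> (\<open>has_fourier_exists\<close>), the transform of a synthesised function
(\<open>has_fourier_osc\<close>) and inversion (\<open>fourier_inversion\<close>). Existence needs only the inequality half of
Plancherel's theorem. The two other facts are obtained by testing against modulated Gaussians, which
reduces them to the injectivity of the transform on \<open>L\<^sup>1\<close>, that is, to Levy's uniqueness theorem for
characteristic functions.\<close>


section \<open>Oscillatory integrals and Gaussians\<close>

lemma borel_measurable_cis [measurable]: "cis \<in> borel_measurable borel"
  by (intro borel_measurable_continuous_onI continuous_intros)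

text \<open>The unnormalised inverse Fourier transform. Without the factor \<open>1/sqrt (2 * pi)\<close>, products of such
integrals correspond to plain convolutions.\<close>

definition osc :: "(real \<Rightarrow> complex) \<Rightarrow> real \<Rightarrow> complex" where
  "osc f x = (LINT y|lborel. cis (x * y) * f y)"

lemma borel_measurable_osc [measurable]:
  assumes [measurable]: "f \<in> borel_measurable borel"
  shows "osc f \<in> borel_measurable borel"
  unfolding osc_def[abs_def] by measurable

lemma integrable_cis_mult:
  assumes f: "integrable lborel f" and [measurable]: "g \<in> borel_measurable borel"
  shows "integrable lborel (\<lambda>y. cis (g y) * f y)"
proof -
  have [measurable]: "f \<in> borel_measurable borel" using f by auto
  show ?thesis by (rule Bochner_Integration.integrable_bound[OF f]) (auto simp: norm_mult)
qed

lemma norm_osc_le: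
  assumes f: "integrable lborel f"
  shows "norm (osc f x) \<le> (LINT y|lborel. norm (f y))"
  unfolding osc_def
  by (rule order_trans[OF integral_norm_bound]) (simp add: norm_mult)

lemma integrable_pair_mult:
  fixes f h :: "real \<Rightarrow> complex"
  assumes f: "integrable lborel f" and h: "integrable lborel h"
  shows "integrable (lborel \<Otimes>\<^sub>M lborel) (\<lambda>(x,y). f x * h y)"
proof (rule lborel_pair.Fubini_integrable)
  have [measurable]: "f \<in> borel_measurable borel" "h \<in> borel_measurable borel" using f h by auto
  show "(\<lambda>(x,y). f x * h y) \<in> borel_measurable (lborel \<Otimes>\<^sub>M lborel)" by measurable
  show "integrable lborel (\<lambda>x. LINT y|lborel. norm (case (x, y) of (x, y) \<Rightarrow> f x * h y))"
    using f by (simp add: norm_mult)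
  show "AE x in lborel. integrable lborel (\<lambda>y. case (x, y) of (x, y) \<Rightarrow> f x * h y)"
    using h by simp
qed

text \<open>Fubini's theorem; both sides are the double integral of \<open>cis (x * y) f(y) h(x)\<close>.\<close>

lemma osc_multiplication:
  assumes f: "integrable lborel f" and h: "integrable lborel h"
  shows "(LINT x|lborel. osc f x * h x) = (LINT y|lborel. f y * osc h y)"
proof -
  have [measurable]: "f \<in> borel_measurable borel" "h \<in> borel_measurable borel" using f h by auto
  have "integrable (lborel \<Otimes>\<^sub>M lborel) (\<lambda>(x,y). cis (x * y) * (h x * f y))"
    by (rule Bochner_Integration.integrable_bound[OF integrable_pair_mult[OF h f]])
       (auto simp: norm_mult)
  from lborel_pair.Fubini_integral[OF this]
  have "(LINT y|lborel. LINT x|lborel. cis (x * y) * (h x * f y))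
      = (LINT x|lborel. LINT y|lborel. cis (x * y) * (h x * f y))" .
  moreover have "(LINT x|lborel. cis (x * y) * (h x * f y)) = f y * osc h y" for y
    unfolding osc_def
    by (subst integral_mult_right_zero[symmetric]) (simp add: mult_ac)
  moreover have "(LINT y|lborel. cis (x * y) * (h x * f y)) = osc f x * h x" for x
    unfolding osc_def
    by (subst integral_mult_left_zero[symmetric]) (simp add: mult_ac)
  ultimately show ?thesis by simp
qed

lemma integrable_gauss:
  assumes "e \<noteq> 0"
  shows "integrable lborel (\<lambda>y::real. exp (-((e*y)\<^sup>2)/2))"
proof -
  have "integrable lborel (\<lambda>y. sqrt (2*pi) * std_normal_density y)"
    by (intro integrable_mult_right integrable_normal_moment[where k=0, simplified, of 1 0]) auto
  then have "integrable lborel (\<lambda>y::real. exp (-(y\<^sup>2)/2))"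
    by (simp add: std_normal_density_def field_simps)
  from lborel_integrable_real_affine[OF this assms, of 0] show ?thesis by simp
qed

lemma integrable_gauss1: "integrable lborel (\<lambda>y::real. exp (-(y\<^sup>2)/2))"
  using integrable_gauss[of 1] by simp

lemma osc_gauss1:
  "osc (\<lambda>y. of_real (exp (-(y\<^sup>2)/2))) x = of_real (sqrt (2*pi) * exp (-(x\<^sup>2)/2))"
proof -
  have "char std_normal_distribution x = (LINT y|lborel. std_normal_density y *\<^sub>R iexp (x * y))"
    unfolding char_def by (subst integral_density) (auto simp: normal_density_nonneg)
  also have "\<dots> = (LINT y|lborel. of_real (1 / sqrt (2*pi)) * (cis (x*y) * of_real (exp (-(y\<^sup>2)/2))))"
    by (intro Bochner_Integration.integral_cong refl)
       (simp add: std_normal_density_def cis_conv_exp scaleR_conv_of_real)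
  also have "\<dots> = of_real (1 / sqrt (2*pi)) * osc (\<lambda>y. of_real (exp (-(y\<^sup>2)/2))) x"
    unfolding osc_def by (subst integral_mult_right_zero) simp
  finally show ?thesis
    by (simp add: char_std_normal_distribution field_simps)
qed

text \<open>The transform of a wide Gaussian is a narrow probability density. As \<open>e\<close> tends to 0 the left-hand side
regularises the integral of \<open>cis (x * y)\<close> over all \<open>y\<close>.\<close>

lemma osc_gauss:
  assumes "e > 0"
  shows "osc (\<lambda>y. of_real (exp (-((e*y)\<^sup>2)/2))) x = of_real (2 * pi * normal_density 0 e x)"
proof -
  have "osc (\<lambda>y. of_real (exp (-(y\<^sup>2)/2))) (x/e)
      = \<bar>e\<bar> *\<^sub>R (LINT y|lborel. cis (x/e * (0 + e * y)) * of_real (exp (-((0 + e * y)\<^sup>2)/2)))"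
    unfolding osc_def using assms by (intro lborel_integral_real_affine) auto
  also have "\<dots> = e *\<^sub>R osc (\<lambda>y. of_real (exp (-((e*y)\<^sup>2)/2))) x"
    unfolding osc_def using assms by (simp)
  finally have eq: "e *\<^sub>R osc (\<lambda>y. of_real (exp (-((e*y)\<^sup>2)/2))) x
      = of_real (sqrt (2*pi) * exp (-((x/e)\<^sup>2)/2))"
    unfolding osc_gauss1 by simp
  have "sqrt (2*pi) * exp (-((x/e)\<^sup>2)/2) = e * (2 * pi * normal_density 0 e x)"
    using assms real_sqrt_mult_self[of "2*pi"]
    by (simp add: normal_density_def real_sqrt_mult power_divide field_simps del: real_sqrt_mult_self)
       (simp add: algebra_simps)?
  with eq have "e *\<^sub>R osc (\<lambda>y. of_real (exp (-((e*y)\<^sup>2)/2))) x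
      = of_real (e * (2 * pi * normal_density 0 e x))" by metis
  also have "\<dots> = e *\<^sub>R of_real (2 * pi * normal_density 0 e x)"
    by (simp add: scaleR_conv_of_real)
  finally show ?thesis using assms by (metis scaleR_cancel_left less_irrefl)
qed


lemma borel_measurable_cnj [measurable]: "cnj \<in> borel_measurable borel"
  by (intro borel_measurable_continuous_onI continuous_intros)

lemma osc_reflect: "osc (\<lambda>y. f (-y)) x = osc f (-x)"
  unfolding osc_def using lborel_integral_real_affine[of "-1" "\<lambda>y. cis (- x * y) * f y" 0] by simp

lemma cnj_osc: "cnj (osc f x) = osc (\<lambda>y. cnj (f y)) (-x)"
proof -
  have "cnj (osc f x) = (LINT y|lborel. cnj (cis (x * y) * f y))"
    unfolding osc_def by (rule Bochner_Integration.integral_cnj[symmetric])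
  then show ?thesis unfolding osc_def by (simp add: cis_cnj)
qed

lemma osc_modulate: "osc (\<lambda>y. cis (a * y) * f y) x = osc f (x + a)"
  unfolding osc_def by (simp add: cis_mult algebra_simps flip: mult.assoc)

lemma nn_integral_normal_density:
  assumes "e > 0" shows "(\<integral>\<^sup>+ y. ennreal (normal_density m e y) \<partial>lborel) = 1"
  using assms by (subst nn_integral_eq_integral) (auto simp: integral_normal_density)

text \<open>The Gaussian factor makes the integral absolutely convergent. Two applications of the multiplication
formula turn it into the quadratic form of \<open>f\<close> with a Gaussian probability kernel, and
\<open>2 |f(x)| |f(y)| \<le> |f(x)|\<^sup>2 + |f(y)|\<^sup>2\<close> bounds this form by the square of the \<open>L\<^sup>2\<close> norm, uniformly in
\<open>e\<close>.\<close>

lemma nn_integral_gauss_osc_le: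
  assumes f: "integrable lborel f" and e: "e > 0"
  shows "(\<integral>\<^sup>+ x. ennreal ((norm (osc f x))\<^sup>2 * exp (-((e*x)\<^sup>2)/2)) \<partial>lborel)
    \<le> ennreal (2 * pi) * (\<integral>\<^sup>+ x. ennreal ((norm (f x))\<^sup>2) \<partial>lborel)"
proof -
  let ?k = "\<lambda>x y. pi * ((norm (f x))\<^sup>2 * normal_density x e y + (norm (f y))\<^sup>2 * normal_density y e x)"
  let ?m = "\<lambda>x y. norm (f x * (cnj (f y) * of_real (2 * pi * normal_density x e y)))"
  have [measurable]: "f \<in> borel_measurable borel" using f by auto
  define G :: "real \<Rightarrow> complex" where "G y = of_real (exp (-((e*y)\<^sup>2)/2))" for y
  have G_int: "integrable lborel G"
    unfolding G_def using integrable_gauss[of e] e by (intro integrable_of_real) auto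
  have [measurable]: "G \<in> borel_measurable borel" unfolding G_def by measurable
  define h where "h x = G x * cnj (osc f x)" for x
  have [measurable]: "h \<in> borel_measurable borel" unfolding h_def[abs_def] by measurable
  define C where "C = (LINT y|lborel. norm (f y))"
  have h_int: "integrable lborel h"
  proof (rule Bochner_Integration.integrable_bound)
    show "integrable lborel (\<lambda>x. C *\<^sub>R G x)" using G_int by simp
    show "AE x in lborel. norm (h x) \<le> norm (C *\<^sub>R G x)"
      using norm_osc_le[OF f] by (auto simp: h_def norm_mult C_def mult.commute intro!: mult_left_mono AE_I2)
  qed simp
  have cf_int: "integrable lborel (\<lambda>y. cnj (f y))" using f by simp
  have osc_h: "osc h x = (LINT y|lborel. cnj (f y) * of_real (2 * pi * normal_density x e y))" for x
  proof -
    have "osc h x = (LINT y|lborel. osc (\<lambda>y. cnj (f y)) (-y) * (cis (x * y) * G y))"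
      unfolding osc_def[of h] h_def by (simp add: cnj_osc mult_ac)
    also have "\<dots> = (LINT y|lborel. osc (\<lambda>y. cnj (f y)) y * (cis (-x * y) * G y))"
      using lborel_integral_real_affine[of "-1" "\<lambda>y. osc (\<lambda>y. cnj (f y)) (-y) * (cis (x * y) * G y)" 0]
      by (simp add: G_def)
    also have "\<dots> = (LINT y|lborel. cnj (f y) * osc (\<lambda>y. cis (-x * y) * G y) y)"
      by (intro osc_multiplication cf_int integrable_cis_mult G_int) measurable
    also have "\<dots> = (LINT y|lborel. cnj (f y) * of_real (2 * pi * normal_density x e y))"
      unfolding osc_modulate G_def osc_gauss[OF e]
      by (simp add: normal_density_def)
    finally show ?thesis .
  qed
  have "(\<integral>\<^sup>+ x. ennreal ((norm (osc f x))\<^sup>2 * exp (-((e*x)\<^sup>2)/2)) \<partial>lborel)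
      = (\<integral>\<^sup>+ x. ennreal (norm (osc f x * h x)) \<partial>lborel)"
    unfolding h_def G_def
    by (intro nn_integral_cong) (simp add: norm_mult power2_eq_square mult_ac)
  also have "\<dots> = ennreal (LINT x|lborel. norm (osc f x * h x))"
  proof (subst nn_integral_eq_integral)
    show "integrable lborel (\<lambda>x. norm (osc f x * h x))"
    proof (rule Bochner_Integration.integrable_bound)
      show "integrable lborel (\<lambda>x. C *\<^sub>R h x)" using h_int by simp
      show "AE x in lborel. norm (norm (osc f x * h x)) \<le> norm (C *\<^sub>R h x)"
        using norm_osc_le[OF f] order_trans[OF norm_ge_zero norm_osc_le[OF f]]
        by (auto simp: norm_mult C_def intro!: mult_right_mono AE_I2)
    qed simp
  qed simp_all
  also have "(LINT x|lborel. norm (osc f x * h x)) = norm (LINT x|lborel. osc f x * h x)"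
  proof -
    have "osc f x * h x = of_real (norm (osc f x * h x))" for x
    proof -
      have "osc f x * h x = of_real ((norm (osc f x))\<^sup>2 * exp (-((e*x)\<^sup>2)/2))"
        unfolding h_def G_def using complex_norm_square[of "osc f x"] by (simp add: mult_ac)
      moreover have "norm (osc f x * h x) = (norm (osc f x))\<^sup>2 * exp (-((e*x)\<^sup>2)/2)"
        unfolding h_def G_def by (simp add: norm_mult power2_eq_square mult_ac)
      ultimately show ?thesis by simp
    qed
    then have "(LINT x|lborel. osc f x * h x) = (LINT x|lborel. of_real (norm (osc f x * h x)))"
      by (intro Bochner_Integration.integral_cong) auto
    also have "\<dots> = of_real (LINT x|lborel. norm (osc f x * h x))"
      by (rule integral_complex_of_real)
    finally show ?thesis by simp
  qed
  also have "(LINT x|lborel. osc f x * h x) = (LINT x|lborel. f x * osc h x)"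
    by (intro osc_multiplication f h_int)
  also have "ennreal (norm (LINT x|lborel. f x * osc h x)) \<le> (\<integral>\<^sup>+ x. ennreal (norm (f x * osc h x)) \<partial>lborel)"
  proof (cases "integrable lborel (\<lambda>x. f x * osc h x)")
    case True then show ?thesis by (rule integral_norm_bound_ennreal)
  qed (simp add: not_integrable_integral_eq)
  also have "\<dots> \<le> (\<integral>\<^sup>+ x. \<integral>\<^sup>+ y. ennreal (?k x y) \<partial>lborel \<partial>lborel)"
  proof (intro nn_integral_mono)
    fix x :: real
    have int: "integrable lborel (\<lambda>y. f x * (cnj (f y) * of_real (2 * pi * normal_density x e y)))"
    proof (intro integrable_mult_right, rule Bochner_Integration.integrable_bound)
      show "integrable lborel (\<lambda>y. (2 * pi * (1 / sqrt (2 * pi * e\<^sup>2))) *\<^sub>R f y)"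
        using f by simp
      show "AE y in lborel. norm (cnj (f y) * of_real (2 * pi * normal_density x e y))
         \<le> norm ((2 * pi * (1 / sqrt (2 * pi * e\<^sup>2))) *\<^sub>R f y)"
      proof (rule AE_I2)
        fix y
        have "normal_density x e y \<le> 1 / sqrt (2 * pi * e\<^sup>2)"
          unfolding normal_density_def using e by (intro mult_left_le) auto
        then have "norm (f y) * (2 * pi * normal_density x e y) \<le> norm (f y) * (2 * pi * (1 / sqrt (2 * pi * e\<^sup>2)))"
          by (intro mult_left_mono) auto
        then show "norm (cnj (f y) * of_real (2 * pi * normal_density x e y))
         \<le> norm ((2 * pi * (1 / sqrt (2 * pi * e\<^sup>2))) *\<^sub>R f y)"
          by (simp add: norm_mult mult_ac)
      qed
    qed simp
    have "f x * osc h x = (LINT y|lborel. f x * (cnj (f y) * of_real (2 * pi * normal_density x e y)))"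
      unfolding osc_h by simp
    have "ennreal (norm (f x * osc h x))
       \<le> (\<integral>\<^sup>+ y. ennreal (?m x y) \<partial>lborel)"
      unfolding \<open>f x * osc h x = _\<close> by (rule integral_norm_bound_ennreal[OF int])
    also have "\<dots> \<le> (\<integral>\<^sup>+ y. ennreal (?k x y) \<partial>lborel)"
    proof (intro nn_integral_mono ennreal_leI)
      fix y
      have sym: "normal_density y e x = normal_density x e y"
        by (simp add: normal_density_def power2_commute)
      have "?m x y
          = (pi * normal_density x e y) * (2 * norm (f x) * norm (f y))"
        by (simp add: norm_mult mult_ac)
      also have "\<dots> \<le> (pi * normal_density x e y) * ((norm (f x))\<^sup>2 + (norm (f y))\<^sup>2)"
        by (intro mult_left_mono sum_squares_bound) auto
      finally show "?m x y
         \<le> ?k x y"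
        unfolding sym by (simp add: algebra_simps)
    qed
    finally show "ennreal (norm (f x * osc h x))
       \<le> (\<integral>\<^sup>+ y. ennreal (?k x y) \<partial>lborel)" .
  qed
  also have "\<dots> = (\<integral>\<^sup>+ x. \<integral>\<^sup>+ y. ennreal (pi * (norm (f x))\<^sup>2) * ennreal (normal_density x e y)
          + ennreal (pi * (norm (f y))\<^sup>2) * ennreal (normal_density y e x) \<partial>lborel \<partial>lborel)"
    by (intro nn_integral_cong) (simp add: algebra_simps flip: ennreal_mult ennreal_plus)
  also have "\<dots> = (\<integral>\<^sup>+ x. \<integral>\<^sup>+ y. ennreal (pi * (norm (f x))\<^sup>2) * ennreal (normal_density x e y) \<partial>lborel \<partial>lborel)
     + (\<integral>\<^sup>+ x. \<integral>\<^sup>+ y. ennreal (pi * (norm (f y))\<^sup>2) * ennreal (normal_density y e x) \<partial>lborel \<partial>lborel)"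
    by (simp add: nn_integral_add normal_density_def)
  also have "(\<integral>\<^sup>+ x. \<integral>\<^sup>+ y. ennreal (pi * (norm (f y))\<^sup>2) * ennreal (normal_density y e x) \<partial>lborel \<partial>lborel)
     = (\<integral>\<^sup>+ x. \<integral>\<^sup>+ y. ennreal (pi * (norm (f x))\<^sup>2) * ennreal (normal_density x e y) \<partial>lborel \<partial>lborel)"
    by (rule lborel_pair.Fubini') (simp add: normal_density_def)
  also have "(\<integral>\<^sup>+ x. \<integral>\<^sup>+ y. ennreal (pi * (norm (f x))\<^sup>2) * ennreal (normal_density x e y) \<partial>lborel \<partial>lborel)
     = (\<integral>\<^sup>+ x. ennreal pi * ennreal ((norm (f x))\<^sup>2) \<partial>lborel)"
    by (simp add: nn_integral_cmult nn_integral_normal_density[OF e] ennreal_mult)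
  also have "\<dots> = ennreal pi * (\<integral>\<^sup>+ x. ennreal ((norm (f x))\<^sup>2) \<partial>lborel)"
    by (simp add: nn_integral_cmult)
  finally show ?thesis
    by (simp add: ennreal_mult distrib_right[symmetric] flip: mult_2 mult.assoc)
qed

text \<open>One half of Plancherel's theorem: remove the Gaussian factor by Fatou's lemma. The bound may be
infinite.\<close>

lemma nn_integral_osc_le:
  assumes f: "integrable lborel f"
  shows "(\<integral>\<^sup>+ x. ennreal ((norm (osc f x))\<^sup>2) \<partial>lborel)
    \<le> ennreal (2 * pi) * (\<integral>\<^sup>+ x. ennreal ((norm (f x))\<^sup>2) \<partial>lborel)"
proof -
  have [measurable]: "f \<in> borel_measurable borel" using f by auto
  define F where "F n x = ennreal ((norm (osc f x))\<^sup>2 * exp (-((inverse (real (Suc n)) * x)\<^sup>2)/2))" for n x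
  have lim: "(\<lambda>n. F n x) \<longlonglongrightarrow> ennreal ((norm (osc f x))\<^sup>2)" for x
  proof -
    have "(\<lambda>n. (norm (osc f x))\<^sup>2 * exp (-((inverse (real (Suc n)) * x)\<^sup>2)/2))
       \<longlonglongrightarrow> (norm (osc f x))\<^sup>2 * exp (-((0 * x)\<^sup>2)/2)"
      by (intro tendsto_intros LIMSEQ_inverse_real_of_nat) auto
    then show ?thesis unfolding F_def by (intro tendsto_ennrealI) simp
  qed
  have "(\<integral>\<^sup>+ x. ennreal ((norm (osc f x))\<^sup>2) \<partial>lborel) = (\<integral>\<^sup>+ x. liminf (\<lambda>n. F n x) \<partial>lborel)"
    using lim by (intro nn_integral_cong) (metis lim_imp_Liminf trivial_limit_sequentially)
  also have "\<dots> \<le> liminf (\<lambda>n. \<integral>\<^sup>+ x. F n x \<partial>lborel)"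
    by (rule nn_integral_liminf) (simp add: F_def[abs_def])
  also have "\<dots> \<le> liminf (\<lambda>n. ennreal (2 * pi) * (\<integral>\<^sup>+ x. ennreal ((norm (f x))\<^sup>2) \<partial>lborel))"
    unfolding F_def by (intro Liminf_mono always_eventually allI nn_integral_gauss_osc_le f) simp
  also have "\<dots> = ennreal (2 * pi) * (\<integral>\<^sup>+ x. ennreal ((norm (f x))\<^sup>2) \<partial>lborel)"
    by (rule Liminf_const) simp
  finally show ?thesis .
qed


section \<open>Injectivity of the transform and completeness\<close>

lemma osc_add:
  assumes "integrable lborel f" "integrable lborel g"
  shows "osc (\<lambda>y. f y + g y) x = osc f x + osc g x"
  unfolding osc_def distrib_left
  by (intro Bochner_Integration.integral_add integrable_cis_mult assms) measurable

lemma osc_diff: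
  assumes "integrable lborel f" "integrable lborel g"
  shows "osc (\<lambda>y. f y - g y) x = osc f x - osc g x"
  unfolding osc_def right_diff_distrib
  by (intro Bochner_Integration.integral_diff integrable_cis_mult assms) measurable

lemma osc_cmult: "osc (\<lambda>y. c * f y) x = c * osc f x"
  unfolding osc_def mult.left_commute[of _ c] by (rule integral_mult_right_zero)

text \<open>The positive and negative parts of \<open>h\<close> have the same transform, in particular the same mass. After
normalisation they are densities of probability measures with equal characteristic functions, hence
of equal measures.\<close>

lemma osc_eq_0_imp_AE_real:
  fixes h :: "real \<Rightarrow> real"
  assumes h: "integrable lborel h" and zero: "\<And>x. osc (\<lambda>y. of_real (h y)) x = 0"
  shows "AE x in lborel. h x = 0"
proof -
  have [measurable]: "h \<in> borel_measurable borel" using h by auto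
  define p where "p x = max 0 (h x)" for x
  define q where "q x = max 0 (- h x)" for x
  have [measurable]: "p \<in> borel_measurable borel" "q \<in> borel_measurable borel"
    unfolding p_def[abs_def] q_def[abs_def] by measurable
  have pq: "h x = p x - q x" "p x \<ge> 0" "q x \<ge> 0" for x by (auto simp: p_def q_def)
  have pi: "integrable lborel p" and qi: "integrable lborel q"
    using h unfolding p_def[abs_def] q_def[abs_def] by auto
  define c where "c = (LINT x|lborel. p x)"
  have eqosc: "osc (\<lambda>y. of_real (p y)) x = osc (\<lambda>y. of_real (q y)) x" for x
  proof -
    have "osc (\<lambda>y. of_real (p y)) x - osc (\<lambda>y. of_real (q y)) x = osc (\<lambda>y. of_real (h y)) x"
      by (subst osc_diff[symmetric]) (auto simp: pi qi pq(1))
    then show ?thesis using zero by simp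
  qed
  have cq: "c = (LINT x|lborel. q x)"
    using eqosc[of 0] unfolding osc_def c_def by simp
  have "c \<ge> 0" unfolding c_def by (intro Bochner_Integration.integral_nonneg pq)
  show ?thesis
  proof (cases "c = 0")
    case True
    have "AE x in lborel. p x = 0" "AE x in lborel. q x = 0"
      using True cq pi qi pq unfolding c_def by (auto simp: integral_nonneg_eq_0_iff_AE[symmetric])
    then show ?thesis by eventually_elim (simp add: pq(1))
  next
    case False
    with \<open>c \<ge> 0\<close> have c: "c > 0" by simp
    have distr: "real_distribution (density lborel (\<lambda>x. ennreal (r x / c)))"
      if "r \<in> borel_measurable borel" "integrable lborel r" "\<And>x. r x \<ge> 0" "(LINT x|lborel. r x) = c" for r
    proof (intro real_distribution.intro prob_spaceI real_distribution_axioms.intro)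
      show "emeasure (density lborel (\<lambda>x. ennreal (r x / c))) (space (density lborel (\<lambda>x. ennreal (r x / c)))) = 1"
        using that c by (simp add: emeasure_density nn_integral_eq_integral)
    qed simp
    have ch: "char (density lborel (\<lambda>x. ennreal (r x / c))) t = osc (\<lambda>y. of_real (r y)) t / of_real c"
      if "r \<in> borel_measurable borel" "\<And>x. r x \<ge> 0" for r t
    proof -
      have "char (density lborel (\<lambda>x. ennreal (r x / c))) t = (LINT y|lborel. (r y / c) *\<^sub>R iexp (t * y))"
        unfolding char_def using that c by (subst integral_density) auto
      also have "\<dots> = (LINT y|lborel. (cis (t * y) * of_real (r y)) / of_real c)"
        by (intro Bochner_Integration.integral_cong refl)
           (simp add: cis_conv_exp scaleR_conv_of_real)
      finally show ?thesis unfolding osc_def by simp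
    qed
    have "density lborel (\<lambda>x. ennreal (p x / c)) = density lborel (\<lambda>x. ennreal (q x / c))"
      by (intro Levy_uniqueness distr pi qi pq ext) (auto simp: ch pq eqosc c_def[symmetric] cq[symmetric])
    then have "AE x in lborel. ennreal (p x / c) = ennreal (q x / c)"
      by (subst (asm) sigma_finite_measure.density_unique_iff[OF lborel.sigma_finite_measure_axioms]) auto
    then show ?thesis
      by eventually_elim (use c pq(2,3) in \<open>simp add: pq(1) field_simps\<close>)
  qed
qed

lemma osc_eq_0_imp_AE:
  assumes f: "integrable lborel f" and zero: "\<And>x. osc f x = 0"
  shows "AE x in lborel. f x = 0"
proof -
  have add: "osc (\<lambda>y. c * f y + d * cnj (f y)) x = 0" for x c d
  proof -
    have "osc (\<lambda>y. c * f y + d * cnj (f y)) x = c * osc f x + d * osc (\<lambda>y. cnj (f y)) x"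
      by (subst osc_add) (auto simp: f osc_cmult)
    also have "\<dots> = 0" using zero cnj_osc[of f "-x"] by simp
    finally show ?thesis .
  qed
  have "AE x in lborel. Re (f x) = 0"
  proof (rule osc_eq_0_imp_AE_real)
    show "osc (\<lambda>y. of_real (Re (f y))) x = 0" for x
    proof -
      have "of_real (Re z) = (1/2) * z + (1/2) * cnj z" for z
        by (simp add: complex_eq_iff)
      then show ?thesis using add[of "1/2" "1/2" x] by simp
    qed
  qed (use f in simp)
  moreover have "AE x in lborel. Im (f x) = 0"
  proof (rule osc_eq_0_imp_AE_real)
    have "of_real (Im z) = (-\<i>/2) * z + (\<i>/2) * cnj z" for z
      by (simp add: complex_eq_iff)
    then show "osc (\<lambda>y. of_real (Im (f y))) x = 0" for x
      using add[of "-\<i>/2" "\<i>/2" x] by simp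
  qed (use f in simp)
  ultimately show ?thesis by eventually_elim (simp add: complex_eq_iff)
qed

text \<open>Completeness of \<open>L\<^sup>2\<close> together with a rate of convergence, for families indexed by a cut-off radius.
The limit is taken pointwise along radii at which the error is at most \<open>8\<^bsup>-k\<^esup>\<close>; Fatou's lemma then
gives the rate for every radius.\<close>

lemma L2_Cauchy_limit:
  fixes F :: "real \<Rightarrow> real \<Rightarrow> complex" and T :: "real \<Rightarrow> real"
  assumes [measurable]: "\<And>R. F R \<in> borel_measurable borel"
    and T: "(T \<longlongrightarrow> 0) at_top"
    and Cauchy: "\<And>R R'. R \<le> R' \<Longrightarrow> (\<integral>\<^sup>+ x. ennreal ((norm (F R' x - F R x))\<^sup>2) \<partial>lborel) \<le> ennreal (T R)"
  shows "\<exists>g\<in>borel_measurable borel. \<forall>R. (\<integral>\<^sup>+ x. ennreal ((norm (F R x - g x))\<^sup>2) \<partial>lborel) \<le> ennreal (T R)"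
proof -
  have "\<exists>r. \<forall>R\<ge>r. T R \<le> (1/8)^k" for k :: nat
  proof -
    have "eventually (\<lambda>R. T R < (1/8)^k) at_top" by (rule order_tendstoD(2)[OF T]) simp
    then show ?thesis unfolding eventually_at_top_linorder by (meson less_imp_le)
  qed
  then obtain r0 where r0: "\<And>k R. R \<ge> r0 k \<Longrightarrow> T R \<le> (1/8)^k" by metis
  \<comment> \<open>This choice is monotone in \<open>k\<close> and dominates both \<open>r0 k\<close> and \<open>k\<close>.\<close>
  define r where "r k = real k + (\<Sum>j\<le>k. \<bar>r0 j\<bar>)" for k :: nat
  have r_ge: "r0 k \<le> r k" "real k \<le> r k" for k
  proof -
    have "\<bar>r0 k\<bar> \<le> (\<Sum>j\<le>k. \<bar>r0 j\<bar>)" by (rule member_le_sum) auto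
    then show "r0 k \<le> r k" unfolding r_def by linarith
    show "real k \<le> r k" unfolding r_def by (simp add: sum_nonneg)
  qed
  have r_Suc: "r k \<le> r (Suc k)" for k unfolding r_def by simp
  define d where "d k x = norm (F (r (Suc k)) x - F (r k) x)" for k x
  have [measurable]: "d k \<in> borel_measurable borel" for k unfolding d_def[abs_def] by measurable
  \<comment> \<open>The factor \<open>4\<^sup>k\<close> still leaves a convergent series and forces \<open>d k x\<close> to decay like \<open>2\<^bsup>-k\<^esup>\<close> almost everywhere.\<close>
  have "(\<integral>\<^sup>+ x. (\<Sum>k. ennreal (4^k * (d k x)\<^sup>2)) \<partial>lborel) = (\<Sum>k. \<integral>\<^sup>+ x. ennreal (4^k * (d k x)\<^sup>2) \<partial>lborel)"
    by (intro nn_integral_suminf) measurable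
  also have "\<dots> \<le> (\<Sum>k. ennreal ((1/2)^k))"
  proof (intro suminf_le allI)
    fix k
    have "(\<integral>\<^sup>+ x. ennreal (4^k * (d k x)\<^sup>2) \<partial>lborel) = ennreal (4^k) * (\<integral>\<^sup>+ x. ennreal ((d k x)\<^sup>2) \<partial>lborel)"
      by (simp add: ennreal_mult nn_integral_cmult)
    also have "\<dots> \<le> ennreal (4^k) * ennreal ((1/8)^k)"
      unfolding d_def
      by (intro mult_left_mono order_trans[OF Cauchy[OF r_Suc]] ennreal_leI r0 r_ge) simp
    also have "\<dots> = ennreal ((1/2)^k)"
    proof -
      have "(4::real)^k * (1/8)^k = (1/2)^k" by (subst power_mult_distrib[symmetric]) simp
      then show ?thesis by (metis ennreal_mult zero_le_power zero_le_numeral zero_le_divide_1_iff)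
    qed
    finally show "(\<integral>\<^sup>+ x. ennreal (4^k * (d k x)\<^sup>2) \<partial>lborel) \<le> ennreal ((1/2)^k)" .
  qed auto
  also have "\<dots> = ennreal (\<Sum>k. (1/2)^k)"
    by (intro suminf_ennreal2) (auto intro: summable_geometric)
  also have "\<dots> < \<infinity>" by simp
  finally have fin: "(\<integral>\<^sup>+ x. (\<Sum>k. ennreal (4^k * (d k x)\<^sup>2)) \<partial>lborel) \<noteq> \<infinity>" by simp
  have "AE x in lborel. (\<Sum>k. ennreal (4^k * (d k x)\<^sup>2)) \<noteq> \<infinity>"
    by (rule nn_integral_PInf_AE[OF _ fin]) measurable
  then have conv: "AE x in lborel. convergent (\<lambda>k. F (r k) x)"
  proof eventually_elim
    fix x assume "(\<Sum>k. ennreal (4^k * (d k x)\<^sup>2)) \<noteq> \<infinity>"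
    then obtain C where C: "(\<Sum>k. ennreal (4^k * (d k x)\<^sup>2)) = ennreal C" "C \<ge> 0"
      by (metis ennreal_cases infinity_ennreal_def)
    have le: "d k x \<le> sqrt C * (1/2)^k" for k
    proof -
      have "ennreal (4^k * (d k x)\<^sup>2) \<le> ennreal C"
      proof -
        have "(\<Sum>j\<in>{k}. ennreal (4^j * (d j x)\<^sup>2)) \<le> (\<Sum>k. ennreal (4^k * (d k x)\<^sup>2))"
          by (rule sum_le_suminf) auto
        then show ?thesis unfolding C(1) by simp
      qed
      then have "(2^k * d k x)\<^sup>2 \<le> C"
      proof -
        have "(2^k * d k x)\<^sup>2 = ((2::real)\<^sup>2)^k * (d k x)\<^sup>2"
          unfolding power_mult_distrib by (simp only: power_mult[symmetric] mult.commute)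
        also have "\<dots> = 4^k * (d k x)\<^sup>2" by simp
        finally show ?thesis using \<open>ennreal (4^k * (d k x)\<^sup>2) \<le> ennreal C\<close> C(2) by (simp add: ennreal_le_iff)
      qed
      then have "2^k * d k x \<le> sqrt C" by (rule real_le_rsqrt)
      then show ?thesis by (simp add: field_simps power_divide)
    qed
    have "summable (\<lambda>k. F (r (Suc k)) x - F (r k) x)"
    proof (rule summable_comparison_test')
      show "summable (\<lambda>k. sqrt C * (1/2)^k)" by (intro summable_mult summable_geometric) simp
      show "norm (F (r (Suc k)) x - F (r k) x) \<le> sqrt C * (1/2)^k" for k
        using le[of k] unfolding d_def .
    qed
    from summable_LIMSEQ[OF this] have "convergent (\<lambda>n. \<Sum>k<n. F (r (Suc k)) x - F (r k) x)"
      by (auto simp: convergent_def)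
    then have "convergent (\<lambda>n. F (r n) x - F (r 0) x)"
      by (simp add: sum_lessThan_telescope[of "\<lambda>k. F (r k) x"])
    then show "convergent (\<lambda>k. F (r k) x)"
      using convergent_diff_const_right_iff[of "\<lambda>k. F (r k) x" "F (r 0) x"] by simp
  qed
  define g where "g x = lim (\<lambda>k. F (r k) x)" for x
  have [measurable]: "g \<in> borel_measurable borel" unfolding g_def[abs_def] by measurable
  have "(\<integral>\<^sup>+ x. ennreal ((norm (F R x - g x))\<^sup>2) \<partial>lborel) \<le> ennreal (T R)" for R
  proof -
    have "(\<integral>\<^sup>+ x. ennreal ((norm (F R x - g x))\<^sup>2) \<partial>lborel)
        = (\<integral>\<^sup>+ x. liminf (\<lambda>k. ennreal ((norm (F R x - F (r k) x))\<^sup>2)) \<partial>lborel)"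
    proof (rule nn_integral_cong_AE, use conv in eventually_elim)
      fix x assume "convergent (\<lambda>k. F (r k) x)"
      then have "(\<lambda>k. F (r k) x) \<longlonglongrightarrow> g x" unfolding g_def by (simp add: convergent_LIMSEQ_iff)
      then have "(\<lambda>k. ennreal ((norm (F R x - F (r k) x))\<^sup>2)) \<longlonglongrightarrow> ennreal ((norm (F R x - g x))\<^sup>2)"
        by (intro tendsto_intros)
      then show "ennreal ((norm (F R x - g x))\<^sup>2) = liminf (\<lambda>k. ennreal ((norm (F R x - F (r k) x))\<^sup>2))"
        by (metis lim_imp_Liminf trivial_limit_sequentially)
    qed
    also have "\<dots> \<le> liminf (\<lambda>k. \<integral>\<^sup>+ x. ennreal ((norm (F R x - F (r k) x))\<^sup>2) \<partial>lborel)"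
      by (rule nn_integral_liminf) measurable
    also have "\<dots> \<le> liminf (\<lambda>k. ennreal (T R))"
    proof (rule Liminf_mono)
      have "eventually (\<lambda>k. R \<le> real k) sequentially"
        using filterlim_real_sequentially by (auto simp: filterlim_at_top)
      then show "eventually (\<lambda>k. (\<integral>\<^sup>+ x. ennreal ((norm (F R x - F (r k) x))\<^sup>2) \<partial>lborel) \<le> ennreal (T R)) sequentially"
      proof eventually_elim
        fix k assume "R \<le> real k"
        with r_ge(2)[of k] have "R \<le> r k" by linarith
        from Cauchy[OF this] show "(\<integral>\<^sup>+ x. ennreal ((norm (F R x - F (r k) x))\<^sup>2) \<partial>lborel) \<le> ennreal (T R)"
          by (simp add: norm_minus_commute)
      qed
    qed
    also have "\<dots> = ennreal (T R)" by (rule Liminf_const) simp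
    finally show ?thesis .
  qed
  then show ?thesis by (intro bexI[of _ g]) auto
qed


section \<open>The Fourier transform on square integrable functions\<close>

lemma L2_borel_measurable: "f \<in> L2 \<Longrightarrow> f \<in> borel_measurable borel"
  by (simp add: L2_def)

lemma L2_iff: "f \<in> L2 \<longleftrightarrow> f \<in> borel_measurable borel \<and> (\<integral>\<^sup>+ x. ennreal ((norm (f x))\<^sup>2) \<partial>lborel) < \<infinity>"
  by (auto simp: L2_def integrable_iff_bounded)

lemma L2_nn: "f \<in> L2 \<Longrightarrow> (\<integral>\<^sup>+ x. ennreal ((norm (f x))\<^sup>2) \<partial>lborel) < \<infinity>"
  by (simp add: L2_iff)

lemma L2_mult_integrable:
  assumes f: "f \<in> L2" and g: "g \<in> L2"
  shows "integrable lborel (\<lambda>x. f x * g x)"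
proof -
  have [measurable]: "f \<in> borel_measurable borel" "g \<in> borel_measurable borel"
    using f g by (auto simp: L2_borel_measurable)
  have "integrable lborel (\<lambda>x. (norm (f x))\<^sup>2 + (norm (g x))\<^sup>2)"
    using f g by (auto simp: L2_def)
  then show ?thesis
  proof (rule Bochner_Integration.integrable_bound)
    show "AE x in lborel. norm (f x * g x) \<le> norm ((norm (f x))\<^sup>2 + (norm (g x))\<^sup>2)"
    proof (rule AE_I2)
      fix x
      have "norm (f x * g x) * 2 \<le> (norm (f x))\<^sup>2 + (norm (g x))\<^sup>2"
        using sum_squares_bound[of "norm (f x)" "norm (g x)"] by (simp add: norm_mult mult_ac)
      moreover have "0 \<le> norm (f x * g x)" by simp
      ultimately have "norm (f x * g x) \<le> (norm (f x))\<^sup>2 + (norm (g x))\<^sup>2" by linarith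
      then show "norm (f x * g x) \<le> norm ((norm (f x))\<^sup>2 + (norm (g x))\<^sup>2)" by simp
    qed
  qed measurable
qed

lemma L2_dominated:
  assumes f: "f \<in> L2" and [measurable]: "g \<in> borel_measurable borel"
    and le: "\<And>x. norm (g x) \<le> c * norm (f x)"
  shows "g \<in> L2"
proof -
  have "integrable lborel (\<lambda>x. c\<^sup>2 * (norm (f x))\<^sup>2)" using f by (simp add: L2_def)
  then have "integrable lborel (\<lambda>x. (norm (g x))\<^sup>2)"
    by (rule Bochner_Integration.integrable_bound)
       (auto intro!: AE_I2 simp: power_mult_distrib[symmetric] intro: power_mono le)
  then show ?thesis by (simp add: L2_def)
qed

lemma L2_cmult: "f \<in> L2 \<Longrightarrow> (\<lambda>x. c * f x) \<in> L2"
  by (rule L2_dominated[of f _ "norm c"]) (auto simp: norm_mult dest: L2_borel_measurable)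

lemma L2_diff:
  assumes f: "f \<in> L2" and g: "g \<in> L2"
  shows "(\<lambda>x. f x - g x) \<in> L2"
proof -
  have [measurable]: "f \<in> borel_measurable borel" "g \<in> borel_measurable borel"
    using f g by (auto simp: L2_borel_measurable)
  have "integrable lborel (\<lambda>x. 2 * ((norm (f x))\<^sup>2 + (norm (g x))\<^sup>2))"
    using f g by (auto simp: L2_def)
  then have "integrable lborel (\<lambda>x. (norm (f x - g x))\<^sup>2)"
  proof (rule Bochner_Integration.integrable_bound)
    show "AE x in lborel. norm ((norm (f x - g x))\<^sup>2) \<le> norm (2 * ((norm (f x))\<^sup>2 + (norm (g x))\<^sup>2))"
    proof (rule AE_I2)
      fix x
      have "(norm (f x - g x))\<^sup>2 \<le> (norm (f x) + norm (g x))\<^sup>2"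
        by (intro power_mono norm_triangle_ineq4) simp
      also have "\<dots> \<le> 2 * ((norm (f x))\<^sup>2 + (norm (g x))\<^sup>2)"
        using sum_squares_bound[of "norm (f x)" "norm (g x)"] by (simp add: power2_sum)
      finally show "norm ((norm (f x - g x))\<^sup>2) \<le> norm (2 * ((norm (f x))\<^sup>2 + (norm (g x))\<^sup>2))" by simp
    qed
  qed measurable
  then show ?thesis by (simp add: L2_def)
qed

lemma osc_L2:
  assumes "integrable lborel f" "f \<in> L2"
  shows "osc f \<in> L2"
proof -
  have "(\<integral>\<^sup>+ x. ennreal ((norm (osc f x))\<^sup>2) \<partial>lborel) < \<infinity>"
    using order.strict_trans1[OF nn_integral_osc_le[OF assms(1)]] L2_nn[OF assms(2)]
    by (simp add: ennreal_mult_less_top)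
  then show ?thesis using L2_borel_measurable[OF assms(2)] by (simp add: L2_iff)
qed

lemma L2_reflect:
  assumes f: "f \<in> L2" shows "(\<lambda>x. f (-x)) \<in> L2"
  using lborel_integrable_real_affine[of "\<lambda>x. (norm (f x))\<^sup>2" "-1" 0] f L2_borel_measurable[OF f]
  by (simp add: L2_def)

definition cut :: "real \<Rightarrow> (real \<Rightarrow> complex) \<Rightarrow> real \<Rightarrow> complex" where
  "cut R f x = indicator {-R..R} x *\<^sub>R f x"

lemma borel_measurable_cut [measurable]:
  "f \<in> borel_measurable borel \<Longrightarrow> cut R f \<in> borel_measurable borel"
  unfolding cut_def[abs_def] by measurable

lemma truncated_fourier_eq:
  "truncated_fourier R f \<xi> = (1 / sqrt (2 * pi)) *\<^sub>R osc (cut R f) (-\<xi>)"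
proof -
  have "exp (- (\<i> * complex_of_real x * complex_of_real \<xi>)) = cis (- \<xi> * x)" for x
    by (simp add: cis_conv_exp mult_ac)
  then show ?thesis
    unfolding truncated_fourier_def osc_def set_lebesgue_integral_def cut_def
    by (simp add: scaleR_conv_of_real mult_ac)
qed

lemma integrable_cut:
  assumes f: "f \<in> L2" shows "integrable lborel (cut R f)"
proof -
  have [measurable]: "f \<in> borel_measurable borel" using f by (rule L2_borel_measurable)
  have "integrable lborel (\<lambda>x. indicator {-R..R} x + (norm (f x))\<^sup>2 :: real)"
    using f by (intro Bochner_Integration.integrable_add integrable_real_indicator)
      (auto simp: L2_def emeasure_lborel_Icc_eq)
  then show ?thesis
  proof (rule Bochner_Integration.integrable_bound)
    show "AE x in lborel. norm (cut R f x) \<le> norm (indicator {-R..R} x + (norm (f x))\<^sup>2 :: real)"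
    proof (rule AE_I2)
      fix x
      have "2 * norm (f x) * 1 \<le> 1\<^sup>2 + (norm (f x))\<^sup>2"
        using sum_squares_bound[of 1 "norm (f x)"] by simp
      then have "norm (f x) \<le> 1 + (norm (f x))\<^sup>2"
        using norm_ge_zero[of "f x"] by (simp del: norm_ge_zero)
      then show "norm (cut R f x) \<le> norm (indicator {-R..R} x + (norm (f x))\<^sup>2 :: real)"
        by (auto simp: cut_def indicator_def)
    qed
  qed measurable
qed

lemma nn_integral_reflect:
  assumes [measurable]: "f \<in> borel_measurable borel"
  shows "(\<integral>\<^sup>+ x. f (-x :: real) \<partial>lborel) = (\<integral>\<^sup>+ x. f x \<partial>lborel)"
  using nn_integral_real_affine[of f "-1" 0] by simp

text \<open>The transforms of truncations form a Cauchy family because the transform is bounded on \<open>L\<^sup>2\<close>; the error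
is controlled by the tail of \<open>f\<close>.\<close>

lemma nn_integral_truncated_fourier_diff_le:
  assumes f: "f \<in> L2" and R: "R \<le> R'"
  shows "(\<integral>\<^sup>+ \<xi>. ennreal ((cmod (truncated_fourier R' f \<xi> - truncated_fourier R f \<xi>))\<^sup>2) \<partial>lborel)
    \<le> ennreal (LINT x|lborel. indicator (- {-R..R}) x * (norm (f x))\<^sup>2)"
proof -
  have [measurable]: "f \<in> borel_measurable borel" using f by (rule L2_borel_measurable)
  define h where "h x = cut R' f x - cut R f x" for x
  have h_int: "integrable lborel h" unfolding h_def by (intro Bochner_Integration.integrable_diff integrable_cut f)
  have [measurable]: "h \<in> borel_measurable borel" unfolding h_def[abs_def] by measurable
  have "(\<integral>\<^sup>+ \<xi>. ennreal ((cmod (truncated_fourier R' f \<xi> - truncated_fourier R f \<xi>))\<^sup>2) \<partial>lborel)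
      = (\<integral>\<^sup>+ \<xi>. ennreal (1 / (2 * pi)) * ennreal ((norm (osc h (-\<xi>)))\<^sup>2) \<partial>lborel)"
  proof (intro nn_integral_cong)
    fix \<xi>
    have "truncated_fourier R' f \<xi> - truncated_fourier R f \<xi> = (1 / sqrt (2 * pi)) *\<^sub>R osc h (-\<xi>)"
      unfolding truncated_fourier_eq h_def by (simp add: osc_diff integrable_cut f scaleR_diff_right)
    then show "ennreal ((cmod (truncated_fourier R' f \<xi> - truncated_fourier R f \<xi>))\<^sup>2)
        = ennreal (1 / (2 * pi)) * ennreal ((norm (osc h (-\<xi>)))\<^sup>2)"
      by (simp add: power_divide power_mult_distrib flip: ennreal_mult)
  qed
  also have "\<dots> = ennreal (1 / (2 * pi)) * (\<integral>\<^sup>+ \<xi>. ennreal ((norm (osc h \<xi>))\<^sup>2) \<partial>lborel)"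
    by (subst nn_integral_cmult) (simp_all add: nn_integral_reflect[where f="\<lambda>\<xi>. ennreal ((norm (osc h \<xi>))\<^sup>2)"])
  also have "\<dots> \<le> ennreal (1 / (2 * pi)) * (ennreal (2 * pi) * (\<integral>\<^sup>+ x. ennreal ((norm (h x))\<^sup>2) \<partial>lborel))"
    by (intro mult_left_mono nn_integral_osc_le h_int) simp
  also have "\<dots> = (\<integral>\<^sup>+ x. ennreal ((norm (h x))\<^sup>2) \<partial>lborel)"
    by (simp flip: mult.assoc ennreal_mult)
  also have "\<dots> \<le> (\<integral>\<^sup>+ x. ennreal (indicator (- {-R..R}) x * (norm (f x))\<^sup>2) \<partial>lborel)"
    using R by (intro nn_integral_mono ennreal_leI) (auto simp: h_def cut_def indicator_def)
  also have "\<dots> = ennreal (LINT x|lborel. indicator (- {-R..R}) x * (norm (f x))\<^sup>2)"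
  proof (rule nn_integral_eq_integral)
    have "integrable lborel (\<lambda>x. (norm (f x))\<^sup>2)" using f by (simp add: L2_def)
    then show "integrable lborel (\<lambda>x. indicator (- {-R..R}) x * (norm (f x))\<^sup>2)"
      by (rule Bochner_Integration.integrable_bound) (auto simp: indicator_def)
  qed auto
  finally show ?thesis .
qed

theorem has_fourier_exists:
  assumes f: "f \<in> L2"
  shows "\<exists>g. has_fourier f g"
proof -
  have fm[measurable]: "f \<in> borel_measurable borel" using f by (rule L2_borel_measurable)
  have f2: "integrable lborel (\<lambda>x. (norm (f x))\<^sup>2)" using f by (simp add: L2_def)
  define T where "T R = (LINT x|lborel. indicator (- {-R..R}) x * (norm (f x))\<^sup>2)" for R
  have Tlim: "(T \<longlongrightarrow> 0) at_top"
  proof -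
    have "(T \<longlongrightarrow> (LINT x|(lborel :: real measure). 0 :: real)) at_top"
      unfolding T_def
    proof (rule integral_dominated_convergence_at_top[where w="\<lambda>x. (norm (f x))\<^sup>2"])
      show "AE x in lborel. ((\<lambda>R. indicator (- {-R..R}) x * (norm (f x))\<^sup>2) \<longlongrightarrow> 0) at_top"
      proof (rule AE_I2, rule tendsto_eventually)
        fix x :: real
        show "\<forall>\<^sub>F R in at_top. indicator (- {-R..R}) x * (norm (f x))\<^sup>2 = (0::real)"
          using eventually_ge_at_top[of "\<bar>x\<bar>"] by eventually_elim (auto simp: indicator_def)
      qed
    qed (auto simp: indicator_def f2)
    then show ?thesis by simp
  qed
  have tf_meas[measurable]: "truncated_fourier R f \<in> borel_measurable borel" for R
    unfolding truncated_fourier_eq[abs_def] by measurable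
  obtain g where g[measurable]: "g \<in> borel_measurable borel"
    and gle: "\<And>R. (\<integral>\<^sup>+ x. ennreal ((norm (truncated_fourier R f x - g x))\<^sup>2) \<partial>lborel) \<le> ennreal (T R)"
    using L2_Cauchy_limit[of "\<lambda>R. truncated_fourier R f" T, OF tf_meas Tlim]
      nn_integral_truncated_fourier_diff_le[OF f] unfolding T_def by blast
  have lim: "((\<lambda>R. \<integral>\<^sup>+ x. ennreal ((norm (truncated_fourier R f x - g x))\<^sup>2) \<partial>lborel) \<longlongrightarrow> 0) at_top"
    by (rule tendsto_sandwich[OF _ _ tendsto_const tendsto_ennrealI[OF Tlim, simplified]])
       (auto simp: gle)
  \<comment> \<open>The limit inherits square integrability from one member of the family, here the one of radius 0.\<close>
  have "(\<lambda>x. osc (cut 0 f) (-x)) \<in> L2"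
  proof (intro L2_reflect osc_L2 integrable_cut f)
    show "cut 0 f \<in> L2" by (rule L2_dominated[OF f, of _ 1]) (auto simp: cut_def indicator_def)
  qed
  then have tf: "truncated_fourier 0 f \<in> L2"
    by (rule L2_dominated[where c="1 / sqrt (2*pi)"]) (auto simp: truncated_fourier_eq)
  have "(\<lambda>x. truncated_fourier 0 f x - g x) \<in> L2"
    using order.strict_trans1[OF gle[of 0]] by (simp add: L2_iff)
  from L2_diff[OF tf this] have "g \<in> L2" by simp
  with lim show ?thesis by (auto simp: has_fourier_def)
qed

lemma has_fourier_fourier: "f \<in> L2 \<Longrightarrow> has_fourier f (fourier f)"
  by (metis fourier_def someI_ex has_fourier_exists)


lemma norm_integral_mult_le:
  assumes f: "f \<in> L2" and g: "g \<in> L2"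
  shows "ennreal ((norm (LINT x|lborel. f x * g x))\<^sup>2)
     \<le> (\<integral>\<^sup>+ x. ennreal ((norm (f x))\<^sup>2) \<partial>lborel) * (\<integral>\<^sup>+ x. ennreal ((norm (g x))\<^sup>2) \<partial>lborel)"
proof -
  have [measurable]: "f \<in> borel_measurable borel" "g \<in> borel_measurable borel"
    using f g by (auto simp: L2_borel_measurable)
  have "ennreal ((norm (LINT x|lborel. f x * g x))\<^sup>2) = (ennreal (norm (LINT x|lborel. f x * g x)))\<^sup>2"
    by (simp add: ennreal_power)
  also have "\<dots> \<le> (\<integral>\<^sup>+ x. ennreal (norm (f x * g x)) \<partial>lborel)\<^sup>2"
    by (intro power_mono integral_norm_bound_ennreal L2_mult_integrable f g) simp
  also have "\<dots> = (\<integral>\<^sup>+ x. ennreal (norm (f x)) * ennreal (norm (g x)) \<partial>lborel)\<^sup>2"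
    by (simp add: norm_mult ennreal_mult)
  also have "\<dots> \<le> (\<integral>\<^sup>+ x. (ennreal (norm (f x)))\<^sup>2 \<partial>lborel) * (\<integral>\<^sup>+ x. (ennreal (norm (g x)))\<^sup>2 \<partial>lborel)"
    by (rule Cauchy_Schwarz_nn_integral) measurable
  finally show ?thesis by (simp add: ennreal_power)
qed

text \<open>The multiplication formula passes to the limit \<open>R \<rightarrow> \<infinity>\<close>: on the left by domination, on the right by
Cauchy-Schwarz.\<close>

lemma has_fourier_multiplication:
  fixes g \<phi> :: "real \<Rightarrow> complex"
  assumes f: "f \<in> L2" and fg: "has_fourier f g"
    and \<phi>: "integrable lborel \<phi>" "\<phi> \<in> L2"
  shows "(LINT x|lborel. f x * osc \<phi> (-x)) = sqrt (2 * pi) * (LINT \<xi>|lborel. g \<xi> * \<phi> \<xi>)"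
proof -
  have [measurable]: "f \<in> borel_measurable borel" "\<phi> \<in> borel_measurable borel"
    using f \<phi> by (auto simp: L2_borel_measurable)
  have g: "g \<in> L2" using fg by (simp add: has_fourier_def)
  have o: "(\<lambda>x. osc \<phi> (-x)) \<in> L2" using \<phi> by (intro L2_reflect osc_L2)
  define F where "F n = truncated_fourier (real n) f" for n
  let ?A = "\<integral>\<^sup>+ x. ennreal ((norm (\<phi> x))\<^sup>2) \<partial>lborel"
  let ?E = "\<lambda>n. (LINT \<xi>|lborel. F n \<xi> * \<phi> \<xi>) - (LINT \<xi>|lborel. g \<xi> * \<phi> \<xi>)"
  let ?D = "\<lambda>n. \<integral>\<^sup>+ x. ennreal ((norm (F n x - g x))\<^sup>2) \<partial>lborel"
  have cut_L2: "cut R f \<in> L2" for R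
    by (rule L2_dominated[OF f, of _ 1]) (auto simp: cut_def indicator_def)
  have F_L2: "F n \<in> L2" for n
    unfolding F_def
    by (rule L2_dominated[OF L2_reflect[OF osc_L2[OF integrable_cut[OF f] cut_L2]], of _ "1 / sqrt (2*pi)"])
       (auto simp: truncated_fourier_eq[abs_def])
  have eq: "(LINT x|lborel. cut (real n) f x * osc \<phi> (-x)) = sqrt (2 * pi) * (LINT \<xi>|lborel. F n \<xi> * \<phi> \<xi>)" for n
  proof -
    have "sqrt (2 * pi) * (LINT \<xi>|lborel. F n \<xi> * \<phi> \<xi>) = (LINT \<xi>|lborel. sqrt (2 * pi) * (F n \<xi> * \<phi> \<xi>))"
      by (rule integral_mult_right_zero[symmetric])
    also have "\<dots> = (LINT \<xi>|lborel. osc (cut n f) (-\<xi>) * \<phi> \<xi>)"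
      unfolding F_def truncated_fourier_eq by (simp add: scaleR_conv_of_real)
    also have "\<dots> = (LINT \<xi>|lborel. osc (cut n f) \<xi> * \<phi> (-\<xi>))"
      using lborel_integral_real_affine[of "-1" "\<lambda>\<xi>. osc (cut n f) \<xi> * \<phi> (-\<xi>)" 0] by simp
    also have "\<dots> = (LINT x|lborel. cut n f x * osc (\<lambda>\<xi>. \<phi> (-\<xi>)) x)"
      using lborel_integrable_real_affine[OF \<phi>(1), of "-1" 0]
      by (intro osc_multiplication integrable_cut f) auto
    finally show ?thesis by (simp add: osc_reflect)
  qed
  have lim1: "(\<lambda>n. LINT x|lborel. cut (real n) f x * osc \<phi> (-x)) \<longlonglongrightarrow> (LINT x|lborel. f x * osc \<phi> (-x))"
  proof (rule integral_dominated_convergence[where w="\<lambda>x. norm (f x * osc \<phi> (-x))"])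
    show "integrable lborel (\<lambda>x. norm (f x * osc \<phi> (-x)))"
      by (intro integrable_norm L2_mult_integrable f o)
    show "AE x in lborel. (\<lambda>n. cut (real n) f x * osc \<phi> (-x)) \<longlonglongrightarrow> f x * osc \<phi> (-x)"
    proof (rule AE_I2, rule tendsto_eventually)
      fix x :: real
      have "eventually (\<lambda>n. \<bar>x\<bar> \<le> real n) sequentially"
        using filterlim_real_sequentially by (auto simp: filterlim_at_top)
      then show "\<forall>\<^sub>F n in sequentially. cut (real n) f x * osc \<phi> (-x) = f x * osc \<phi> (-x)"
        by eventually_elim (auto simp: cut_def indicator_def)
    qed
    show "AE x in lborel. norm (cut (real n) f x * osc \<phi> (-x)) \<le> norm (f x * osc \<phi> (-x))" for n
      by (auto simp: cut_def indicator_def)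
  qed measurable
  have lim2: "(\<lambda>n. LINT \<xi>|lborel. F n \<xi> * \<phi> \<xi>) \<longlonglongrightarrow> (LINT \<xi>|lborel. g \<xi> * \<phi> \<xi>)"
  proof -
    have bound: "ennreal ((norm (?E n))\<^sup>2)
       \<le> ?A * (?D n)" for n
    proof -
      have "?E n = (LINT \<xi>|lborel. (F n \<xi> - g \<xi>) * \<phi> \<xi>)"
        by (subst Bochner_Integration.integral_diff[symmetric])
           (auto intro!: L2_mult_integrable F_L2 g \<phi> simp: algebra_simps)
      then show ?thesis
        using norm_integral_mult_le[OF L2_diff[OF F_L2 g] \<phi>(2), of n] by (simp add: mult.commute)
    qed
    have "(\<lambda>n. ?A * (?D n)) \<longlonglongrightarrow>
       ?A * 0"
    proof (rule ennreal_tendsto_cmult)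
      show "?A < top" using L2_nn[OF \<phi>(2)] by simp
      show "(\<lambda>n. ?D n) \<longlonglongrightarrow> 0"
        using fg unfolding has_fourier_def F_def
        by (intro filterlim_compose[OF _ filterlim_real_sequentially]) blast
    qed
    then have w: "(\<lambda>n. ?A * (?D n)) \<longlonglongrightarrow> 0"
      by simp
    have "(\<lambda>n. ennreal ((norm (?E n))\<^sup>2)) \<longlonglongrightarrow> ennreal 0"
      unfolding ennreal_0
      by (rule tendsto_sandwich[OF _ _ tendsto_const w]) (rule always_eventually, intro allI, rule zero_le bound)+
    then have "(\<lambda>n. (norm (?E n))\<^sup>2) \<longlonglongrightarrow> 0"
      by (subst (asm) tendsto_ennreal_iff) auto
    then have "(\<lambda>n. sqrt ((norm (?E n))\<^sup>2)) \<longlonglongrightarrow> sqrt 0"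
      by (rule tendsto_real_sqrt)
    then show ?thesis by (simp add: tendsto_norm_zero_iff LIM_zero_iff)
  qed
  show ?thesis
    by (rule LIMSEQ_unique[OF lim1]) (unfold eq, intro tendsto_intros lim2)
qed

definition gauss :: "real \<Rightarrow> complex" where
  "gauss x = of_real (exp (-(x\<^sup>2)/2))"

lemma borel_measurable_gauss [measurable]: "gauss \<in> borel_measurable borel"
  unfolding gauss_def[abs_def] by measurable

lemma integrable_gauss_shift: "integrable lborel (\<lambda>x. gauss (x + a))"
  using lborel_integrable_real_affine[of gauss 1 a] integrable_gauss1
  unfolding gauss_def[abs_def] by (simp add: add.commute)

lemma integrable_gauss_complex: "integrable lborel gauss"
  using integrable_gauss_shift[of 0] by simp

lemma norm_gauss_le: "norm (gauss x) \<le> 1"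
  by (simp add: gauss_def)

lemma L2_bounded_integrable:
  assumes f: "integrable lborel f" and le: "\<And>x. norm (f x) \<le> B"
  shows "f \<in> L2"
proof -
  have [measurable]: "f \<in> borel_measurable borel" using f by auto
  have "integrable lborel (\<lambda>x. B * norm (f x))" using f by simp
  then have "integrable lborel (\<lambda>x. (norm (f x))\<^sup>2)"
  proof (rule Bochner_Integration.integrable_bound)
    show "AE x in lborel. norm ((norm (f x))\<^sup>2) \<le> norm (B * norm (f x))"
      using le order_trans[OF norm_ge_zero le] by (auto simp: power2_eq_square abs_mult intro!: AE_I2 mult_right_mono)
  qed measurable
  then show ?thesis by (simp add: L2_def)
qed

lemma gauss_shift_L2: "(\<lambda>x. gauss (x + a)) \<in> L2"
  by (rule L2_bounded_integrable[OF integrable_gauss_shift norm_gauss_le])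

lemma gauss_modulate_L2: "(\<lambda>x. cis (a * x) * gauss x) \<in> L2"
  using gauss_shift_L2[of 0] by (rule L2_dominated[where c=1]) (auto simp: norm_mult)

lemma integrable_gauss_modulate: "integrable lborel (\<lambda>x. cis (a * x) * gauss x)"
  by (intro integrable_cis_mult integrable_gauss_complex) measurable

lemma osc_gauss_complex: "osc gauss x = of_real (sqrt (2*pi)) * gauss x"
  using osc_gauss1[of x] unfolding gauss_def[abs_def] by simp

lemma osc_shift: "osc (\<lambda>y. f (y + a)) x = cis (- a * x) * osc f x"
proof -
  have "osc f x = (LINT y|lborel. cis (x * (a + 1 * y)) * f (a + 1 * y))"
    unfolding osc_def using lborel_integral_real_affine[of 1 "\<lambda>y. cis (x * y) * f y" a] by simp
  also have "\<dots> = (LINT y|lborel. cis (a * x) * (cis (x * y) * f (y + a)))"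
    by (simp add: algebra_simps cis_mult[symmetric])
  also have "\<dots> = cis (a * x) * osc (\<lambda>y. f (y + a)) x"
    unfolding osc_def by (rule integral_mult_right_zero)
  finally show ?thesis by (simp add: cis_mult flip: mult.assoc)
qed

text \<open>Modulated Gaussians separate functions, because testing \<open>d\<close> against all of them computes the transform
of the integrable function \<open>d(x) e\<^bsup>-x\<^sup>2/2\<^esup>\<close>.\<close>

lemma gauss_tests_AE:
  assumes "integrable lborel (\<lambda>x. d x * gauss x)"
    and "\<And>a. (LINT x|lborel. d x * (cis (a * x) * gauss x)) = 0"
  shows "AE x in lborel. d x = 0"
proof -
  have "AE x in lborel. d x * gauss x = 0"
    using assms by (intro osc_eq_0_imp_AE) (simp_all add: osc_def mult.left_commute)
  then show ?thesis by (simp add: gauss_def)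
qed

lemma has_fourier_unique:
  assumes f: "f \<in> L2" and g: "has_fourier f g" and g': "has_fourier f g'"
  shows "AE \<xi> in lborel. g \<xi> = g' \<xi>"
proof -
  have L: "g \<in> L2" "g' \<in> L2" using g g' by (auto simp: has_fourier_def)
  have "AE \<xi> in lborel. g \<xi> - g' \<xi> = 0"
  proof (rule gauss_tests_AE)
    show "integrable lborel (\<lambda>x. (g x - g' x) * gauss x)"
      using gauss_shift_L2[of 0] by (intro L2_mult_integrable L2_diff L) simp
    fix a
    have "sqrt (2*pi) * (LINT x|lborel. g x * (cis (a * x) * gauss x)) = sqrt (2*pi) * (LINT x|lborel. g' x * (cis (a * x) * gauss x))"
      by (simp only: has_fourier_multiplication[OF f g integrable_gauss_modulate gauss_modulate_L2, symmetric]
        has_fourier_multiplication[OF f g' integrable_gauss_modulate gauss_modulate_L2, symmetric])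
    then have "(LINT x|lborel. g x * (cis (a * x) * gauss x)) = (LINT x|lborel. g' x * (cis (a * x) * gauss x))"
      by simp
    then show "(LINT x|lborel. (g x - g' x) * (cis (a * x) * gauss x)) = 0"
      by (simp add: left_diff_distrib L2_mult_integrable L gauss_modulate_L2)
  qed
  then show ?thesis by simp
qed

text \<open>The transform exchanges modulated and translated Gaussians. So testing the transform of \<open>osc v\<close> against
a modulated Gaussian amounts to testing \<open>osc v\<close> against a translated one, and this in turn to testing
\<open>v\<close> against the modulated one again.\<close>

theorem has_fourier_osc:
  fixes v :: "real \<Rightarrow> complex"
  assumes v: "integrable lborel v" "v \<in> L2"
  shows "has_fourier (osc v) (\<lambda>\<xi>. sqrt (2*pi) * v \<xi>)"
proof -
  have o: "osc v \<in> L2" using v by (rule osc_L2)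
  obtain g where g: "has_fourier (osc v) g" using has_fourier_exists[OF o] by blast
  have gL: "g \<in> L2" using g by (simp add: has_fourier_def)
  have vL: "(\<lambda>\<xi>. sqrt (2*pi) * v \<xi>) \<in> L2" using v by (intro L2_cmult)
  have "AE \<xi> in lborel. g \<xi> - sqrt (2*pi) * v \<xi> = 0"
  proof (rule gauss_tests_AE)
    show "integrable lborel (\<lambda>x. (g x - sqrt (2*pi) * v x) * gauss x)"
      using gauss_shift_L2[of 0] by (intro L2_mult_integrable L2_diff gL vL) simp
    fix a
    have "sqrt (2*pi) * (LINT x|lborel. g x * (cis (a * x) * gauss x))
        = (LINT x|lborel. osc v x * (sqrt (2*pi) * gauss (x + (-a))))"
    proof (subst has_fourier_multiplication[OF o g integrable_gauss_modulate gauss_modulate_L2, symmetric],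
        intro Bochner_Integration.integral_cong refl)
      fix x
      have "gauss (- x + a) = gauss (x + (-a))"
        unfolding gauss_def by (simp add: power2_commute)
      then show "osc v x * osc (\<lambda>x. cis (a * x) * gauss x) (- x) = osc v x * (sqrt (2*pi) * gauss (x + (-a)))"
        unfolding osc_modulate osc_gauss_complex by simp
    qed
    also have "\<dots> = (LINT y|lborel. v y * osc (\<lambda>x. sqrt (2*pi) * gauss (x + (-a))) y)"
      by (intro osc_multiplication v integrable_mult_right integrable_gauss_shift)
    also have "\<dots> = (LINT y|lborel. (sqrt (2*pi) * sqrt (2*pi)) * (v y * (cis (a * y) * gauss y)))"
      unfolding osc_cmult osc_shift osc_gauss_complex
      by (intro Bochner_Integration.integral_cong refl) (simp only: minus_minus of_real_mult mult_ac)
    also have "\<dots> = (sqrt (2*pi) * sqrt (2*pi)) * (LINT y|lborel. v y * (cis (a * y) * gauss y))"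
      by (rule integral_mult_right_zero)
    finally have "(LINT x|lborel. g x * (cis (a * x) * gauss x)) = sqrt (2*pi) * (LINT y|lborel. v y * (cis (a * y) * gauss y))"
      unfolding of_real_mult mult.assoc by (subst (asm) mult_cancel_left) simp
    also have "\<dots> = (LINT y|lborel. sqrt (2*pi) * v y * (cis (a * y) * gauss y))"
      unfolding mult.assoc by (rule integral_mult_right_zero[symmetric])
    finally show "(LINT x|lborel. (g x - sqrt (2*pi) * v x) * (cis (a * x) * gauss x)) = 0"
      using L2_mult_integrable[OF gL gauss_modulate_L2] L2_mult_integrable[OF vL gauss_modulate_L2]
      by (simp add: left_diff_distrib)
  qed
  then have "AE \<xi> in lborel. g \<xi> = sqrt (2*pi) * v \<xi>" by simp
  then have "(\<integral>\<^sup>+ \<xi>. ennreal ((cmod (truncated_fourier R (osc v) \<xi> - g \<xi>))\<^sup>2) \<partial>lborel)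
     = (\<integral>\<^sup>+ \<xi>. ennreal ((cmod (truncated_fourier R (osc v) \<xi> - sqrt (2*pi) * v \<xi>))\<^sup>2) \<partial>lborel)" for R
    by (intro nn_integral_cong_AE) auto
  then show ?thesis using g vL by (simp add: has_fourier_def)
qed

lemma fourier_osc:
  fixes v :: "real \<Rightarrow> complex"
  assumes v: "integrable lborel v" "v \<in> L2"
  shows "AE \<xi> in lborel. fourier (osc v) \<xi> = sqrt (2*pi) * v \<xi>"
  using has_fourier_unique[OF osc_L2[OF v] has_fourier_fourier[OF osc_L2[OF v]] has_fourier_osc[OF v]] .

text \<open>The same comparison of tests, now with the modulation on the side of \<open>f\<close>. Integrability of \<open>g\<close> makes
the right-hand side a bounded function.\<close>

theorem fourier_inversion:
  fixes g :: "real \<Rightarrow> complex"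
  assumes f: "f \<in> L2" and fg: "has_fourier f g" and g: "integrable lborel g"
  shows "AE x in lborel. f x = osc (\<lambda>\<xi>. g \<xi> / sqrt (2*pi)) x"
proof -
  define v where "v \<xi> = g \<xi> / sqrt (2*pi)" for \<xi>
  have v: "integrable lborel v" unfolding v_def using g by simp
  have [measurable]: "f \<in> borel_measurable borel" "v \<in> borel_measurable borel"
    using f v by (auto simp: L2_borel_measurable)
  have i1: "integrable lborel (\<lambda>x. osc v x * (cis (a * x) * gauss x))" for a
  proof (rule Bochner_Integration.integrable_bound)
    show "integrable lborel (\<lambda>x. (LINT y|lborel. norm (v y)) *\<^sub>R gauss x)"
      using integrable_gauss_complex by simp
    show "AE x in lborel. norm (osc v x * (cis (a * x) * gauss x)) \<le> norm ((LINT y|lborel. norm (v y)) *\<^sub>R gauss x)"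
      using norm_osc_le[OF v] by (auto simp: norm_mult intro!: AE_I2 mult_right_mono)
  qed measurable
  have i2: "integrable lborel (\<lambda>x. f x * (cis (a * x) * gauss x))" for a
    by (intro L2_mult_integrable f gauss_modulate_L2)
  have "AE x in lborel. f x - osc v x = 0"
  proof (rule gauss_tests_AE)
    show "integrable lborel (\<lambda>x. (f x - osc v x) * gauss x)"
      using Bochner_Integration.integrable_diff[OF i2[of 0] i1[of 0]] by (simp add: left_diff_distrib)
    fix a
    have "(LINT x|lborel. f x * osc (\<lambda>y. gauss (y + a)) (-x)) = sqrt (2*pi) * (LINT \<xi>|lborel. g \<xi> * gauss (\<xi> + a))"
      by (rule has_fourier_multiplication[OF f fg integrable_gauss_shift gauss_shift_L2])
    also have "(\<lambda>x. f x * osc (\<lambda>y. gauss (y + a)) (-x)) = (\<lambda>x. sqrt (2*pi) * (f x * (cis (a * x) * gauss x)))"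
      unfolding osc_shift osc_gauss_complex by (auto simp: gauss_def)
    also have "(LINT x|lborel. sqrt (2*pi) * (f x * (cis (a * x) * gauss x))) = sqrt (2*pi) * (LINT x|lborel. f x * (cis (a * x) * gauss x))"
      by (rule integral_mult_right_zero)
    finally have "(LINT x|lborel. f x * (cis (a * x) * gauss x)) = (LINT \<xi>|lborel. g \<xi> * gauss (\<xi> + a))"
      by simp
    also have "\<dots> = (LINT y|lborel. v y * osc (\<lambda>x. cis (a * x) * gauss x) y)"
      unfolding osc_modulate osc_gauss_complex v_def by simp
    also have "\<dots> = (LINT x|lborel. osc v x * (cis (a * x) * gauss x))"
      by (intro osc_multiplication[symmetric] v integrable_gauss_modulate)
    finally show "(LINT x|lborel. (f x - osc v x) * (cis (a * x) * gauss x)) = 0"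
      using i1 i2 by (simp add: left_diff_distrib)
  qed
  then show ?thesis by (simp add: v_def[abs_def])
qed

text \<open>The \<open>L\<^sup>1\<close> injectivity under a hypothesis that is insensitive to null sets, as needed for data that are
real almost everywhere.\<close>

lemma osc_AE_eq_0_imp_AE:
  assumes d: "integrable lborel d" and "AE x in lborel. osc d x = 0"
  shows "AE x in lborel. d x = 0"
proof (rule gauss_tests_AE)
  have [measurable]: "d \<in> borel_measurable borel" using d by auto
  show "integrable lborel (\<lambda>x. d x * gauss x)"
    by (rule Bochner_Integration.integrable_bound[OF d]) (auto simp: norm_mult norm_gauss_le mult_left_le)
  fix a
  have "0 = (LINT x|lborel. osc d x * gauss (x + (-a)))"
    by (rule integral_eq_zero_AE[symmetric]) (use assms(2) in auto)
  also have "\<dots> = (LINT y|lborel. d y * osc (\<lambda>x. gauss (x + (-a))) y)"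
    by (intro osc_multiplication d integrable_gauss_shift)
  also have "\<dots> = (LINT y|lborel. sqrt (2*pi) * (d y * (cis (a * y) * gauss y)))"
    unfolding osc_shift osc_gauss_complex by (simp add: mult_ac)
  also have "\<dots> = sqrt (2*pi) * (LINT y|lborel. d y * (cis (a * y) * gauss y))"
    by (rule integral_mult_right_zero)
  finally show "(LINT y|lborel. d y * (cis (a * y) * gauss y)) = 0" by simp
qed


section \<open>Convolutions in weighted spaces\<close>

definition conv :: "(real \<Rightarrow> complex) \<Rightarrow> (real \<Rightarrow> complex) \<Rightarrow> real \<Rightarrow> complex" where
  "conv f g \<xi> = (LINT y|lborel. f (\<xi> - y) * g y)"

text \<open>The bound \<open>a\<close> on the norm is kept as an argument, so that the estimates below can be stated with
explicit constants. An extended integral is used so that the predicate includes square integrability.\<close>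

definition weighted_L2_le :: "(real \<Rightarrow> real) \<Rightarrow> (real \<Rightarrow> complex) \<Rightarrow> real \<Rightarrow> bool" where
  "weighted_L2_le \<rho> f a \<longleftrightarrow> f \<in> borel_measurable borel \<and> 0 \<le> a \<and>
     (\<integral>\<^sup>+ \<xi>. ennreal ((\<rho> \<xi> * norm (f \<xi>))\<^sup>2) \<partial>lborel) \<le> ennreal (a\<^sup>2)"

lemma weighted_L2_leD:
  assumes "weighted_L2_le \<rho> f a"
  shows "f \<in> borel_measurable borel" "0 \<le> a"
    "(\<integral>\<^sup>+ \<xi>. ennreal ((\<rho> \<xi> * norm (f \<xi>))\<^sup>2) \<partial>lborel) \<le> ennreal (a\<^sup>2)"
  using assms by (auto simp: weighted_L2_le_def)

lemma weighted_L2_le_mono: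
  assumes "weighted_L2_le \<rho> f a" and [measurable]: "g \<in> borel_measurable borel"
    and "\<And>\<xi>. 0 \<le> \<rho>' \<xi>" "\<And>\<xi>. \<rho>' \<xi> * norm (g \<xi>) \<le> \<rho> \<xi> * norm (f \<xi>)" "a \<le> b"
  shows "weighted_L2_le \<rho>' g b"
proof -
  have "(\<integral>\<^sup>+ \<xi>. ennreal ((\<rho>' \<xi> * norm (g \<xi>))\<^sup>2) \<partial>lborel) \<le> (\<integral>\<^sup>+ \<xi>. ennreal ((\<rho> \<xi> * norm (f \<xi>))\<^sup>2) \<partial>lborel)"
    using assms by (intro nn_integral_mono ennreal_leI power_mono) auto
  also have "\<dots> \<le> ennreal (a\<^sup>2)" using assms by (simp add: weighted_L2_le_def)
  also have "\<dots> \<le> ennreal (b\<^sup>2)" using assms by (intro ennreal_leI power_mono) (auto simp: weighted_L2_le_def)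
  finally show ?thesis using assms by (auto simp: weighted_L2_le_def)
qed

lemma power2_add_le: "((x::real) + y)\<^sup>2 \<le> 2 * (x\<^sup>2 + y\<^sup>2)"
  using sum_squares_bound[of x y] by (simp add: power2_sum)

text \<open>A cheap substitute for Minkowski's inequality, from \<open>(x + y)\<^sup>2 \<le> 2 (x\<^sup>2 + y\<^sup>2)\<close>.\<close>

lemma weighted_L2_le_add:
  assumes f: "weighted_L2_le \<rho> f a" and g: "weighted_L2_le \<rho> g b"
    and [measurable]: "\<rho> \<in> borel_measurable borel" and pos: "\<And>\<xi>. 0 \<le> \<rho> \<xi>"
  shows "weighted_L2_le \<rho> (\<lambda>\<xi>. f \<xi> + g \<xi>) (2 * (a + b))"
proof -
  have [measurable]: "f \<in> borel_measurable borel" "g \<in> borel_measurable borel"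
    using f g by (auto dest: weighted_L2_leD)
  have ab: "0 \<le> a" "0 \<le> b" using f g by (auto dest: weighted_L2_leD)
  have "(\<integral>\<^sup>+ \<xi>. ennreal ((\<rho> \<xi> * norm (f \<xi> + g \<xi>))\<^sup>2) \<partial>lborel)
     \<le> (\<integral>\<^sup>+ \<xi>. ennreal 2 * (ennreal ((\<rho> \<xi> * norm (f \<xi>))\<^sup>2) + ennreal ((\<rho> \<xi> * norm (g \<xi>))\<^sup>2)) \<partial>lborel)"
  proof (rule nn_integral_mono)
    fix \<xi>
    have "(\<rho> \<xi> * norm (f \<xi> + g \<xi>))\<^sup>2 \<le> (\<rho> \<xi> * norm (f \<xi>) + \<rho> \<xi> * norm (g \<xi>))\<^sup>2"
      using pos[of \<xi>] norm_triangle_ineq[of "f \<xi>" "g \<xi>"]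
      by (intro power_mono) (auto simp: distrib_left[symmetric] intro!: mult_left_mono)
    also have "\<dots> \<le> 2 * ((\<rho> \<xi> * norm (f \<xi>))\<^sup>2 + (\<rho> \<xi> * norm (g \<xi>))\<^sup>2)"
      by (rule power2_add_le)
    finally have "ennreal ((\<rho> \<xi> * norm (f \<xi> + g \<xi>))\<^sup>2) \<le> ennreal (2 * ((\<rho> \<xi> * norm (f \<xi>))\<^sup>2 + (\<rho> \<xi> * norm (g \<xi>))\<^sup>2))"
      by (rule ennreal_leI)
    then show "ennreal ((\<rho> \<xi> * norm (f \<xi> + g \<xi>))\<^sup>2)
       \<le> ennreal 2 * (ennreal ((\<rho> \<xi> * norm (f \<xi>))\<^sup>2) + ennreal ((\<rho> \<xi> * norm (g \<xi>))\<^sup>2))"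
      by (subst (asm) ennreal_mult) (simp_all add: ennreal_plus)
  qed
  also have "\<dots> = ennreal 2 * ((\<integral>\<^sup>+ \<xi>. ennreal ((\<rho> \<xi> * norm (f \<xi>))\<^sup>2) \<partial>lborel) + (\<integral>\<^sup>+ \<xi>. ennreal ((\<rho> \<xi> * norm (g \<xi>))\<^sup>2) \<partial>lborel))"
    by (simp add: nn_integral_cmult nn_integral_add)
  also have "\<dots> \<le> ennreal 2 * (ennreal (a\<^sup>2) + ennreal (b\<^sup>2))"
    using f g by (intro mult_left_mono add_mono) (auto dest: weighted_L2_leD)
  also have "\<dots> = ennreal (2 * (a\<^sup>2 + b\<^sup>2))"
    by (subst ennreal_mult) (simp_all add: ennreal_plus)
  also have "\<dots> \<le> ennreal ((2 * (a + b))\<^sup>2)"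
    using ab by (intro ennreal_leI) (simp add: power2_eq_square algebra_simps)
  finally show ?thesis using ab by (auto simp: weighted_L2_le_def)
qed

lemma weighted_L2_le_cmult:
  assumes f: "weighted_L2_le \<rho> f a" and c: "norm c \<le> 1" and pos: "\<And>\<xi>. 0 \<le> \<rho> \<xi>"
  shows "weighted_L2_le \<rho> (\<lambda>\<xi>. c * f \<xi>) a"
  by (rule weighted_L2_le_mono[OF f])
     (use c pos f in \<open>auto simp: norm_mult intro!: mult_left_mono mult_left_le_one_le dest: weighted_L2_leD\<close>)

locale submultiplicative_weight =
  fixes \<rho> :: "real \<Rightarrow> real"
  assumes weight_measurable [measurable]: "\<rho> \<in> borel_measurable borel"
    and weight_pos: "\<And>\<xi>. 0 < \<rho> \<xi>"
    and weight_add: "\<And>\<xi> \<eta>. \<rho> (\<xi> + \<eta>) \<le> \<rho> \<xi> * \<rho> \<eta>"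
begin

lemma weighted_L2:
  assumes f: "weighted_L2_le \<rho> f a"
  shows "(\<lambda>\<xi>. complex_of_real (\<rho> \<xi> * norm (f \<xi>))) \<in> L2"
proof -
  have [measurable]: "f \<in> borel_measurable borel" using f by (rule weighted_L2_leD)
  have "(\<integral>\<^sup>+ \<xi>. ennreal ((\<rho> \<xi> * norm (f \<xi>))\<^sup>2) \<partial>lborel) < \<infinity>"
    using order.strict_trans1[OF weighted_L2_leD(3)[OF f]] by simp
  then show ?thesis unfolding L2_iff by (simp add: power_mult_distrib norm_mult)
qed

text \<open>By submultiplicativity the weight can be distributed over the two factors, and Cauchy-Schwarz applies
for each fixed frequency. The convolution is thus bounded pointwise, not only in an integral norm.\<close>

lemma conv_bound:
  assumes f: "weighted_L2_le \<rho> f a" and g: "weighted_L2_le \<rho> g b"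
  shows "integrable lborel (\<lambda>y. f (\<xi> - y) * g y)"
    and "\<rho> \<xi> * norm (conv f g \<xi>) \<le> a * b"
proof -
  have [measurable]: "f \<in> borel_measurable borel" "g \<in> borel_measurable borel"
    using f g by (auto dest: weighted_L2_leD)
  have ab: "0 \<le> a" "0 \<le> b" using f g by (auto dest: weighted_L2_leD)
  define F where "F y = \<rho> (\<xi> - y) * norm (f (\<xi> - y))" for y
  define G where "G y = \<rho> y * norm (g y)" for y
  have FG0: "0 \<le> F y" "0 \<le> G y" for y using weight_pos by (auto simp: F_def G_def less_imp_le)
  have [measurable]: "F \<in> borel_measurable borel" "G \<in> borel_measurable borel"
    unfolding F_def[abs_def] G_def[abs_def] by measurable
  have nF: "(\<integral>\<^sup>+ y. ennreal ((F y)\<^sup>2) \<partial>lborel) = (\<integral>\<^sup>+ y. ennreal ((\<rho> y * norm (f y))\<^sup>2) \<partial>lborel)"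
    using nn_integral_real_affine[of "\<lambda>y. ennreal ((\<rho> y * norm (f y))\<^sup>2)" "-1" \<xi>] by (simp add: F_def)
  have F2: "(\<lambda>y. complex_of_real (F y)) \<in> L2"
  proof -
    have "(\<integral>\<^sup>+ y. ennreal ((F y)\<^sup>2) \<partial>lborel) < \<infinity>"
      unfolding nF using order.strict_trans1[OF weighted_L2_leD(3)[OF f]] by simp
    then show ?thesis by (simp add: L2_iff)
  qed
  have G2: "(\<lambda>y. complex_of_real (G y)) \<in> L2"
    unfolding G_def by (rule weighted_L2[OF g])
  have FG: "integrable lborel (\<lambda>y. F y * G y)"
    using integrable_norm[OF L2_mult_integrable[OF F2 G2]] FG0 by (simp add: norm_mult)
  have "ennreal ((norm (LINT x|lborel. complex_of_real (F x) * complex_of_real (G x)))\<^sup>2) \<le> ennreal (a\<^sup>2) * ennreal (b\<^sup>2)"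
    by (rule order_trans[OF norm_integral_mult_le[OF F2 G2]], intro mult_mono)
       (use weighted_L2_leD(3)[OF f] weighted_L2_leD(3)[OF g] in \<open>simp_all add: nF G_def[symmetric]\<close>)
  also have "(LINT x|lborel. complex_of_real (F x) * complex_of_real (G x)) = of_real (LINT x|lborel. F x * G x)"
    by (simp flip: of_real_mult)
  finally have "(LINT x|lborel. F x * G x)\<^sup>2 \<le> (a * b)\<^sup>2"
    by (simp add: power_mult_distrib flip: ennreal_mult)
  then have FGle: "(LINT x|lborel. F x * G x) \<le> a * b"
    by (rule power2_le_imp_le) (use ab in simp)
  have le: "\<rho> \<xi> * norm (f (\<xi> - y) * g y) \<le> F y * G y" for y
  proof -
    have "\<rho> \<xi> \<le> \<rho> (\<xi> - y) * \<rho> y" using weight_add[of "\<xi> - y" y] by simp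
    then have "\<rho> \<xi> * (norm (f (\<xi> - y)) * norm (g y)) \<le> (\<rho> (\<xi> - y) * \<rho> y) * (norm (f (\<xi> - y)) * norm (g y))"
      by (intro mult_right_mono) auto
    then show ?thesis by (simp add: F_def G_def norm_mult mult_ac)
  qed
  show int: "integrable lborel (\<lambda>y. f (\<xi> - y) * g y)"
  proof (rule Bochner_Integration.integrable_bound)
    show "integrable lborel (\<lambda>y. F y * G y / \<rho> \<xi>)" using FG by simp
    show "AE y in lborel. norm (f (\<xi> - y) * g y) \<le> norm (F y * G y / \<rho> \<xi>)"
      using le weight_pos[of \<xi>] FG0 by (auto intro!: AE_I2 simp: field_simps)
  qed measurable
  have "\<rho> \<xi> * norm (conv f g \<xi>) \<le> \<rho> \<xi> * (LINT y|lborel. norm (f (\<xi> - y) * g y))"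
    unfolding conv_def using weight_pos[of \<xi>] by (intro mult_left_mono integral_norm_bound) auto
  also have "\<dots> = (LINT y|lborel. \<rho> \<xi> * norm (f (\<xi> - y) * g y))" by simp
  also have "\<dots> \<le> (LINT y|lborel. F y * G y)"
    using int by (intro integral_mono FG integrable_mult_right integrable_norm le)
  finally show "\<rho> \<xi> * norm (conv f g \<xi>) \<le> a * b" using FGle by simp
qed

lemma conv_diff_left:
  assumes "weighted_L2_le \<rho> f a" "weighted_L2_le \<rho> f' a'" "weighted_L2_le \<rho> g b"
  shows "conv (\<lambda>\<xi>. f \<xi> - f' \<xi>) g \<xi> = conv f g \<xi> - conv f' g \<xi>"
  unfolding conv_def left_diff_distrib
  by (intro Bochner_Integration.integral_diff conv_bound(1)[OF assms(1,3)] conv_bound(1)[OF assms(2,3)])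

lemma conv_diff_right:
  assumes "weighted_L2_le \<rho> f a" "weighted_L2_le \<rho> g b" "weighted_L2_le \<rho> g' b'"
  shows "conv f (\<lambda>\<xi>. g \<xi> - g' \<xi>) \<xi> = conv f g \<xi> - conv f g' \<xi>"
  unfolding conv_def right_diff_distrib
  by (intro Bochner_Integration.integral_diff conv_bound(1)[OF assms(1,2)] conv_bound(1)[OF assms(1,3)])

lemma conv_continuous:
  fixes f g :: "real \<Rightarrow> real \<Rightarrow> complex"
  assumes f0: "weighted_L2_le \<rho> f0 a" and g0: "weighted_L2_le \<rho> g0 b"
    and [measurable]: "\<And>t. f t \<in> borel_measurable borel" "\<And>t. g t \<in> borel_measurable borel"
    and le: "\<And>t \<xi>. norm (f t \<xi>) \<le> norm (f0 \<xi>)" "\<And>t \<xi>. norm (g t \<xi>) \<le> norm (g0 \<xi>)"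
    and cont: "\<And>\<xi>. continuous_on UNIV (\<lambda>t. f t \<xi>)" "\<And>\<xi>. continuous_on UNIV (\<lambda>t. g t \<xi>)"
  shows "continuous_on UNIV (\<lambda>t. conv (f t) (g t) \<xi>)"
  unfolding continuous_on_def
proof
  fix t :: real
  show "((\<lambda>t. conv (f t) (g t) \<xi>) \<longlongrightarrow> conv (f t) (g t) \<xi>) (at t within UNIV)"
    unfolding tendsto_at_iff_sequentially comp_def
  proof (intro allI impI)
    fix X :: "nat \<Rightarrow> real" assume X: "X \<longlonglongrightarrow> t"
    show "(\<lambda>n. conv (f (X n)) (g (X n)) \<xi>) \<longlonglongrightarrow> conv (f t) (g t) \<xi>"
      unfolding conv_def
    proof (rule integral_dominated_convergence)
      show "integrable lborel (\<lambda>y. norm (f0 (\<xi> - y) * g0 y))"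
        by (intro integrable_norm conv_bound(1)[OF f0 g0])
      show "AE y in lborel. (\<lambda>n. f (X n) (\<xi> - y) * g (X n) y) \<longlonglongrightarrow> f t (\<xi> - y) * g t y"
        by (intro AE_I2 tendsto_mult continuous_on_tendsto_compose[OF cont(1) X]
            continuous_on_tendsto_compose[OF cont(2) X]) auto
      show "AE y in lborel. norm (f (X n) (\<xi> - y) * g (X n) y) \<le> norm (f0 (\<xi> - y) * g0 y)" for n
        using le by (intro AE_I2) (auto simp: norm_mult intro!: mult_mono)
    qed measurable
  qed
qed

end

lemma borel_measurable_conv_param:
  assumes [measurable]: "case_prod f \<in> borel_measurable (borel \<Otimes>\<^sub>M borel)" "case_prod g \<in> borel_measurable (borel \<Otimes>\<^sub>M borel)"
  shows "(\<lambda>(t, \<xi>). conv (f t) (g t) \<xi>) \<in> borel_measurable (borel \<Otimes>\<^sub>M borel)"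
proof -
  have "(\<lambda>x. case_prod f (fst (fst x), snd (fst x) - snd x) * case_prod g (fst (fst x), snd x))
     \<in> borel_measurable ((borel \<Otimes>\<^sub>M borel) \<Otimes>\<^sub>M lborel)" by measurable
  then show ?thesis unfolding conv_def by (simp add: split_beta' lborel.borel_measurable_lebesgue_integral)
qed

lemma borel_measurable_conv [measurable]:
  assumes [measurable]: "f \<in> borel_measurable borel" "g \<in> borel_measurable borel"
  shows "conv f g \<in> borel_measurable borel"
  unfolding conv_def[abs_def] by measurable


section \<open>A contraction principle for weighted pointwise bounds\<close>

text \<open>Banach's fixed point theorem with distances measured by the least \<open>d\<close> such that
\<open>|z p - z' p| \<le> d * b p\<close> for all \<open>p\<close>. Equality holds at every point, not only almost everywhere, and
measurability enters through the closedness of \<open>S\<close> under such limits.\<close>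

lemma contraction_fixed_point:
  fixes \<Phi> :: "('p \<Rightarrow> complex) \<Rightarrow> 'p \<Rightarrow> complex" and b :: "'p \<Rightarrow> real"
  assumes z0: "z0 \<in> S" and maps: "\<And>z. z \<in> S \<Longrightarrow> \<Phi> z \<in> S"
    and bound: "\<And>z p. z \<in> S \<Longrightarrow> norm (z p) \<le> b p"
    and contr: "\<And>z z' d p. z \<in> S \<Longrightarrow> z' \<in> S \<Longrightarrow> 0 \<le> d \<Longrightarrow> (\<And>p. norm (z p - z' p) \<le> d * b p)
      \<Longrightarrow> norm (\<Phi> z p - \<Phi> z' p) \<le> d / 2 * b p"
    and closed: "\<And>Z z. (\<And>n. Z n \<in> S) \<Longrightarrow> (\<And>n p. norm (Z n p - z p) \<le> 4 * (1/2)^n * b p) \<Longrightarrow> z \<in> S"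
  shows "\<exists>z\<in>S. \<Phi> z = z"
proof -
  define Z where "Z n = (\<Phi> ^^ n) z0" for n
  have ZS: "Z n \<in> S" for n unfolding Z_def by (induction n) (auto simp: z0 maps)
  have b0: "0 \<le> b p" for p using order_trans[OF norm_ge_zero bound[OF z0]] .
  have step: "norm (Z (Suc n) p - Z n p) \<le> 2 * (1/2)^n * b p" for n p
  proof (induction n arbitrary: p)
    case 0
    have "norm (Z (Suc 0) p - Z 0 p) \<le> norm (Z (Suc 0) p) + norm (Z 0 p)" by (rule norm_triangle_ineq4)
    also have "\<dots> \<le> b p + b p" by (intro add_mono bound ZS)
    finally show ?case by simp
  next
    case (Suc n)
    have "norm (\<Phi> (Z (Suc n)) p - \<Phi> (Z n) p) \<le> (2 * (1/2)^n) / 2 * b p"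
      by (rule contr[OF ZS ZS _ Suc.IH]) simp
    then show ?case by (simp add: Z_def)
  qed
  have tail: "norm (Z (n + k) p - Z n p) \<le> (4 * (1/2)^n - 4 * (1/2)^(n + k)) * b p" for n k p
  proof (induction k)
    case (Suc k)
    have "norm (Z (n + Suc k) p - Z n p) \<le> norm (Z (Suc (n + k)) p - Z (n + k) p) + norm (Z (n + k) p - Z n p)"
      using norm_triangle_ineq[of "Z (Suc (n + k)) p - Z (n + k) p" "Z (n + k) p - Z n p"] by simp
    also have "\<dots> \<le> 2 * (1/2)^(n + k) * b p + (4 * (1/2)^n - 4 * (1/2)^(n + k)) * b p"
      by (intro add_mono step Suc.IH)
    also have "\<dots> = (4 * (1/2)^n - 4 * (1/2)^(n + Suc k)) * b p" by (simp add: algebra_simps)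
    finally show ?case .
  qed simp
  have tail': "norm (Z (n + k) p - Z n p) \<le> 4 * (1/2)^n * b p" for n k p
  proof -
    have "(4 * (1/2)^n - 4 * (1/2)^(n + k)) * b p \<le> 4 * (1/2)^n * b p"
      using b0[of p] by (intro mult_right_mono) auto
    then show ?thesis using tail[of n k p] by linarith
  qed
  have conv: "convergent (\<lambda>n. Z n p)" for p
  proof -
    have "summable (\<lambda>n. Z (Suc n) p - Z n p)"
    proof (rule summable_comparison_test')
      show "summable (\<lambda>n. 2 * (1/2)^n * b p)" by (intro summable_mult2 summable_mult summable_geometric) simp
      show "norm (Z (Suc n) p - Z n p) \<le> 2 * (1/2)^n * b p" for n by (rule step)
    qed
    from summable_LIMSEQ[OF this] have "convergent (\<lambda>n. \<Sum>k<n. Z (Suc k) p - Z k p)"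
      by (auto simp: convergent_def)
    then have "convergent (\<lambda>n. Z n p - Z 0 p)"
      by (simp add: sum_lessThan_telescope[of "\<lambda>k. Z k p"])
    then show ?thesis using convergent_diff_const_right_iff[of "\<lambda>k. Z k p" "Z 0 p"] by simp
  qed
  define z where "z p = lim (\<lambda>n. Z n p)" for p
  have lim: "(\<lambda>n. Z n p) \<longlonglongrightarrow> z p" for p
    using conv unfolding z_def by (simp add: convergent_LIMSEQ_iff)
  have near: "norm (Z n p - z p) \<le> 4 * (1/2)^n * b p" for n p
  proof (rule LIMSEQ_le_const2)
    show "(\<lambda>k. norm (Z n p - Z (k + n) p)) \<longlonglongrightarrow> norm (Z n p - z p)"
      by (intro tendsto_intros LIMSEQ_ignore_initial_segment lim)
    show "\<exists>N. \<forall>k\<ge>N. norm (Z n p - Z (k + n) p) \<le> 4 * (1/2)^n * b p"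
      using tail'[of n _ p] by (auto simp: norm_minus_commute add.commute)
  qed
  have zS: "z \<in> S" using closed[of Z z] ZS near by blast
  have "\<Phi> z p = z p" for p
  proof (rule LIMSEQ_unique[of "\<lambda>n. Z (Suc n) p"])
    show "(\<lambda>n. Z (Suc n) p) \<longlonglongrightarrow> z p" by (rule LIMSEQ_Suc[OF lim])
    have "(\<lambda>n. Z (Suc n) p - \<Phi> z p) \<longlonglongrightarrow> 0"
    proof (rule Lim_null_comparison[where g="\<lambda>n. 4 * (1/2)^n / 2 * b p"])
      show "\<forall>\<^sub>F n in sequentially. norm (Z (Suc n) p - \<Phi> z p) \<le> 4 * (1/2)^n / 2 * b p"
      proof (intro always_eventually allI)
        fix n
        have "norm (\<Phi> (Z n) p - \<Phi> z p) \<le> (4 * (1/2)^n) / 2 * b p"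
          by (rule contr[OF ZS zS _ near]) simp
        then show "norm (Z (Suc n) p - \<Phi> z p) \<le> 4 * (1/2)^n / 2 * b p" by (simp add: Z_def)
      qed
      have "(\<lambda>n. 4 * (1/2)^n / 2 * b p) \<longlonglongrightarrow> 4 * 0 / 2 * b p"
        by (intro tendsto_intros LIMSEQ_power_zero) auto
      then show "(\<lambda>n. 4 * (1/2)^n / 2 * b p) \<longlonglongrightarrow> 0" by simp
    qed
    then show "(\<lambda>n. Z (Suc n) p) \<longlonglongrightarrow> \<Phi> z p" by (rule LIM_zero_cancel)
  qed
  then show ?thesis using zS by (intro bexI[of _ z]) auto
qed

section \<open>The nonlinearity on the Fourier side\<close>

lemma bracket_ge_1: "1 \<le> bracket \<xi>" and bracket_pos: "0 < bracket \<xi>" and bracket_nonneg: "0 \<le> bracket \<xi>"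
  by (auto simp: bracket_def)

lemma borel_measurable_bracket [measurable]: "bracket \<in> borel_measurable borel"
  unfolding bracket_def[abs_def] by measurable

lemma bracket_add_le: "bracket (\<xi> + \<eta>) \<le> bracket \<xi> + bracket \<eta>"
  by (simp add: bracket_def abs_triangle_ineq)

lemma bracket_add_le_mult: "bracket (\<xi> + \<eta>) \<le> bracket \<xi> * bracket \<eta>"
proof -
  have "bracket \<xi> * bracket \<eta> = 1 + \<bar>\<xi>\<bar> + \<bar>\<eta>\<bar> + \<bar>\<xi>\<bar> * \<bar>\<eta>\<bar>"
    by (simp add: bracket_def algebra_simps)
  moreover have "0 \<le> \<bar>\<xi>\<bar> * \<bar>\<eta>\<bar>" by simp
  ultimately show ?thesis using abs_triangle_ineq[of \<xi> \<eta>] unfolding bracket_def[of "\<xi> + \<eta>"] by linarith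
qed

lemma nn_integral_inverse_bracket_le:
  "(\<integral>\<^sup>+ \<xi>. ennreal ((1 / bracket \<xi>)\<^sup>2) \<partial>lborel) \<le> ennreal ((sqrt pi)\<^sup>2)"
proof -
  have i: "integrable lborel (\<lambda>x::real. inverse (1 + x\<^sup>2))"
    using integrable_inverse_1_plus_square unfolding set_integrable_def by (simp add: einterval_def)
  have "(LINT x|lborel. inverse (1 + (x::real)\<^sup>2)) = pi"
    using LBINT_inverse_1_plus_square
    by (simp add: interval_lebesgue_integral_def set_lebesgue_integral_def einterval_def)
  have "(\<integral>\<^sup>+ \<xi>. ennreal ((1 / bracket \<xi>)\<^sup>2) \<partial>lborel) \<le> (\<integral>\<^sup>+ x. ennreal (inverse (1 + (x::real)\<^sup>2)) \<partial>lborel)"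
  proof (intro nn_integral_mono ennreal_leI)
    fix x :: real
    have "1 + x\<^sup>2 \<le> (bracket x)\<^sup>2" by (simp add: bracket_def power2_sum)
    then show "(1 / bracket x)\<^sup>2 \<le> inverse (1 + x\<^sup>2)"
      unfolding power_divide inverse_eq_divide by (simp add: frac_le add_pos_nonneg)
  qed
  also have "\<dots> = ennreal (LINT x|lborel. inverse (1 + (x::real)\<^sup>2))"
    by (intro nn_integral_eq_integral i AE_I2) (simp add: add_nonneg_nonneg)
  finally show ?thesis using \<open>_ = pi\<close> by simp
qed

definition gweight :: "real \<Rightarrow> real \<Rightarrow> real \<Rightarrow> real" where
  "gweight \<sigma> s \<xi> = bracket \<xi> powr s * exp (\<sigma> * bracket \<xi>)"

lemma gweight_submultiplicative:
  assumes "0 \<le> s" "0 \<le> \<sigma>" shows "submultiplicative_weight (gweight \<sigma> s)"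
proof
  show "gweight \<sigma> s \<in> borel_measurable borel" unfolding gweight_def[abs_def] by measurable
  show "0 < gweight \<sigma> s \<xi>" for \<xi> using bracket_pos[of \<xi>] by (simp add: gweight_def)
  show "gweight \<sigma> s (\<xi> + \<eta>) \<le> gweight \<sigma> s \<xi> * gweight \<sigma> s \<eta>" for \<xi> \<eta>
  proof -
    have "bracket (\<xi> + \<eta>) powr s \<le> (bracket \<xi> * bracket \<eta>) powr s"
      using assms by (intro powr_mono2 bracket_add_le_mult) (auto simp: bracket_nonneg)
    moreover have "exp (\<sigma> * bracket (\<xi> + \<eta>)) \<le> exp (\<sigma> * bracket \<xi> + \<sigma> * bracket \<eta>)"
      using assms bracket_add_le[of \<xi> \<eta>] by (simp add: mult_left_mono flip: distrib_left)
    ultimately have "gweight \<sigma> s (\<xi> + \<eta>) \<le> (bracket \<xi> * bracket \<eta>) powr s * exp (\<sigma> * bracket \<xi> + \<sigma> * bracket \<eta>)"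
      unfolding gweight_def by (intro mult_mono) auto
    then show ?thesis
      by (simp add: gweight_def powr_mult bracket_nonneg exp_add mult_ac)
  qed
qed

lemma gweight_eq_bracket_mult: "gweight \<sigma> s \<xi> = bracket \<xi> * gweight \<sigma> (s - 1) \<xi>"
  using bracket_pos[of \<xi>] by (simp add: gweight_def powr_diff)

lemma weighted_L2_le_inverse_bracket:
  assumes [measurable]: "f \<in> borel_measurable borel" "\<rho> \<in> borel_measurable borel" and "\<And>\<xi>. 0 \<le> \<rho> \<xi>" and "0 \<le> a"
    and le: "\<And>\<xi>. \<rho> \<xi> * norm (f \<xi>) \<le> a / bracket \<xi>"
  shows "weighted_L2_le \<rho> f (a * sqrt pi)"
proof -
  have "(\<integral>\<^sup>+ \<xi>. ennreal ((\<rho> \<xi> * norm (f \<xi>))\<^sup>2) \<partial>lborel) \<le> (\<integral>\<^sup>+ \<xi>. ennreal (a\<^sup>2) * ennreal ((1 / bracket \<xi>)\<^sup>2) \<partial>lborel)"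
  proof (intro nn_integral_mono)
    fix \<xi>
    have "(\<rho> \<xi> * norm (f \<xi>))\<^sup>2 \<le> (a / bracket \<xi>)\<^sup>2"
      by (intro power_mono le mult_nonneg_nonneg assms norm_ge_zero)
    also have "\<dots> = a\<^sup>2 * (1 / bracket \<xi>)\<^sup>2" by (simp add: power_divide)
    finally show "ennreal ((\<rho> \<xi> * norm (f \<xi>))\<^sup>2) \<le> ennreal (a\<^sup>2) * ennreal ((1 / bracket \<xi>)\<^sup>2)"
      by (subst ennreal_mult[symmetric]) (auto intro: ennreal_leI)
  qed
  also have "\<dots> = ennreal (a\<^sup>2) * (\<integral>\<^sup>+ \<xi>. ennreal ((1 / bracket \<xi>)\<^sup>2) \<partial>lborel)"
    by (simp add: nn_integral_cmult)
  also have "\<dots> \<le> ennreal (a\<^sup>2) * ennreal ((sqrt pi)\<^sup>2)"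
    by (intro mult_left_mono nn_integral_inverse_bracket_le) simp
  also have "\<dots> = ennreal ((a * sqrt pi)\<^sup>2)"
    by (subst ennreal_mult[symmetric]) (simp_all add: power_mult_distrib)
  finally show ?thesis using assms by (simp add: weighted_L2_le_def)
qed

lemma weighted_L2_le_0: "0 \<le> M \<Longrightarrow> weighted_L2_le \<rho> (\<lambda>\<xi>. 0) M"
  by (simp add: weighted_L2_le_def)

definition hermitian :: "(real \<Rightarrow> complex) \<Rightarrow> bool" where
  "hermitian f \<longleftrightarrow> (\<forall>\<xi>. f (-\<xi>) = cnj (f \<xi>))"

lemma hermitianD: "hermitian f \<Longrightarrow> f (-\<xi>) = cnj (f \<xi>)"
  by (simp add: hermitian_def)

lemma hermitian_conv:
  assumes f: "hermitian f" and g: "hermitian g"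
  shows "hermitian (conv f g)"
  unfolding hermitian_def
proof
  fix \<xi>
  have "conv f g (-\<xi>) = (LINT y|lborel. f (-(\<xi> - y)) * g (-y))"
    unfolding conv_def using lborel_integral_real_affine[of "-1" "\<lambda>y. f (-\<xi> - y) * g y" 0] by simp
  also have "\<dots> = (LINT y|lborel. cnj (f (\<xi> - y) * g y))"
    unfolding hermitianD[OF f] hermitianD[OF g] by simp
  also have "\<dots> = cnj (conv f g \<xi>)"
    unfolding conv_def by (rule Bochner_Integration.integral_cnj)
  finally show "conv f g (-\<xi>) = cnj (conv f g \<xi>)" .
qed

text \<open>Differentiation as it acts on the integrand of \<open>osc\<close>.\<close>

definition ddx :: "(real \<Rightarrow> complex) \<Rightarrow> real \<Rightarrow> complex" where "ddx f \<xi> = \<i> * \<xi> * f \<xi>"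

lemma borel_measurable_ddx [measurable]: "f \<in> borel_measurable borel \<Longrightarrow> ddx f \<in> borel_measurable borel"
  unfolding ddx_def[abs_def] by measurable

text \<open>An equation \<open>v\<^sub>t = - \<i> \<phi> v + N v\<close> whose dispersion relation and symbols are known only through
their growth, decay and symmetry.\<close>

locale gevrey_flow =
  fixes \<sigma> s K :: real and \<phi> :: "real \<Rightarrow> real" and p1 p2 p3 :: "real \<Rightarrow> complex"
  assumes s: "1 \<le> s" and \<sigma>: "0 < \<sigma>" and K: "0 \<le> K"
    and symbols_measurable [measurable]: "\<phi> \<in> borel_measurable borel" "p1 \<in> borel_measurable borel"
      "p2 \<in> borel_measurable borel" "p3 \<in> borel_measurable borel"
    and p1: "\<And>\<xi>. norm (p1 \<xi>) \<le> K / bracket \<xi>"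
    and p2: "\<And>\<xi>. norm (p2 \<xi>) \<le> K / (bracket \<xi>)\<^sup>2"
    and \<phi>_le: "\<And>\<xi>. \<bar>\<phi> \<xi>\<bar> \<le> K * bracket \<xi>"
    and p3: "\<And>\<xi>. norm (p3 \<xi>) \<le> K / (bracket \<xi>)\<^sup>2"
    and \<phi>_odd: "\<And>\<xi>. \<phi> (-\<xi>) = - \<phi> \<xi>"
    and p_hermitian: "hermitian p1" "hermitian p2" "hermitian p3"
begin

abbreviation w where "w \<equiv> gweight \<sigma> s"
abbreviation w' where "w' \<equiv> gweight \<sigma> (s - 1)"

sublocale W: submultiplicative_weight w
  by (rule gweight_submultiplicative) (use s \<sigma> in auto)

sublocale W': submultiplicative_weight w'
  by (rule gweight_submultiplicative) (use s \<sigma> in auto)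

text \<open>The pointwise size of the nonlinear terms. It beats the inverse weight by one factor \<open>1/\<langle>\<xi>\<rangle>\<close>, which
places it in the weighted space.\<close>

definition \<beta> :: "real \<Rightarrow> real" where "\<beta> \<xi> = 1 / (bracket \<xi> * w \<xi>)"

lemma \<beta>_pos: "0 < \<beta> \<xi>" using bracket_pos W.weight_pos by (simp add: \<beta>_def)

lemma borel_measurable_\<beta> [measurable]: "\<beta> \<in> borel_measurable borel"
  unfolding \<beta>_def[abs_def] by measurable

lemma w_eq: "w \<xi> = bracket \<xi> * w' \<xi>" by (rule gweight_eq_bracket_mult)

lemma w'_le_w: "w' \<xi> \<le> w \<xi>"
  using mult_right_mono[OF bracket_ge_1[of \<xi>] less_imp_le[OF W'.weight_pos[of \<xi>]]] by (simp add: w_eq)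

lemma weighted_L2_le_\<beta>:
  assumes [measurable]: "f \<in> borel_measurable borel" and "0 \<le> d" and le: "\<And>\<xi>. norm (f \<xi>) \<le> d * \<beta> \<xi>"
  shows "weighted_L2_le w f (d * sqrt pi)"
proof (rule weighted_L2_le_inverse_bracket)
  fix \<xi>
  have "w \<xi> * norm (f \<xi>) \<le> w \<xi> * (d * \<beta> \<xi>)"
    using W.weight_pos[of \<xi>] le by (intro mult_left_mono) auto
  then show "w \<xi> * norm (f \<xi>) \<le> d / bracket \<xi>"
    using W.weight_pos[of \<xi>] bracket_pos[of \<xi>] by (simp add: \<beta>_def field_simps)
  show "0 \<le> w \<xi>" using W.weight_pos[of \<xi>] by simp
qed (use assms in auto)

text \<open>One derivative costs one power of the bracket; this is where the weight with exponent \<open>s - 1\<close> enters,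
which is still submultiplicative.\<close>

lemma weighted_L2_le_ddx:
  assumes f: "weighted_L2_le w f a" shows "weighted_L2_le w' (ddx f) a"
proof (rule weighted_L2_le_mono[OF f])
  show "ddx f \<in> borel_measurable borel" using weighted_L2_leD(1)[OF f] by measurable
  fix \<xi>
  have "w' \<xi> * (\<bar>\<xi>\<bar> * norm (f \<xi>)) \<le> w' \<xi> * (bracket \<xi> * norm (f \<xi>))"
    using W'.weight_pos[of \<xi>] by (intro mult_left_mono mult_right_mono) (auto simp: bracket_def)
  then show "w' \<xi> * norm (ddx f \<xi>) \<le> w \<xi> * norm (f \<xi>)"
    by (simp add: ddx_def norm_mult w_eq mult_ac)
qed (use W'.weight_pos in \<open>auto simp: less_imp_le\<close>)

lemma weighted_L2_le_w':
  assumes f: "weighted_L2_le w f a" shows "weighted_L2_le w' f a"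
  by (rule weighted_L2_le_mono[OF f])
     (use weighted_L2_leD(1)[OF f] W'.weight_pos w'_le_w in \<open>auto simp: less_imp_le intro!: mult_right_mono\<close>)

text \<open>A convolution controlled by \<open>conv_bound\<close> can serve as a factor in another convolution, with respect to
the weaker weight.\<close>

lemma weighted_L2_le_conv:
  assumes [measurable]: "h \<in> borel_measurable borel" and a: "0 \<le> a" and le: "\<And>\<xi>. w \<xi> * norm (h \<xi>) \<le> a"
  shows "weighted_L2_le w' h (a * sqrt pi)"
proof (rule weighted_L2_le_inverse_bracket)
  show "w' \<xi> * norm (h \<xi>) \<le> a / bracket \<xi>" for \<xi>
    using le[of \<xi>] bracket_pos[of \<xi>] by (simp add: w_eq field_simps)
  show "0 \<le> w' \<xi>" for \<xi> using W'.weight_pos[of \<xi>] by simp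
qed (use a in auto)

definition N :: "(real \<Rightarrow> complex) \<Rightarrow> real \<Rightarrow> complex" where
  "N v \<xi> = p1 \<xi> * conv v v \<xi> + p2 \<xi> * conv (ddx v) (ddx v) \<xi> + p3 \<xi> * conv v (conv v v) \<xi>"

text \<open>Two bilinear terms contribute \<open>2 M\<close> each and the trilinear one \<open>3 M\<^sup>2 sqrt pi\<close>, where \<open>sqrt pi\<close> bounds
the \<open>L\<^sup>2\<close> norm of \<open>1/\<langle>\<xi>\<rangle>\<close>.\<close>

definition C :: "real \<Rightarrow> real" where "C M = K * (4 * M + 3 * M\<^sup>2 * sqrt pi)"

lemma C_nonneg: "0 \<le> M \<Longrightarrow> 0 \<le> C M" using K by (simp add: C_def)

lemma conv_square_diff:
  assumes "submultiplicative_weight \<rho>"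
    and f: "weighted_L2_le \<rho> f M" and g: "weighted_L2_le \<rho> g M" and fg: "weighted_L2_le \<rho> (\<lambda>\<xi>. f \<xi> - g \<xi>) d"
  shows "\<rho> \<xi> * norm (conv f f \<xi> - conv g g \<xi>) \<le> 2 * M * d"
proof -
  interpret submultiplicative_weight \<rho> by fact
  have "conv f f \<xi> - conv g g \<xi> = conv (\<lambda>\<xi>. f \<xi> - g \<xi>) f \<xi> + conv g (\<lambda>\<xi>. f \<xi> - g \<xi>) \<xi>"
    by (simp add: conv_diff_left[OF f g f] conv_diff_right[OF g f g])
  then have "\<rho> \<xi> * norm (conv f f \<xi> - conv g g \<xi>) \<le> \<rho> \<xi> * (norm (conv (\<lambda>\<xi>. f \<xi> - g \<xi>) f \<xi>) + norm (conv g (\<lambda>\<xi>. f \<xi> - g \<xi>) \<xi>))"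
    using weight_pos[of \<xi>] by (intro mult_left_mono) (auto intro: norm_triangle_ineq)
  also have "\<dots> \<le> d * M + M * d"
    unfolding distrib_left by (intro add_mono conv_bound(2) f g fg)
  finally show ?thesis by (simp add: mult_ac)
qed

text \<open>The quadratic term without derivatives gains the weight \<open>w\<close> from the convolution and \<open>1/\<langle>\<xi>\<rangle>\<close> from its
symbol. The other two terms are only controlled with respect to \<open>w/\<langle>\<xi>\<rangle>\<close>, and the stronger decay of their
symbols makes up for the missing power.\<close>

lemma N_diff:
  assumes f: "weighted_L2_le w f M" and g: "weighted_L2_le w g M" and fg: "weighted_L2_le w (\<lambda>\<xi>. f \<xi> - g \<xi>) d"
  shows "norm (N f \<xi> - N g \<xi>) \<le> C M * d * \<beta> \<xi>"
proof -
  have [measurable]: "f \<in> borel_measurable borel" "g \<in> borel_measurable borel"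
    using f g by (auto dest: weighted_L2_leD)
  have M: "0 \<le> M" and d: "0 \<le> d" using f fg by (auto dest: weighted_L2_leD)
  define B where "B = bracket \<xi>"
  define W where "W = w' \<xi>"
  have B: "0 < B" and W: "0 < W" and wBW: "w \<xi> = B * W" using bracket_pos W'.weight_pos by (auto simp: B_def W_def w_eq)
  have B1: "1 \<le> B" unfolding B_def by (rule bracket_ge_1)
  have \<beta>: "\<beta> \<xi> = 1 / (B\<^sup>2 * W)" unfolding \<beta>_def wBW by (simp add: B_def power2_eq_square mult_ac)
  have 1: "norm (p1 \<xi> * (conv f f \<xi> - conv g g \<xi>)) \<le> K * (2 * M * d) * \<beta> \<xi>"
  proof -
    have "norm (conv f f \<xi> - conv g g \<xi>) \<le> 2 * M * d / (B * W)"
      using conv_square_diff[OF W.submultiplicative_weight_axioms f g fg, of \<xi>] B W by (simp add: wBW field_simps)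
    then have "norm (p1 \<xi>) * norm (conv f f \<xi> - conv g g \<xi>) \<le> K / B * (2 * M * d / (B * W))"
      using p1[of \<xi>] M d B W K unfolding B_def[symmetric] by (intro mult_mono) auto
    then show ?thesis using B W unfolding norm_mult by (simp add: \<beta> power2_eq_square field_simps)
  qed
  have Dfg: "weighted_L2_le w' (\<lambda>\<xi>. ddx f \<xi> - ddx g \<xi>) d"
    using weighted_L2_le_ddx[OF fg] by (simp add: ddx_def[abs_def] right_diff_distrib)
  have 2: "norm (p2 \<xi> * (conv (ddx f) (ddx f) \<xi> - conv (ddx g) (ddx g) \<xi>)) \<le> K * (2 * M * d) * \<beta> \<xi>"
  proof -
    have "norm (conv (ddx f) (ddx f) \<xi> - conv (ddx g) (ddx g) \<xi>) \<le> 2 * M * d / W"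
      using conv_square_diff[OF W'.submultiplicative_weight_axioms weighted_L2_le_ddx[OF f] weighted_L2_le_ddx[OF g] Dfg, of \<xi>] W
      by (simp add: W_def field_simps)
    then have "norm (p2 \<xi>) * norm (conv (ddx f) (ddx f) \<xi> - conv (ddx g) (ddx g) \<xi>) \<le> K / B\<^sup>2 * (2 * M * d / W)"
      using p2[of \<xi>] M d B W K unfolding B_def[symmetric] by (intro mult_mono) auto
    then show ?thesis using B W unfolding norm_mult by (simp add: \<beta> field_simps)
  qed
  have f': "weighted_L2_le w' f M" and g': "weighted_L2_le w' g M" and fg': "weighted_L2_le w' (\<lambda>\<xi>. f \<xi> - g \<xi>) d"
    using f g fg by (auto intro: weighted_L2_le_w')
  have ff: "weighted_L2_le w' (conv f f) (M * M * sqrt pi)"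
    using W.conv_bound(2)[OF f f] M by (intro weighted_L2_le_conv) auto
  have gg: "weighted_L2_le w' (conv g g) (M * M * sqrt pi)"
    using W.conv_bound(2)[OF g g] M by (intro weighted_L2_le_conv) auto
  have fgd: "weighted_L2_le w' (\<lambda>\<xi>. conv f f \<xi> - conv g g \<xi>) (2 * M * d * sqrt pi)"
    using conv_square_diff[OF W.submultiplicative_weight_axioms f g fg] M d by (intro weighted_L2_le_conv) auto
  have 3: "norm (p3 \<xi> * (conv f (conv f f) \<xi> - conv g (conv g g) \<xi>)) \<le> K * (3 * M\<^sup>2 * sqrt pi * d) * \<beta> \<xi>"
  proof -
    have "conv f (conv f f) \<xi> - conv g (conv g g) \<xi>
       = conv (\<lambda>\<xi>. f \<xi> - g \<xi>) (conv f f) \<xi> + conv g (\<lambda>\<xi>. conv f f \<xi> - conv g g \<xi>) \<xi>"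
      by (simp add: W'.conv_diff_left[OF f' g' ff] W'.conv_diff_right[OF g' ff gg])
    then have "W * norm (conv f (conv f f) \<xi> - conv g (conv g g) \<xi>)
      \<le> W * (norm (conv (\<lambda>\<xi>. f \<xi> - g \<xi>) (conv f f) \<xi>) + norm (conv g (\<lambda>\<xi>. conv f f \<xi> - conv g g \<xi>) \<xi>))"
      using W by (intro mult_left_mono) (auto intro: norm_triangle_ineq)
    also have "\<dots> \<le> d * (M * M * sqrt pi) + M * (2 * M * d * sqrt pi)"
      unfolding distrib_left W_def by (intro add_mono W'.conv_bound(2) fg' ff g' fgd)
    also have "\<dots> = 3 * M\<^sup>2 * sqrt pi * d" by (simp add: power2_eq_square algebra_simps)
    finally have "norm (conv f (conv f f) \<xi> - conv g (conv g g) \<xi>) \<le> 3 * M\<^sup>2 * sqrt pi * d / W"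
      using W by (simp add: field_simps)
    then have "norm (p3 \<xi>) * norm (conv f (conv f f) \<xi> - conv g (conv g g) \<xi>) \<le> K / B\<^sup>2 * (3 * M\<^sup>2 * sqrt pi * d / W)"
      using p3[of \<xi>] M d B W K unfolding B_def[symmetric] by (intro mult_mono) auto
    then show ?thesis using B W unfolding norm_mult by (simp add: \<beta> field_simps)
  qed
  have "N f \<xi> - N g \<xi> = p1 \<xi> * (conv f f \<xi> - conv g g \<xi>) + p2 \<xi> * (conv (ddx f) (ddx f) \<xi> - conv (ddx g) (ddx g) \<xi>)
     + p3 \<xi> * (conv f (conv f f) \<xi> - conv g (conv g g) \<xi>)"
    unfolding N_def by (simp add: algebra_simps)
  also have "norm \<dots> \<le> K * (2 * M * d) * \<beta> \<xi> + K * (2 * M * d) * \<beta> \<xi> + K * (3 * M\<^sup>2 * sqrt pi * d) * \<beta> \<xi>"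
    by (intro order_trans[OF norm_triangle_ineq] add_mono 1 2 3)
  also have "\<dots> = C M * d * \<beta> \<xi>" by (simp add: C_def algebra_simps)
  finally show ?thesis .
qed

lemma N_bound:
  assumes f: "weighted_L2_le w f M"
  shows "norm (N f \<xi>) \<le> C M * M * \<beta> \<xi>"
proof -
  have "N (\<lambda>\<xi>. 0) \<xi> = 0" by (simp add: N_def conv_def ddx_def)
  moreover have "0 \<le> M" using f by (rule weighted_L2_leD)
  ultimately show ?thesis using N_diff[OF f weighted_L2_le_0, of M \<xi>] f by simp
qed

end


context gevrey_flow begin

section \<open>Local existence by contraction\<close>

lemma hermitian_N:
  assumes v: "hermitian v" shows "hermitian (N v)"
proof -
  have "hermitian (ddx v)" using v by (simp add: hermitian_def ddx_def)
  then show ?thesis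
    using hermitian_conv[OF v v] hermitian_conv[OF \<open>hermitian (ddx v)\<close> \<open>hermitian (ddx v)\<close>]
      hermitian_conv[OF v hermitian_conv[OF v v]] p_hermitian
    by (simp add: hermitian_def N_def)
qed

text \<open>\<open>M\<close> bounds the weighted norm of all iterates when \<open>r\<close> bounds that of the data. The time is chosen so
that the integral of the nonlinearity stays below \<open>\<beta>\<close> and contracts with factor one half.\<close>

definition existence_time :: "real \<Rightarrow> real" where
  "existence_time r = (let M = 2 * (r + sqrt pi) in 1 / (2 * (C M * (M + sqrt pi) + 1)))"

lemma existence_time_pos:
  assumes "0 \<le> r" shows "0 < existence_time r"
proof -
  have "0 \<le> C (2 * (r + sqrt pi)) * (2 * (r + sqrt pi) + sqrt pi)"
    using assms by (intro mult_nonneg_nonneg C_nonneg) auto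
  then show ?thesis by (simp add: existence_time_def Let_def)
qed

end

locale gevrey_data = gevrey_flow +
  fixes v0 :: "real \<Rightarrow> complex" and r :: real
  assumes v0: "weighted_L2_le w v0 r"
begin

definition M where "M = 2 * (r + sqrt pi)"
definition T where "T = existence_time r"

lemma r_nonneg: "0 \<le> r" using v0 by (rule weighted_L2_leD)
lemma M_nonneg: "0 \<le> M" using r_nonneg by (simp add: M_def)
lemma T_pos: "0 < T" unfolding T_def by (rule existence_time_pos[OF r_nonneg])

lemma T_small: "C M * M * T \<le> 1" "C M * sqrt pi * T \<le> 1/2"
proof -
  define A where "A = C M * M"
  define B where "B = C M * sqrt pi"
  have AB: "0 \<le> A" "0 \<le> B" using C_nonneg[OF M_nonneg] M_nonneg by (simp_all add: A_def B_def)
  have T: "T = 1 / (2 * (A + B + 1))"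
    unfolding T_def existence_time_def M_def[symmetric] Let_def A_def B_def by (simp only: distrib_left)
  show "C M * M * T \<le> 1" "C M * sqrt pi * T \<le> 1/2"
    unfolding T A_def[symmetric] B_def[symmetric] using AB by (simp_all add: field_simps)
qed

lemma v0_measurable [measurable]: "v0 \<in> borel_measurable borel" using v0 by (rule weighted_L2_leD)

text \<open>One function of the weighted space that dominates every iterate at every time. It is what makes
dominated convergence available throughout.\<close>

definition majorant :: "real \<Rightarrow> complex" where "majorant \<xi> = complex_of_real (norm (v0 \<xi>)) + complex_of_real (\<beta> \<xi>)"

lemma majorant_measurable [measurable]: "majorant \<in> borel_measurable borel" unfolding majorant_def[abs_def] by measurable

lemma norm_majorant: "norm (majorant \<xi>) = norm (v0 \<xi>) + \<beta> \<xi>"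
  using \<beta>_pos[of \<xi>] unfolding majorant_def of_real_add[symmetric] norm_of_real by simp

lemma weighted_majorant: "weighted_L2_le w majorant M"
proof -
  have 1: "weighted_L2_le w (\<lambda>\<xi>. complex_of_real (norm (v0 \<xi>))) r"
    by (rule weighted_L2_le_mono[OF v0]) (use W.weight_pos in \<open>auto simp: less_imp_le\<close>)
  have 2: "weighted_L2_le w (\<lambda>\<xi>. complex_of_real (\<beta> \<xi>)) (1 * sqrt pi)"
    by (rule weighted_L2_le_\<beta>) (use \<beta>_pos in \<open>auto simp: less_imp_le\<close>)
  show ?thesis
    using weighted_L2_le_add[OF 1 2 W.weight_measurable] W.weight_pos
    by (simp add: majorant_def[abs_def] M_def less_imp_le)
qed

text \<open>The perturbation \<open>z\<close> is measured in the frame that moves with the linear flow, so that the unbounded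
factor \<open>\<phi>\<close> never has to be integrated in time.\<close>

definition V :: "(real \<times> real \<Rightarrow> complex) \<Rightarrow> real \<Rightarrow> real \<Rightarrow> complex" where
  "V z t \<xi> = cis (- (t * \<phi> \<xi>)) * (v0 \<xi> + z (t, \<xi>))"

definition F :: "(real \<times> real \<Rightarrow> complex) \<Rightarrow> real \<Rightarrow> real \<Rightarrow> complex" where
  "F z t \<xi> = cis (t * \<phi> \<xi>) * N (V z t) \<xi>"

text \<open>Duhamel's integral. Stopping it at \<open>T\<close> (and at 0, where the interval becomes empty) extends the
iterates to all real times with the same bounds and continuity.\<close>

definition \<Phi> :: "(real \<times> real \<Rightarrow> complex) \<Rightarrow> real \<times> real \<Rightarrow> complex" where
  "\<Phi> z p = (LINT \<tau>:{0..min (fst p) T}|lborel. F z \<tau> (snd p))"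

definition perturbations :: "(real \<times> real \<Rightarrow> complex) set" where
  "perturbations = {z. z \<in> borel_measurable (borel \<Otimes>\<^sub>M borel) \<and> (\<forall>\<xi>. continuous_on UNIV (\<lambda>t. z (t, \<xi>))) \<and>
     (\<forall>t \<xi>. norm (z (t, \<xi>)) \<le> \<beta> \<xi>) \<and> (hermitian v0 \<longrightarrow> (\<forall>t. hermitian (\<lambda>\<xi>. z (t, \<xi>))))}"

lemma perturbationsD:
  assumes "z \<in> perturbations"
  shows "z \<in> borel_measurable (borel \<Otimes>\<^sub>M borel)" "continuous_on UNIV (\<lambda>t. z (t, \<xi>))"
    "norm (z (t, \<xi>)) \<le> \<beta> \<xi>" "hermitian v0 \<Longrightarrow> hermitian (\<lambda>\<xi>. z (t, \<xi>))"
  using assms by (auto simp: perturbations_def)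

lemma V_joint_measurable:
  assumes [measurable]: "z \<in> borel_measurable (borel \<Otimes>\<^sub>M borel)"
  shows "case_prod (V z) \<in> borel_measurable (borel \<Otimes>\<^sub>M borel)"
  unfolding V_def[abs_def] by measurable

lemma F_joint_measurable:
  assumes z: "z \<in> borel_measurable (borel \<Otimes>\<^sub>M borel)"
  shows "case_prod (F z) \<in> borel_measurable (borel \<Otimes>\<^sub>M borel)"
proof -
  note V[measurable] = V_joint_measurable[OF z]
  have DV[measurable]: "case_prod (\<lambda>t. ddx (V z t)) \<in> borel_measurable (borel \<Otimes>\<^sub>M borel)"
    unfolding ddx_def[abs_def] by measurable
  note c2[measurable] = borel_measurable_conv_param[OF V V]
  have c2': "case_prod (\<lambda>t. conv (V z t) (V z t)) \<in> borel_measurable (borel \<Otimes>\<^sub>M borel)"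
    using c2 by simp
  note [measurable] = borel_measurable_conv_param[OF DV DV] borel_measurable_conv_param[OF V c2']
  have "(\<lambda>(t, \<xi>). cis (t * \<phi> \<xi>) * (p1 \<xi> * conv (V z t) (V z t) \<xi> + p2 \<xi> * conv (ddx (V z t)) (ddx (V z t)) \<xi>
      + p3 \<xi> * conv (V z t) (conv (V z t) (V z t)) \<xi>)) \<in> borel_measurable (borel \<Otimes>\<^sub>M borel)"
    by measurable
  then show ?thesis unfolding F_def[abs_def] N_def[abs_def] by simp
qed

lemma V_measurable [measurable]:
  assumes z: "z \<in> perturbations" shows "V z t \<in> borel_measurable borel"
proof -
  note [measurable] = V_joint_measurable[OF perturbationsD(1)[OF z]]
  have "(\<lambda>\<xi>. case_prod (V z) (t, \<xi>)) \<in> borel_measurable borel" by measurable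
  then show ?thesis by simp
qed

lemma norm_V_le:
  assumes z: "z \<in> perturbations" shows "norm (V z t \<xi>) \<le> norm (majorant \<xi>)"
  using norm_triangle_ineq[of "v0 \<xi>" "z (t, \<xi>)"] perturbationsD(3)[OF z, of t \<xi>] by (simp add: V_def norm_mult norm_majorant)

lemma weighted_V:
  assumes z: "z \<in> perturbations" shows "weighted_L2_le w (V z t) M"
  by (rule weighted_L2_le_mono[OF weighted_majorant V_measurable[OF z]])
     (use W.weight_pos norm_V_le[OF z] in \<open>auto simp: less_imp_le intro!: mult_left_mono\<close>)

lemma V_continuous:
  assumes z: "z \<in> perturbations" shows "continuous_on UNIV (\<lambda>t. V z t \<xi>)"
  unfolding V_def by (intro continuous_intros perturbationsD(2)[OF z])

text \<open>Convolutions of families that are continuous in time for each frequency remain so by dominated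
convergence. For the triple convolution the inner one is dominated by its pointwise bound.\<close>

lemma F_continuous:
  assumes z: "z \<in> perturbations" shows "continuous_on A (\<lambda>t. F z t \<xi>)"
proof -
  note V[measurable] = V_measurable[OF z]
  have conv_le: "norm (conv (V z t) (V z t) \<xi>) \<le> norm (complex_of_real (M * M / w \<xi>))" for t \<xi>
    using W.conv_bound(2)[OF weighted_V[OF z, of t] weighted_V[OF z, of t], of \<xi>] W.weight_pos[of \<xi>] M_nonneg
    unfolding norm_of_real by (simp add: field_simps)
  have q: "weighted_L2_le w' (\<lambda>\<xi>. complex_of_real (M * M / w \<xi>)) (M * M * sqrt pi)"
  proof (rule weighted_L2_le_conv)
    show "w \<xi> * norm (complex_of_real (M * M / w \<xi>)) \<le> M * M" for \<xi>
      using W.weight_pos[of \<xi>] M_nonneg unfolding norm_of_real by (simp add: abs_mult abs_of_pos)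
  qed (use M_nonneg in auto)
  have c1: "continuous_on UNIV (\<lambda>t. conv (V z t) (V z t) \<xi>)" for \<xi>
    by (rule W.conv_continuous[OF weighted_majorant weighted_majorant])
       (auto simp: V norm_V_le[OF z] intro: V_continuous[OF z])
  have c2: "continuous_on UNIV (\<lambda>t. conv (ddx (V z t)) (ddx (V z t)) \<xi>)"
  proof (rule W'.conv_continuous[OF weighted_L2_le_ddx[OF weighted_majorant] weighted_L2_le_ddx[OF weighted_majorant]])
    show "continuous_on UNIV (\<lambda>t. ddx (V z t) \<xi>)" for \<xi>
      unfolding ddx_def by (intro continuous_intros V_continuous[OF z])
    then show "continuous_on UNIV (\<lambda>t. ddx (V z t) \<xi>)" for \<xi> .
    show "norm (ddx (V z t) \<xi>) \<le> norm (ddx majorant \<xi>)" for t \<xi>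
      unfolding ddx_def norm_mult by (intro mult_left_mono norm_V_le[OF z]) auto
    then show "norm (ddx (V z t) \<xi>) \<le> norm (ddx majorant \<xi>)" for t \<xi> .
  qed (auto simp: V)
  have c3: "continuous_on UNIV (\<lambda>t. conv (V z t) (conv (V z t) (V z t)) \<xi>)"
    by (rule W'.conv_continuous[OF weighted_L2_le_w'[OF weighted_majorant] q])
       (rule V norm_V_le[OF z] conv_le V_continuous[OF z] c1 borel_measurable_conv)+
  have "continuous_on UNIV (\<lambda>t. F z t \<xi>)"
    unfolding F_def N_def by (intro continuous_intros c1 c2 c3)
  then show ?thesis by (rule continuous_on_subset) simp
qed

lemma norm_F_le:
  assumes z: "z \<in> perturbations" shows "norm (F z t \<xi>) \<le> C M * M * \<beta> \<xi>"
  using N_bound[OF weighted_V[OF z]] by (simp add: F_def norm_mult)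

lemma norm_F_diff_le:
  assumes z: "z \<in> perturbations" and z': "z' \<in> perturbations" and d: "0 \<le> d" and le: "\<And>p. norm (z p - z' p) \<le> d * \<beta> (snd p)"
  shows "norm (F z t \<xi> - F z' t \<xi>) \<le> C M * (d * sqrt pi) * \<beta> \<xi>"
proof -
  have "weighted_L2_le w (\<lambda>\<xi>. V z t \<xi> - V z' t \<xi>) (d * sqrt pi)"
  proof (rule weighted_L2_le_\<beta>[OF _ d])
    show "(\<lambda>\<xi>. V z t \<xi> - V z' t \<xi>) \<in> borel_measurable borel"
      using V_measurable[OF z, of t] V_measurable[OF z', of t] by measurable
    show "norm (V z t \<xi> - V z' t \<xi>) \<le> d * \<beta> \<xi>" for \<xi>
    proof -
      have "V z t \<xi> - V z' t \<xi> = cis (- (t * \<phi> \<xi>)) * (z (t, \<xi>) - z' (t, \<xi>))"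
        by (simp add: V_def algebra_simps)
      then show ?thesis using le[of "(t, \<xi>)"] by (simp add: norm_mult)
    qed
  qed
  from N_diff[OF weighted_V[OF z] weighted_V[OF z'] this, of \<xi>]
  show ?thesis by (simp add: F_def norm_mult flip: right_diff_distrib)
qed

lemma \<Phi>_eq:
  assumes z: "z \<in> perturbations"
  shows "\<Phi> z (t, \<xi>) = integral {0..min t T} (\<lambda>\<tau>. F z \<tau> \<xi>)"
  unfolding \<Phi>_def by (simp, intro set_borel_integral_eq_integral borel_integrable_atLeastAtMost' F_continuous z)

lemma F_integrable:
  assumes z: "z \<in> perturbations" shows "(\<lambda>\<tau>. F z \<tau> \<xi>) integrable_on {a..b}"
  by (intro integrable_continuous_real F_continuous z)

lemma \<Phi>_contraction:
  assumes z: "z \<in> perturbations" and z': "z' \<in> perturbations" and d: "0 \<le> d" and le: "\<And>p. norm (z p - z' p) \<le> d * \<beta> (snd p)"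
  shows "norm (\<Phi> z p - \<Phi> z' p) \<le> d / 2 * \<beta> (snd p)"
proof (cases p)
  case (Pair t \<xi>)
  show ?thesis
  proof (cases "0 \<le> min t T")
    case True
    have "norm (\<Phi> z p - \<Phi> z' p) = norm (integral {0..min t T} (\<lambda>\<tau>. F z \<tau> \<xi> - F z' \<tau> \<xi>))"
      unfolding Pair \<Phi>_eq[OF z] \<Phi>_eq[OF z']
      by (simp add: Henstock_Kurzweil_Integration.integral_diff F_integrable z z')
    also have "\<dots> \<le> (C M * (d * sqrt pi) * \<beta> \<xi>) * (min t T - 0)"
      by (intro integral_bound True continuous_on_diff F_continuous z z' ballI norm_F_diff_le d le)
    also have "\<dots> \<le> (C M * (d * sqrt pi) * \<beta> \<xi>) * T"
      using C_nonneg[OF M_nonneg] d \<beta>_pos[of \<xi>] by (intro mult_left_mono) auto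
    also have "\<dots> = (C M * sqrt pi * T) * (d * \<beta> \<xi>)" by (simp add: mult_ac)
    also have "\<dots> \<le> 1/2 * (d * \<beta> \<xi>)"
      using T_small(2) d \<beta>_pos[of \<xi>] by (intro mult_right_mono) auto
    finally show ?thesis using Pair by simp
  next
    case False
    then show ?thesis using Pair d \<beta>_pos[of \<xi>] by (simp add: \<Phi>_eq z z')
  qed
qed

lemma norm_\<Phi>_le:
  assumes z: "z \<in> perturbations" shows "norm (\<Phi> z (t, \<xi>)) \<le> \<beta> \<xi>"
proof (cases "0 \<le> min t T")
  case True
  have "norm (\<Phi> z (t, \<xi>)) \<le> (C M * M * \<beta> \<xi>) * (min t T - 0)"
    unfolding \<Phi>_eq[OF z] by (intro integral_bound True F_continuous z ballI norm_F_le)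
  also have "\<dots> \<le> (C M * M * \<beta> \<xi>) * T"
    using C_nonneg[OF M_nonneg] M_nonneg \<beta>_pos[of \<xi>] by (intro mult_left_mono) auto
  also have "\<dots> = (C M * M * T) * \<beta> \<xi>" by (simp add: mult_ac)
  also have "\<dots> \<le> 1 * \<beta> \<xi>"
    using T_small(1) \<beta>_pos[of \<xi>] by (intro mult_right_mono) auto
  finally show ?thesis by simp
next
  case False
  then show ?thesis using \<beta>_pos[of \<xi>] by (simp add: \<Phi>_eq z)
qed

lemma \<Phi>_continuous:
  assumes z: "z \<in> perturbations" shows "continuous_on UNIV (\<lambda>t. \<Phi> z (t, \<xi>))"
proof -
  have "\<Phi> z (t, \<xi>) = integral {0..max 0 (min t T)} (\<lambda>\<tau>. F z \<tau> \<xi>)" for t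
    unfolding \<Phi>_eq[OF z] by (cases "0 \<le> min t T") (auto simp: max_def)
  moreover have "continuous_on UNIV (\<lambda>t. integral {0..max 0 (min t T)} (\<lambda>\<tau>. F z \<tau> \<xi>))"
    by (rule continuous_on_compose2[OF indefinite_integral_continuous_1[OF F_integrable[OF z], where b=T]])
       (use T_pos in \<open>auto intro!: continuous_intros\<close>)
  ultimately show ?thesis by simp
qed

lemma \<Phi>_has_vector_derivative:
  assumes z: "z \<in> perturbations" and t: "t \<in> {0..T}"
  shows "((\<lambda>t. \<Phi> z (t, \<xi>)) has_vector_derivative F z t \<xi>) (at t within {0..T})"
proof (rule has_vector_derivative_transform[OF t])
  show "((\<lambda>t. integral {0..t} (\<lambda>\<tau>. F z \<tau> \<xi>)) has_vector_derivative F z t \<xi>) (at t within {0..T})"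
    by (intro integral_has_vector_derivative F_continuous z t)
qed (simp add: \<Phi>_eq z min_absorb1)

lemma \<Phi>_in_perturbations:
  assumes z: "z \<in> perturbations" shows "\<Phi> z \<in> perturbations"
proof -
  note [measurable] = F_joint_measurable[OF perturbationsD(1)[OF z]]
  have "(\<lambda>x. (if 0 \<le> snd x \<and> snd x \<le> min (fst (fst x)) T then 1 else 0 :: real) *\<^sub>R case_prod (F z) (snd x, snd (fst x)))
     \<in> borel_measurable ((borel \<Otimes>\<^sub>M borel) \<Otimes>\<^sub>M lborel)" by measurable
  then have "(\<lambda>p. LINT \<tau>|lborel. (if 0 \<le> \<tau> \<and> \<tau> \<le> min (fst p) T then 1 else 0 :: real) *\<^sub>R F z \<tau> (snd p)) \<in> borel_measurable (borel \<Otimes>\<^sub>M borel)"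
    using lborel.borel_measurable_lebesgue_integral by (simp add: split_beta')
  then have meas: "\<Phi> z \<in> borel_measurable (borel \<Otimes>\<^sub>M borel)"
    unfolding \<Phi>_def[abs_def] set_lebesgue_integral_def by (simp add: indicator_def)
  have herm: "hermitian (\<lambda>\<xi>. \<Phi> z (t, \<xi>))" if v0h: "hermitian v0" for t
  proof -
    have "hermitian (V z \<tau>)" for \<tau>
      using hermitianD[OF v0h] hermitianD[OF perturbationsD(4)[OF z v0h]]
      by (simp add: hermitian_def V_def \<phi>_odd cis_cnj)
    then have FH: "F z \<tau> (-\<xi>) = cnj (F z \<tau> \<xi>)" for \<tau> \<xi>
      using hermitian_N[of "V z \<tau>"] by (simp add: hermitian_def F_def \<phi>_odd cis_cnj)
    show ?thesis
      unfolding hermitian_def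
    proof
      fix \<xi>
      have "\<Phi> z (t, -\<xi>) = (LINT \<tau>|lborel. cnj (indicator {0..min t T} \<tau> *\<^sub>R F z \<tau> \<xi>))"
        unfolding \<Phi>_def set_lebesgue_integral_def by (simp add: FH)
      also have "\<dots> = cnj (\<Phi> z (t, \<xi>))"
        unfolding \<Phi>_def set_lebesgue_integral_def by (subst Bochner_Integration.integral_cnj) simp
      finally show "\<Phi> z (t, -\<xi>) = cnj (\<Phi> z (t, \<xi>))" .
    qed
  qed
  show ?thesis unfolding perturbations_def using meas \<Phi>_continuous[OF z] norm_\<Phi>_le[OF z] herm by auto
qed

lemma perturbations_closed:
  assumes Z: "\<And>n. Z n \<in> perturbations" and near: "\<And>n p. norm (Z n p - z p) \<le> 4 * (1/2)^n * \<beta> (snd p)"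
  shows "z \<in> perturbations"
proof -
  have pow: "(\<lambda>n. 4 * (1/2)^n * b) \<longlonglongrightarrow> 0" for b :: real
    using tendsto_mult_left_zero[OF tendsto_mult_right_zero[OF LIMSEQ_power_zero[of "1/2::real"], of 4], of b] by simp
  have lim: "(\<lambda>n. Z n p) \<longlonglongrightarrow> z p" for p
    by (rule LIM_zero_cancel, rule Lim_null_comparison[OF _ pow[of "\<beta> (snd p)"]]) (auto simp: near)
  have "z \<in> borel_measurable (borel \<Otimes>\<^sub>M borel)"
    by (rule borel_measurable_LIMSEQ_metric[where f=Z]) (use Z lim perturbationsD(1) in auto)
  moreover have "continuous_on UNIV (\<lambda>t. z (t, \<xi>))" for \<xi>
  proof (rule uniform_limit_theorem[where F=sequentially and f="\<lambda>n t. Z n (t, \<xi>)"])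
    show "\<forall>\<^sub>F n in sequentially. continuous_on UNIV (\<lambda>t. Z n (t, \<xi>))"
      using perturbationsD(2)[OF Z] by simp
    show "uniform_limit UNIV (\<lambda>n t. Z n (t, \<xi>)) (\<lambda>t. z (t, \<xi>)) sequentially"
    proof (rule uniform_limitI)
      fix e :: real assume "0 < e"
      then have "\<forall>\<^sub>F n in sequentially. 4 * (1/2)^n * \<beta> \<xi> < e"
        by (rule order_tendstoD(2)[OF pow])
      then show "\<forall>\<^sub>F n in sequentially. \<forall>t\<in>UNIV. dist (Z n (t, \<xi>)) (z (t, \<xi>)) < e"
      proof eventually_elim
        fix n assume "4 * (1/2)^n * \<beta> \<xi> < e"
        then show "\<forall>t\<in>UNIV. dist (Z n (t, \<xi>)) (z (t, \<xi>)) < e"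
          using le_less_trans[OF near[of n "(_, \<xi>)"]] by (simp add: dist_norm)
      qed
    qed
  qed simp
  moreover have "norm (z (t, \<xi>)) \<le> \<beta> \<xi>" for t \<xi>
    using Lim_norm_ubound[OF _ lim[of "(t, \<xi>)"]] perturbationsD(3)[OF Z] by simp
  moreover have "hermitian (\<lambda>\<xi>. z (t, \<xi>))" if "hermitian v0" for t
    unfolding hermitian_def
  proof
    fix \<xi>
    have "Z n (t, -\<xi>) = cnj (Z n (t, \<xi>))" for n
      using hermitianD[OF perturbationsD(4)[OF Z that]] .
    then have "(\<lambda>n. cnj (Z n (t, \<xi>))) \<longlonglongrightarrow> z (t, -\<xi>)" using lim[of "(t, -\<xi>)"] by simp
    then show "z (t, -\<xi>) = cnj (z (t, \<xi>))"
      by (rule LIMSEQ_unique[OF _ tendsto_cnj[OF lim]])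
  qed
  ultimately show ?thesis by (auto simp: perturbations_def)
qed

theorem local_existence:
  "\<exists>v. (\<forall>t. weighted_L2_le w (v t) M) \<and> (\<forall>t \<xi>. norm (v t \<xi>) \<le> norm (majorant \<xi>)) \<and>
     (\<forall>\<xi>. continuous_on UNIV (\<lambda>t. v t \<xi>)) \<and> (\<forall>\<xi>. v 0 \<xi> = v0 \<xi>) \<and>
     (\<forall>t\<in>{0..T}. \<forall>\<xi>. ((\<lambda>t. v t \<xi>) has_vector_derivative (- (\<i> * \<phi> \<xi>) * v t \<xi> + N (v t) \<xi>)) (at t within {0..T})) \<and>
     (hermitian v0 \<longrightarrow> (\<forall>t. hermitian (v t)))"
proof -
  have "\<exists>z\<in>perturbations. \<Phi> z = z"
  proof (rule contraction_fixed_point[where b="\<lambda>p. \<beta> (snd p)"])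
    show "(\<lambda>_. 0) \<in> perturbations" using \<beta>_pos by (auto simp: perturbations_def hermitian_def less_imp_le)
    show "norm (z p) \<le> \<beta> (snd p)" if "z \<in> perturbations" for z p using perturbationsD(3)[OF that, of "fst p" "snd p"] by simp
    show "z \<in> perturbations" if "\<And>n. Z n \<in> perturbations" "\<And>n p. norm (Z n p - z p) \<le> 4 * (1/2)^n * \<beta> (snd p)" for Z z
      using that by (rule perturbations_closed)
  qed (rule \<Phi>_in_perturbations \<Phi>_contraction; assumption)+
  then obtain z where z: "z \<in> perturbations" and fixpoint: "\<Phi> z = z" by blast
  have "V z 0 \<xi> = v0 \<xi>" for \<xi>
  proof -
    have "z (0, \<xi>) = 0" using \<Phi>_eq[OF z, of 0 \<xi>] T_pos by (simp add: fixpoint min_absorb1)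
    then show ?thesis by (simp add: V_def)
  qed
  moreover have "((\<lambda>t. V z t \<xi>) has_vector_derivative (- (\<i> * \<phi> \<xi>) * V z t \<xi> + N (V z t) \<xi>)) (at t within {0..T})"
    if t: "t \<in> {0..T}" for t \<xi>
  proof -
    have 1: "((\<lambda>t. v0 \<xi> + z (t, \<xi>)) has_vector_derivative F z t \<xi>) (at t within {0..T})"
      using \<Phi>_has_vector_derivative[OF z t, of \<xi>] unfolding fixpoint by (auto intro!: derivative_eq_intros)
    have 2: "((\<lambda>t. cis (- (t * \<phi> \<xi>))) has_vector_derivative - (\<i> * \<phi> \<xi>) * cis (- (t * \<phi> \<xi>))) (at t within {0..T})"
      unfolding has_vector_derivative_def
      by (auto intro!: derivative_eq_intros simp: scaleR_conv_of_real)
    have 3: "cis (- (t * \<phi> \<xi>)) * F z t \<xi> = N (V z t) \<xi>"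
      by (simp add: F_def cis_mult flip: mult.assoc)
    show ?thesis
      using has_vector_derivative_mult[OF 2 1] unfolding V_def[of z _ \<xi>] 3 by (simp add: algebra_simps)
  qed
  moreover have "hermitian (V z t)" if v0h: "hermitian v0" for t
    using hermitianD[OF v0h] hermitianD[OF perturbationsD(4)[OF z v0h]]
    by (simp add: hermitian_def V_def \<phi>_odd cis_cnj)
  ultimately show ?thesis
    using weighted_V[OF z] norm_V_le[OF z] V_continuous[OF z] by (intro exI[of _ "V z"]) blast
qed

end


section \<open>Calculus for oscillatory integrals\<close>

lemma norm_le_normI: "0 \<le> x \<Longrightarrow> x \<le> y \<Longrightarrow> norm (x::real) \<le> norm y"
  by simp

lemma mult_le_sum_squares: "0 \<le> x * y \<Longrightarrow> (x::real) * y \<le> x\<^sup>2 + y\<^sup>2"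
  using sum_squares_bound[of x y] by simp

lemma power_le_fact_exp:
  assumes "0 \<le> (y::real)" shows "y ^ k \<le> fact k * exp y"
proof -
  have "(\<Sum>n\<in>{k}. inverse (fact n) *\<^sub>R y ^ n) \<le> (\<Sum>n. inverse (fact n) *\<^sub>R y ^ n)"
    using assms summable_exp_generic[of y] by (intro sum_le_suminf) auto
  then have "inverse (fact k) * y ^ k \<le> exp y" by (simp add: exp_def)
  then show ?thesis by (simp add: field_simps)
qed

lemma integrable_inverse_bracket_square: "integrable lborel (\<lambda>\<xi>. 1 / (bracket \<xi>)\<^sup>2)"
proof (rule integrableI_bounded)
  show "(\<integral>\<^sup>+ x. ennreal (norm (1 / (bracket x)\<^sup>2)) \<partial>lborel) < \<infinity>"
    using order.strict_trans1[OF nn_integral_inverse_bracket_le] by (simp add: power_divide)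
qed measurable

lemma integrable_bracket_exp:
  assumes c: "0 < c"
  shows "integrable lborel (\<lambda>\<xi>. bracket \<xi> ^ n * exp (- (c * bracket \<xi>)))"
proof (rule Bochner_Integration.integrable_bound)
  define A where "A = fact (n + 2) / c ^ (n + 2)"
  show "integrable lborel (\<lambda>\<xi>. A * (1 / (bracket \<xi>)\<^sup>2))"
    using integrable_inverse_bracket_square by (rule integrable_mult_right)
  show "AE \<xi> in lborel. norm (bracket \<xi> ^ n * exp (- (c * bracket \<xi>))) \<le> norm (A * (1 / (bracket \<xi>)\<^sup>2))"
  proof (rule AE_I2)
    fix \<xi>
    have b: "0 < bracket \<xi>" by (rule bracket_pos)
    have "c ^ (n + 2) * bracket \<xi> ^ (n + 2) \<le> fact (n + 2) * exp (c * bracket \<xi>)"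
      using power_le_fact_exp[of "c * bracket \<xi>" "n + 2"] b c by (simp only: power_mult_distrib) simp
    then have "bracket \<xi> ^ n * exp (- (c * bracket \<xi>)) \<le> A * (1 / (bracket \<xi>)\<^sup>2)"
      using b c by (simp add: A_def exp_minus field_simps power_add power2_eq_square del: fact_Suc)
    then show "norm (bracket \<xi> ^ n * exp (- (c * bracket \<xi>))) \<le> norm (A * (1 / (bracket \<xi>)\<^sup>2))"
      by (rule norm_le_normI[rotated]) (use b in simp)
  qed
qed measurable

lemma gweight_ge_exp:
  assumes "0 \<le> s" shows "exp (\<sigma> * bracket \<xi>) \<le> gweight \<sigma> s \<xi>"
  using ge_one_powr_ge_zero[OF bracket_ge_1 assms, of \<xi>] by (simp add: gweight_def)

text \<open>Finite moments of all orders allow \<open>osc f\<close> to be differentiated under the integral sign arbitrarily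
often.\<close>

definition rapid :: "(real \<Rightarrow> complex) \<Rightarrow> bool" where
  "rapid f \<longleftrightarrow> f \<in> borel_measurable borel \<and> (\<forall>n. integrable lborel (\<lambda>\<xi>. bracket \<xi> ^ n * norm (f \<xi>)))"

lemma rapidD:
  assumes "rapid f"
  shows "f \<in> borel_measurable borel" "integrable lborel (\<lambda>\<xi>. bracket \<xi> ^ n * norm (f \<xi>))"
  using assms by (auto simp: rapid_def)

lemma rapid_mono:
  assumes f: "rapid f" and [measurable]: "g \<in> borel_measurable borel"
    and le: "\<And>\<xi>. norm (g \<xi>) \<le> c * bracket \<xi> ^ k * norm (f \<xi>)"
  shows "rapid g"
  unfolding rapid_def
proof (intro conjI allI)
  fix n
  have [measurable]: "f \<in> borel_measurable borel" using f by (rule rapidD)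
  have "integrable lborel (\<lambda>\<xi>. c * (bracket \<xi> ^ (n + k) * norm (f \<xi>)))"
    by (intro integrable_mult_right rapidD(2)[OF f])
  then show "integrable lborel (\<lambda>\<xi>. bracket \<xi> ^ n * norm (g \<xi>))"
  proof (rule Bochner_Integration.integrable_bound)
    show "AE \<xi> in lborel. norm (bracket \<xi> ^ n * norm (g \<xi>)) \<le> norm (c * (bracket \<xi> ^ (n + k) * norm (f \<xi>)))"
    proof (rule AE_I2)
      fix \<xi>
      have "bracket \<xi> ^ n * norm (g \<xi>) \<le> bracket \<xi> ^ n * (c * bracket \<xi> ^ k * norm (f \<xi>))"
        by (intro mult_left_mono le) (simp add: bracket_nonneg)
      also have "\<dots> = c * (bracket \<xi> ^ (n + k) * norm (f \<xi>))" by (simp add: power_add mult_ac)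
      finally show "norm (bracket \<xi> ^ n * norm (g \<xi>)) \<le> norm (c * (bracket \<xi> ^ (n + k) * norm (f \<xi>)))"
        by (rule norm_le_normI[rotated]) (simp add: bracket_nonneg)
    qed
  qed measurable
qed measurable

lemma rapid_integrable: "rapid f \<Longrightarrow> integrable lborel f"
  using rapidD(2)[of f 0] rapidD(1)[of f] by (simp add: integrable_norm_iff)

lemma rapid_ddx: "rapid f \<Longrightarrow> rapid (ddx f)"
proof (rule rapid_mono[where k=1 and c=1])
  fix \<xi>
  show "norm (ddx f \<xi>) \<le> 1 * bracket \<xi> ^ 1 * norm (f \<xi>)"
    by (simp add: ddx_def norm_mult) (rule mult_right_mono, simp_all add: bracket_def)
qed (auto dest: rapidD)

lemma rapid_ddx_funpow: "rapid f \<Longrightarrow> rapid ((ddx ^^ n) f)"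
  by (induction n) (auto intro: rapid_ddx)

lemma rapid_cmult: "rapid f \<Longrightarrow> rapid (\<lambda>\<xi>. c * f \<xi>)"
  by (rule rapid_mono[of f _ "norm c" 0]) (auto simp: norm_mult dest: rapidD)

lemma rapid_add:
  assumes f: "rapid f" and g: "rapid g" shows "rapid (\<lambda>\<xi>. f \<xi> + g \<xi>)"
  unfolding rapid_def
proof (intro conjI allI)
  have [measurable]: "f \<in> borel_measurable borel" "g \<in> borel_measurable borel" using f g by (auto dest: rapidD)
  show "(\<lambda>\<xi>. f \<xi> + g \<xi>) \<in> borel_measurable borel" by measurable
  fix n
  have "integrable lborel (\<lambda>\<xi>. bracket \<xi> ^ n * norm (f \<xi>) + bracket \<xi> ^ n * norm (g \<xi>))"
    by (intro Bochner_Integration.integrable_add rapidD(2) f g)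
  then show "integrable lborel (\<lambda>\<xi>. bracket \<xi> ^ n * norm (f \<xi> + g \<xi>))"
    by (rule Bochner_Integration.integrable_bound)
       (auto intro!: AE_I2 mult_left_mono norm_triangle_ineq
         simp: bracket_nonneg abs_mult simp flip: distrib_left)
qed

lemma rapid_of_bound:
  assumes [measurable]: "f \<in> borel_measurable borel" and c: "0 < c"
    and le: "\<And>\<xi>. norm (f \<xi>) \<le> A * exp (- (c * bracket \<xi>))"
  shows "rapid f"
  unfolding rapid_def
proof (intro conjI allI)
  fix n
  have "integrable lborel (\<lambda>\<xi>. A * (bracket \<xi> ^ n * exp (- (c * bracket \<xi>))))"
    using integrable_bracket_exp[OF c] by (rule integrable_mult_right)
  then show "integrable lborel (\<lambda>\<xi>. bracket \<xi> ^ n * norm (f \<xi>))"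
  proof (rule Bochner_Integration.integrable_bound)
    show "AE \<xi> in lborel. norm (bracket \<xi> ^ n * norm (f \<xi>)) \<le> norm (A * (bracket \<xi> ^ n * exp (- (c * bracket \<xi>))))"
    proof (rule AE_I2)
      fix \<xi>
      have "bracket \<xi> ^ n * norm (f \<xi>) \<le> bracket \<xi> ^ n * (A * exp (- (c * bracket \<xi>)))"
        by (intro mult_left_mono le) (simp add: bracket_nonneg)
      also have "\<dots> = A * (bracket \<xi> ^ n * exp (- (c * bracket \<xi>)))" by simp
      finally show "norm (bracket \<xi> ^ n * norm (f \<xi>)) \<le> norm (A * (bracket \<xi> ^ n * exp (- (c * bracket \<xi>))))"
        by (rule norm_le_normI[rotated]) (simp add: bracket_nonneg)
    qed
  qed measurable
qed measurable

text \<open>The exponential weight absorbs every power of the bracket; Cauchy-Schwarz is replaced by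
\<open>x y \<le> x\<^sup>2 + y\<^sup>2\<close>.\<close>

lemma rapid_of_weighted:
  assumes f: "weighted_L2_le (gweight \<sigma> s) f a" and s: "0 \<le> s" and \<sigma>: "0 < \<sigma>"
  shows "rapid f"
  unfolding rapid_def
proof (intro conjI allI)
  interpret submultiplicative_weight "gweight \<sigma> s" by (rule gweight_submultiplicative) (use s \<sigma> in auto)
  show fm[measurable]: "f \<in> borel_measurable borel" using f by (rule weighted_L2_leD)
  fix n
  have "integrable lborel (\<lambda>\<xi>. bracket \<xi> ^ (n * 2) * exp (- ((2 * \<sigma>) * bracket \<xi>)) + (gweight \<sigma> s \<xi> * norm (f \<xi>))\<^sup>2)"
  proof (rule Bochner_Integration.integrable_add[OF integrable_bracket_exp])
    show "integrable lborel (\<lambda>\<xi>. (gweight \<sigma> s \<xi> * norm (f \<xi>))\<^sup>2)"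
      using weighted_L2[OF f] by (simp add: L2_def norm_mult power_mult_distrib)
  qed (use \<sigma> in simp)
  then show "integrable lborel (\<lambda>\<xi>. bracket \<xi> ^ n * norm (f \<xi>))"
  proof (rule Bochner_Integration.integrable_bound)
    show "AE \<xi> in lborel. norm (bracket \<xi> ^ n * norm (f \<xi>))
      \<le> norm (bracket \<xi> ^ (n * 2) * exp (- ((2 * \<sigma>) * bracket \<xi>)) + (gweight \<sigma> s \<xi> * norm (f \<xi>))\<^sup>2)"
    proof (rule AE_I2)
      fix \<xi>
      define e where "e = exp (\<sigma> * bracket \<xi>)"
      have e: "0 < e" by (simp add: e_def)
      have "bracket \<xi> ^ n * norm (f \<xi>) = (bracket \<xi> ^ n / e) * (e * norm (f \<xi>))" using e by simp
      also have "\<dots> \<le> (bracket \<xi> ^ n / e)\<^sup>2 + (e * norm (f \<xi>))\<^sup>2"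
        by (rule mult_le_sum_squares) (use e in \<open>simp add: bracket_nonneg\<close>)
      also have "(e * norm (f \<xi>))\<^sup>2 \<le> (gweight \<sigma> s \<xi> * norm (f \<xi>))\<^sup>2"
        using gweight_ge_exp[OF s, of \<sigma> \<xi>] e by (intro power_mono mult_right_mono) (auto simp: e_def)
      also have "(bracket \<xi> ^ n / e)\<^sup>2 = bracket \<xi> ^ (n * 2) * exp (- ((2 * \<sigma>) * bracket \<xi>))"
        unfolding power_divide e_def power_mult[symmetric] exp_of_nat_mult[symmetric]
        by (simp add: exp_minus divide_inverse mult_ac)
      finally show "norm (bracket \<xi> ^ n * norm (f \<xi>))
        \<le> norm (bracket \<xi> ^ (n * 2) * exp (- ((2 * \<sigma>) * bracket \<xi>)) + (gweight \<sigma> s \<xi> * norm (f \<xi>))\<^sup>2)"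
        using bracket_nonneg[of \<xi>] by (simp add: abs_mult)
    qed
  qed measurable
qed

lemma osc_product:
  assumes f: "integrable lborel f" and g: "integrable lborel g"
  shows "osc f x * osc g x = osc (conv f g) x"
proof -
  have [measurable]: "f \<in> borel_measurable borel" "g \<in> borel_measurable borel" using f g by auto
  have shift: "integrable lborel (\<lambda>\<xi>. f (\<xi> - y))" for y
    using lborel_integrable_real_affine[OF f, of 1 "-y"] by simp
  have shift_norm: "(LINT \<xi>|lborel. norm (f (\<xi> - y))) = (LINT \<xi>|lborel. norm (f \<xi>))" for y
    using lborel_integral_real_affine[of 1 "\<lambda>\<xi>. norm (f \<xi>)" "-y"] by simp
  have "integrable (lborel \<Otimes>\<^sub>M lborel) (\<lambda>(y, \<xi>). cis (x * \<xi>) * (f (\<xi> - y) * g y))"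
  proof (rule lborel_pair.Fubini_integrable)
    show "integrable lborel (\<lambda>y. LINT \<xi>|lborel. norm (case (y, \<xi>) of (y, \<xi>) \<Rightarrow> cis (x * \<xi>) * (f (\<xi> - y) * g y)))"
      using g by (simp add: norm_mult shift_norm)
    show "AE y in lborel. integrable lborel (\<lambda>\<xi>. case (y, \<xi>) of (y, \<xi>) \<Rightarrow> cis (x * \<xi>) * (f (\<xi> - y) * g y))"
      using shift by (auto intro!: integrable_cis_mult AE_I2)
  qed measurable
  from lborel_pair.Fubini_integral[OF this]
  have "(LINT \<xi>|lborel. LINT y|lborel. cis (x * \<xi>) * (f (\<xi> - y) * g y))
      = (LINT y|lborel. LINT \<xi>|lborel. cis (x * \<xi>) * (f (\<xi> - y) * g y))" .
  moreover have "(LINT y|lborel. cis (x * \<xi>) * (f (\<xi> - y) * g y)) = cis (x * \<xi>) * conv f g \<xi>" for \<xi>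
    unfolding conv_def by (rule integral_mult_right_zero)
  moreover have "(LINT \<xi>|lborel. cis (x * \<xi>) * (f (\<xi> - y) * g y)) = osc f x * (cis (x * y) * g y)" for y
  proof -
    have "(LINT \<xi>|lborel. cis (x * \<xi>) * (f (\<xi> - y) * g y))
       = (LINT \<xi>|lborel. cis (x * (y + 1 * \<xi>)) * (f (y + 1 * \<xi> - y) * g y))"
      using lborel_integral_real_affine[of 1 "\<lambda>\<xi>. cis (x * \<xi>) * (f (\<xi> - y) * g y)" y] by simp
    also have "\<dots> = (LINT \<xi>|lborel. cis (x * \<xi>) * f \<xi> * (cis (x * y) * g y))"
      by (intro Bochner_Integration.integral_cong refl) (simp add: distrib_left cis_mult[symmetric] mult_ac)
    also have "\<dots> = osc f x * (cis (x * y) * g y)"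
      unfolding osc_def by (rule integral_mult_left_zero)
    finally show ?thesis .
  qed
  ultimately show ?thesis unfolding osc_def[of g] osc_def[of "conv f g"] by simp
qed

text \<open>Differentiation under the integral sign. The mean value inequality dominates the difference quotients
by \<open>H\<close>. The set \<open>S\<close> is the whole line for space and a compact interval for time, where the derivatives
at the end points are one-sided.\<close>

lemma has_vector_derivative_integral_dominated:
  fixes f f' :: "real \<Rightarrow> real \<Rightarrow> complex"
  assumes S: "convex S" and t: "t \<in> S"
    and int: "\<And>r. r \<in> S \<Longrightarrow> integrable lborel (f r)"
    and [measurable]: "f' t \<in> borel_measurable borel"
    and der: "\<And>r \<xi>. r \<in> S \<Longrightarrow> ((\<lambda>r. f r \<xi>) has_vector_derivative f' r \<xi>) (at r within S)"
    and bound: "\<And>r \<xi>. r \<in> S \<Longrightarrow> norm (f' r \<xi>) \<le> H \<xi>" and H: "integrable lborel H"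
  shows "((\<lambda>r. LINT \<xi>|lborel. f r \<xi>) has_vector_derivative (LINT \<xi>|lborel. f' t \<xi>)) (at t within S)"
proof -
  have int': "integrable lborel (f' t)"
  proof (rule Bochner_Integration.integrable_bound[OF H])
    show "AE \<xi> in lborel. norm (f' t \<xi>) \<le> norm (H \<xi>)"
      using bound[OF t] by (intro AE_I2) (metis abs_ge_self order_trans real_norm_def)
  qed simp
  have lip: "norm (f r \<xi> - f t \<xi>) \<le> H \<xi> * norm (r - t)" if "r \<in> S" for r \<xi>
  proof (rule differentiable_bound[OF S _ _ that t])
    show "((\<lambda>r. f r \<xi>) has_derivative (\<lambda>h. h *\<^sub>R f' r \<xi>)) (at r within S)" if "r \<in> S" for r
      using der[OF that] by (simp add: has_vector_derivative_def)
    show "onorm (\<lambda>h. h *\<^sub>R f' r \<xi>) \<le> H \<xi>" if "r \<in> S" for r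
      using bound[OF that, of \<xi>] by (intro onorm_le) (simp add: mult.commute mult_left_mono)
  qed
  have "((\<lambda>r. norm ((LINT \<xi>|lborel. f r \<xi>) - (LINT \<xi>|lborel. f t \<xi>) - (r - t) *\<^sub>R (LINT \<xi>|lborel. f' t \<xi>)) / norm (r - t)) \<longlongrightarrow> 0) (at t within S)"
    unfolding tendsto_at_iff_sequentially comp_def
  proof (intro allI impI)
    fix X :: "nat \<Rightarrow> real" assume X: "\<forall>i. X i \<in> S - {t}" and lim: "X \<longlonglongrightarrow> t"
    define q where "q n \<xi> = (f (X n) \<xi> - f t \<xi> - (X n - t) *\<^sub>R f' t \<xi>) /\<^sub>R (X n - t)" for n \<xi>
    have [measurable]: "f (X n) \<in> borel_measurable borel" for n using int X by auto
    have [measurable]: "f t \<in> borel_measurable borel" using int[OF t] by auto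
    have qlim: "(\<lambda>n. q n \<xi>) \<longlonglongrightarrow> 0" for \<xi>
    proof -
      have "((\<lambda>r. norm ((f r \<xi> - f t \<xi>) - (r - t) *\<^sub>R f' t \<xi>) / norm (r - t)) \<longlongrightarrow> 0) (at t within S)"
        using der[OF t, of \<xi>] unfolding has_vector_derivative_def has_derivative_iff_norm by simp
      then have "(\<lambda>n. norm ((f (X n) \<xi> - f t \<xi>) - (X n - t) *\<^sub>R f' t \<xi>) / norm (X n - t)) \<longlonglongrightarrow> 0"
        unfolding tendsto_at_iff_sequentially comp_def using X lim by blast
      then have "(\<lambda>n. norm (q n \<xi>)) \<longlonglongrightarrow> 0"
        by (simp add: q_def divide_inverse mult.commute)
      then show ?thesis by (rule tendsto_norm_zero_cancel)
    qed
    have "(\<lambda>n. LINT \<xi>|lborel. q n \<xi>) \<longlonglongrightarrow> (LINT \<xi>|(lborel::real measure). (0::complex))"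
    proof (rule integral_dominated_convergence[where w="\<lambda>\<xi>. 2 * H \<xi>"])
      show "AE \<xi> in lborel. norm (q n \<xi>) \<le> 2 * H \<xi>" for n
      proof (rule AE_I2)
        fix \<xi>
        have Xn: "X n \<in> S" "X n \<noteq> t" using X by auto
        have "norm (f (X n) \<xi> - f t \<xi> - (X n - t) *\<^sub>R f' t \<xi>) \<le> norm (f (X n) \<xi> - f t \<xi>) + norm ((X n - t) *\<^sub>R f' t \<xi>)"
          by (rule norm_triangle_ineq4)
        also have "\<dots> \<le> H \<xi> * norm (X n - t) + norm (X n - t) * H \<xi>"
          using lip[OF Xn(1), of \<xi>] bound[OF t, of \<xi>] by (intro add_mono) (auto intro: mult_left_mono)
        also have "\<dots> = 2 * H \<xi> * norm (X n - t)" by simp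
        finally have "norm (f (X n) \<xi> - f t \<xi> - (X n - t) *\<^sub>R f' t \<xi>) / norm (X n - t) \<le> 2 * H \<xi>"
          using Xn(2) by (subst pos_divide_le_eq) simp_all
        then show "norm (q n \<xi>) \<le> 2 * H \<xi>"
          by (simp add: q_def divide_inverse mult.commute)
      qed
      show "AE \<xi> in lborel. (\<lambda>n. q n \<xi>) \<longlonglongrightarrow> 0" using qlim by simp
      show "integrable lborel (\<lambda>\<xi>. 2 * H \<xi>)" using H by simp
      show "q n \<in> borel_measurable lborel" for n unfolding q_def[abs_def] by measurable
    qed simp
    then have "(\<lambda>n. norm (LINT \<xi>|lborel. q n \<xi>)) \<longlonglongrightarrow> 0" by (simp add: tendsto_norm_zero)
    moreover have "norm (LINT \<xi>|lborel. q n \<xi>) = norm ((LINT \<xi>|lborel. f (X n) \<xi>) - (LINT \<xi>|lborel. f t \<xi>) - (X n - t) *\<^sub>R (LINT \<xi>|lborel. f' t \<xi>)) / norm (X n - t)" for n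
    proof -
      have Xn: "X n \<in> S" using X by auto
      have "(LINT \<xi>|lborel. q n \<xi>) = ((LINT \<xi>|lborel. f (X n) \<xi>) - (LINT \<xi>|lborel. f t \<xi>) - (X n - t) *\<^sub>R (LINT \<xi>|lborel. f' t \<xi>)) /\<^sub>R (X n - t)"
        unfolding q_def using int[OF Xn] int[OF t] int' by simp
      then show ?thesis by (simp add: divide_inverse mult.commute)
    qed
    ultimately show "(\<lambda>n. norm ((LINT \<xi>|lborel. f (X n) \<xi>) - (LINT \<xi>|lborel. f t \<xi>) - (X n - t) *\<^sub>R (LINT \<xi>|lborel. f' t \<xi>)) / norm (X n - t)) \<longlonglongrightarrow> 0"
      by simp
  qed
  then show ?thesis
    unfolding has_vector_derivative_def has_derivative_iff_norm
    by (simp add: bounded_linear_scaleR_left)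
qed

lemma osc_has_vector_derivative:
  assumes f: "rapid f"
  shows "(osc f has_vector_derivative osc (ddx f) x) (at x)"
  unfolding osc_def[abs_def]
proof (rule has_vector_derivative_integral_dominated[where S=UNIV and H="\<lambda>\<xi>. norm (ddx f \<xi>)"])
  have [measurable]: "f \<in> borel_measurable borel" using f by (rule rapidD)
  show "integrable lborel (\<lambda>y. cis (r * y) * f y)" for r
    by (intro integrable_cis_mult rapid_integrable f) measurable
  show "integrable lborel (\<lambda>\<xi>. norm (ddx f \<xi>))"
    by (intro integrable_norm rapid_integrable rapid_ddx f)
  show "(\<lambda>y. cis (x * y) * ddx f y) \<in> borel_measurable borel" by measurable
  show "((\<lambda>r. cis (r * \<xi>) * f \<xi>) has_vector_derivative cis (r * \<xi>) * ddx f \<xi>) (at r)" for r \<xi>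
    unfolding has_vector_derivative_def
    by (auto intro!: derivative_eq_intros simp: scaleR_conv_of_real ddx_def)
qed (auto simp: norm_mult)

lemma Dx_osc: "rapid f \<Longrightarrow> Dx n (osc f) = osc ((ddx ^^ n) f)"
proof (induction n)
  case (Suc n)
  have "Dx (Suc n) (osc f) = (\<lambda>x. vector_derivative (Dx n (osc f)) (at x))" by (simp add: Dx_def)
  also have "\<dots> = osc ((ddx ^^ Suc n) f)"
    unfolding Suc.IH[OF Suc.prems]
    using vector_derivative_at[OF osc_has_vector_derivative[OF rapid_ddx_funpow[OF Suc.prems]]] by simp
  finally show ?case .
qed (simp add: Dx_def)

lemma ddx_funpow: "(ddx ^^ n) f \<xi> = (\<i> * \<xi>) ^ n * f \<xi>"
  by (induction n) (auto simp: ddx_def)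

lemma osc_differentiable: "rapid f \<Longrightarrow> osc f differentiable (at x)"
  using osc_has_vector_derivative by (rule differentiableI_vector)

lemma osc_hermitian_real:
  assumes "hermitian f" shows "osc f x \<in> \<real>"
proof -
  have "cnj (osc f x) = osc (\<lambda>y. cnj (f (-y))) x"
    using osc_reflect[of "\<lambda>y. cnj (f y)" x] by (simp add: cnj_osc)
  also have "\<dots> = osc f x" using hermitianD[OF assms] by simp
  finally show ?thesis by (simp add: Reals_cnj_iff)
qed


context gevrey_flow begin

lemma rapid_of_weight_bound:
  assumes f: "f \<in> borel_measurable borel" and le: "\<And>\<xi>. w' \<xi> * norm (f \<xi>) \<le> a"
  shows "rapid f"
proof (rule rapid_of_bound[OF f \<sigma>])
  fix \<xi>
  have "exp (\<sigma> * bracket \<xi>) * norm (f \<xi>) \<le> w' \<xi> * norm (f \<xi>)"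
    by (intro mult_right_mono gweight_ge_exp) (use s in auto)
  also note le
  finally show "norm (f \<xi>) \<le> a * exp (- (\<sigma> * bracket \<xi>))"
    by (simp add: exp_minus field_simps)
qed

lemma rapid_weighted: "weighted_L2_le w f a \<Longrightarrow> rapid f"
  using s \<sigma> by (intro rapid_of_weighted[of \<sigma> s f a]) auto

lemma rapid_conv:
  assumes f: "weighted_L2_le w f a"
  shows "rapid (conv f f)" "rapid (conv (ddx f) (ddx f))" "rapid (conv f (conv f f))"
proof -
  have [measurable]: "f \<in> borel_measurable borel" using f by (rule weighted_L2_leD)
  have a: "0 \<le> a" using f by (rule weighted_L2_leD)
  show "rapid (conv f f)"
    using W'.conv_bound(2)[OF weighted_L2_le_w'[OF f] weighted_L2_le_w'[OF f]]
    by (intro rapid_of_weight_bound) auto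
  show "rapid (conv (ddx f) (ddx f))"
    using W'.conv_bound(2)[OF weighted_L2_le_ddx[OF f] weighted_L2_le_ddx[OF f]]
    by (intro rapid_of_weight_bound) auto
  have "weighted_L2_le w' (conv f f) (a * a * sqrt pi)"
    using W.conv_bound(2)[OF f f] a by (intro weighted_L2_le_conv) auto
  from W'.conv_bound(2)[OF weighted_L2_le_w'[OF f] this]
  show "rapid (conv f (conv f f))"
    by (intro rapid_of_weight_bound) auto
qed

lemma rapid_\<beta>: "rapid (\<lambda>\<xi>. complex_of_real (\<beta> \<xi>))"
proof (rule rapid_of_weight_bound)
  fix \<xi>
  have "w' \<xi> * \<beta> \<xi> = (1 / bracket \<xi>) * (1 / bracket \<xi>)"
    using W'.weight_pos[of \<xi>] bracket_pos[of \<xi>] by (simp add: \<beta>_def w_eq)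
  also have "\<dots> \<le> 1 * 1"
    using bracket_ge_1[of \<xi>] by (intro mult_mono) auto
  finally show "w' \<xi> * norm (complex_of_real (\<beta> \<xi>)) \<le> 1" using \<beta>_pos[of \<xi>] by simp
qed measurable

definition rhs :: "(real \<Rightarrow> complex) \<Rightarrow> real \<Rightarrow> complex" where
  "rhs v \<xi> = - (\<i> * \<phi> \<xi>) * v \<xi> + N v \<xi>"

lemma borel_measurable_rhs:
  assumes [measurable]: "v \<in> borel_measurable borel" shows "rhs v \<in> borel_measurable borel"
  unfolding rhs_def[abs_def] N_def by measurable

lemma norm_rhs_le:
  assumes v: "weighted_L2_le w v M"
  shows "norm (rhs v \<xi>) \<le> K * (bracket \<xi> * norm (v \<xi>)) + C M * M * \<beta> \<xi>"
proof -
  have "norm (rhs v \<xi>) \<le> \<bar>\<phi> \<xi>\<bar> * norm (v \<xi>) + norm (N v \<xi>)"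
    unfolding rhs_def by (rule order_trans[OF norm_triangle_ineq]) (simp add: norm_mult)
  also have "\<dots> \<le> (K * bracket \<xi>) * norm (v \<xi>) + C M * M * \<beta> \<xi>"
    by (intro add_mono mult_right_mono \<phi>_le N_bound[OF v]) simp
  finally show ?thesis by (simp add: mult.assoc)
qed

lemma rapid_rhs:
  assumes v: "weighted_L2_le w v M" shows "rapid (rhs v)"
proof (rule rapid_mono[where c=1 and k=0])
  have vm[measurable]: "v \<in> borel_measurable borel" and M: "0 \<le> M" using v by (auto dest: weighted_L2_leD)
  let ?g = "\<lambda>\<xi>. complex_of_real K * complex_of_real (bracket \<xi> * norm (v \<xi>)) + complex_of_real (C M * M) * complex_of_real (\<beta> \<xi>)"
  show "rapid ?g"
  proof (intro rapid_add rapid_cmult rapid_\<beta>)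
    show "rapid (\<lambda>\<xi>. complex_of_real (bracket \<xi> * norm (v \<xi>)))"
      by (rule rapid_mono[OF rapid_weighted[OF v], where c=1 and k=1]) (auto simp: norm_mult bracket_nonneg)
  qed
  show "rhs v \<in> borel_measurable borel" by (rule borel_measurable_rhs[OF vm])
  fix \<xi>
  have "0 \<le> K * (bracket \<xi> * norm (v \<xi>)) + C M * M * \<beta> \<xi>"
    using K C_nonneg[OF M] M \<beta>_pos[of \<xi>] bracket_nonneg[of \<xi>] by simp
  moreover have "?g \<xi> = complex_of_real (K * (bracket \<xi> * norm (v \<xi>)) + C M * M * \<beta> \<xi>)" by simp
  ultimately have "norm (?g \<xi>) = K * (bracket \<xi> * norm (v \<xi>)) + C M * M * \<beta> \<xi>"
    by (simp only: norm_of_real abs_of_nonneg)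
  then show "norm (rhs v \<xi>) \<le> 1 * bracket \<xi> ^ 0 * norm (?g \<xi>)"
    using norm_rhs_le[OF v, of \<xi>] by simp
qed

text \<open>The dispersion relation costs one power of the bracket in the bound for the time derivative and the
\<open>n\<close> derivatives in space cost \<open>n\<close> more; the fixed majorant \<open>m\<close> has all these moments.\<close>

lemma osc_time_derivative:
  assumes v: "\<And>t. weighted_L2_le w (v t) M" and majorant: "weighted_L2_le w m a"
    and le: "\<And>t \<xi>. norm (v t \<xi>) \<le> norm (m \<xi>)"
    and der: "\<And>t \<xi>. t \<in> {0..T} \<Longrightarrow> ((\<lambda>t. v t \<xi>) has_vector_derivative rhs (v t) \<xi>) (at t within {0..T})"
    and t: "t \<in> {0..T}"
  shows "((\<lambda>r. osc ((ddx ^^ n) (v r)) x) has_vector_derivative osc ((ddx ^^ n) (rhs (v t))) x) (at t within {0..T})"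
proof -
  have M: "0 \<le> M" using v by (rule weighted_L2_leD)
  define H where "H \<xi> = K * (bracket \<xi> ^ (n + 1) * norm (m \<xi>)) + (C M * M) * (bracket \<xi> ^ n * \<beta> \<xi>)" for \<xi>
  have "integrable lborel (\<lambda>\<xi>. bracket \<xi> ^ n * \<beta> \<xi>)"
    using rapidD(2)[OF rapid_\<beta>, of n] \<beta>_pos by (simp add: abs_of_pos)
  then have H: "integrable lborel H"
    unfolding H_def by (intro Bochner_Integration.integrable_add integrable_mult_right rapidD(2)[OF rapid_weighted[OF majorant]])
  show ?thesis
    unfolding osc_def
  proof (rule has_vector_derivative_integral_dominated[OF _ t _ _ _ _ H])
    show "integrable lborel (\<lambda>y. cis (x * y) * (ddx ^^ n) (v r) y)" for r
      by (intro integrable_cis_mult rapid_integrable rapid_ddx_funpow rapid_weighted[OF v]) measurable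
    show "(\<lambda>y. cis (x * y) * (ddx ^^ n) (rhs (v t)) y) \<in> borel_measurable borel"
      using rapidD(1)[OF rapid_ddx_funpow[OF rapid_rhs[OF v]]] by measurable
    show "((\<lambda>r. cis (x * \<xi>) * (ddx ^^ n) (v r) \<xi>) has_vector_derivative cis (x * \<xi>) * (ddx ^^ n) (rhs (v r)) \<xi>) (at r within {0..T})"
      if "r \<in> {0..T}" for r \<xi>
      unfolding ddx_funpow
      using has_vector_derivative_mult_right[OF has_vector_derivative_mult_right[OF der[OF that]]] .
    show "norm (cis (x * \<xi>) * (ddx ^^ n) (rhs (v r)) \<xi>) \<le> H \<xi>" for r \<xi>
    proof -
      have "norm (cis (x * \<xi>) * (ddx ^^ n) (rhs (v r)) \<xi>) = \<bar>\<xi>\<bar> ^ n * norm (rhs (v r) \<xi>)"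
        by (simp add: ddx_funpow norm_mult norm_power)
      also have "\<dots> \<le> bracket \<xi> ^ n * (K * (bracket \<xi> * norm (m \<xi>)) + C M * M * \<beta> \<xi>)"
      proof (intro mult_mono power_mono)
        have "norm (rhs (v r) \<xi>) \<le> K * (bracket \<xi> * norm (v r \<xi>)) + C M * M * \<beta> \<xi>"
          by (rule norm_rhs_le[OF v])
        also have "\<dots> \<le> K * (bracket \<xi> * norm (m \<xi>)) + C M * M * \<beta> \<xi>"
          using K by (intro add_right_mono mult_left_mono le) (auto simp: bracket_nonneg)
        finally show "norm (rhs (v r) \<xi>) \<le> K * (bracket \<xi> * norm (m \<xi>)) + C M * M * \<beta> \<xi>" .
      qed (auto simp: bracket_def)
      also have "\<dots> = H \<xi>" by (simp add: H_def algebra_simps)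
      finally show ?thesis .
    qed
  qed auto
qed

end

section \<open>The fifth order KdV-BBM equation\<close>

locale kdv_bbm =
  fixes \<gamma>1 \<gamma>2 \<delta>1 \<delta>2 \<gamma> s \<sigma> :: real
  assumes pos: "0 < \<gamma>1" "0 < \<delta>1" "0 < \<sigma>" and s1: "1 \<le> s"
begin

text \<open>The Fourier symbols of the equation after division by \<open>P\<close>, the symbol of the operator acting on the
time derivative: the dispersion relation \<open>ph\<close>, then \<open>q1\<close> for the two terms with \<open>\<eta>\<^sup>2\<close>, \<open>q2\<close> for the
term with the square of the derivative, and \<open>q3\<close> for the cubic term.\<close>

definition P :: "real \<Rightarrow> real" where "P \<xi> = 1 + \<gamma>1 * \<xi>\<^sup>2 + \<delta>1 * \<xi> ^ 4"
definition ph :: "real \<Rightarrow> real" where "ph \<xi> = \<xi> * (1 - \<gamma>2 * \<xi>\<^sup>2 + \<delta>2 * \<xi> ^ 4) / P \<xi>"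
definition q1 :: "real \<Rightarrow> complex" where "q1 \<xi> = - \<i> * complex_of_real (\<xi> * (3/4 - \<gamma> * \<xi>\<^sup>2) / P \<xi>)"
definition q2 :: "real \<Rightarrow> complex" where "q2 \<xi> = \<i> * complex_of_real (7/48 * \<xi> / P \<xi>)"
definition q3 :: "real \<Rightarrow> complex" where "q3 \<xi> = \<i> * complex_of_real (1/8 * \<xi> / P \<xi>)"
definition \<kappa> :: real where "\<kappa> = min 1 \<delta>1 / 8"
definition K :: real where "K = (2 + \<bar>\<gamma>\<bar> + \<bar>\<gamma>2\<bar> + \<bar>\<delta>2\<bar>) / \<kappa>"

lemma \<kappa>_pos: "0 < \<kappa>" using pos by (simp add: \<kappa>_def)

text \<open>The elliptic estimate behind the decay of all symbols. It rests on \<open>\<langle>\<xi>\<rangle>\<^sup>4 \<le> 8 (1 + \<xi>\<^sup>4)\<close>, whence the 8 in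
\<open>\<kappa>\<close>.\<close>

lemma P_ge: "\<kappa> * bracket \<xi> ^ 4 \<le> P \<xi>"
proof -
  have b2: "(bracket \<xi>)\<^sup>2 \<le> 2 * (1 + \<xi>\<^sup>2)"
    using power2_add_le[of 1 "\<bar>\<xi>\<bar>"] by (simp add: bracket_def)
  have "bracket \<xi> ^ 4 = ((bracket \<xi>)\<^sup>2)\<^sup>2" by simp
  also have "\<dots> \<le> (2 * (1 + \<xi>\<^sup>2))\<^sup>2" by (intro power_mono b2) simp
  also have "\<dots> \<le> 8 * (1 + \<xi> ^ 4)"
    unfolding power_mult_distrib using power2_add_le[of 1 "\<xi>\<^sup>2"] by simp
  finally have "\<kappa> * bracket \<xi> ^ 4 \<le> \<kappa> * (8 * (1 + \<xi> ^ 4))"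
    using \<kappa>_pos by (intro mult_left_mono) auto
  also have "\<dots> = min 1 \<delta>1 * 1 + min 1 \<delta>1 * \<xi> ^ 4" by (simp add: \<kappa>_def algebra_simps)
  also have "\<dots> \<le> 1 * 1 + \<delta>1 * \<xi> ^ 4" by (intro add_mono mult_right_mono) auto
  also have "\<dots> \<le> P \<xi>" using pos by (simp add: P_def)
  finally show ?thesis .
qed

lemma P_pos: "0 < P \<xi>"
  using less_le_trans[OF mult_pos_pos[OF \<kappa>_pos zero_less_power[OF bracket_pos]] P_ge] .

lemma symbol_le:
  assumes "\<bar>a\<bar> \<le> A * bracket \<xi> ^ k" and A: "0 \<le> A" "A \<le> 2 + \<bar>\<gamma>\<bar> + \<bar>\<gamma>2\<bar> + \<bar>\<delta>2\<bar>"
  shows "\<bar>a / P \<xi>\<bar> \<le> K * bracket \<xi> ^ k / bracket \<xi> ^ 4"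
proof -
  have "\<bar>a / P \<xi>\<bar> = \<bar>a\<bar> / P \<xi>" using P_pos[of \<xi>] by simp
  also have "\<dots> \<le> (A * bracket \<xi> ^ k) / (\<kappa> * bracket \<xi> ^ 4)"
    using assms P_ge[of \<xi>] \<kappa>_pos bracket_pos[of \<xi>] by (intro frac_le) auto
  also have "\<dots> = (A / \<kappa>) * (bracket \<xi> ^ k / bracket \<xi> ^ 4)" by simp
  also have "\<dots> \<le> K * (bracket \<xi> ^ k / bracket \<xi> ^ 4)"
    unfolding K_def using A \<kappa>_pos bracket_pos[of \<xi>] by (intro mult_right_mono divide_right_mono) auto
  finally show ?thesis by simp
qed

lemma abs_le_bracket: "\<bar>\<xi>\<bar> \<le> bracket \<xi>" by (simp add: bracket_def)

lemma power_le_bracket: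
  assumes "k \<le> n" shows "\<bar>\<xi>\<bar> ^ k \<le> bracket \<xi> ^ n"
  using power_mono[OF abs_le_bracket[of \<xi>], of k] power_increasing[OF assms bracket_ge_1[of \<xi>]] by simp

lemma abs_mult_power_le: "k \<le> n \<Longrightarrow> \<bar>c * \<xi> ^ k\<bar> \<le> \<bar>c\<bar> * bracket \<xi> ^ n"
  unfolding abs_mult power_abs by (intro mult_left_mono power_le_bracket) auto

sublocale gevrey_flow \<sigma> s K ph q1 q2 q3
proof
  show "1 \<le> s" "0 < \<sigma>" using s1 pos by auto
  show "0 \<le> K" using \<kappa>_pos by (simp add: K_def)
  have [measurable]: "P \<in> borel_measurable borel" unfolding P_def[abs_def] by measurable
  show "ph \<in> borel_measurable borel" unfolding ph_def[abs_def] by measurable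
  show "q1 \<in> borel_measurable borel" unfolding q1_def[abs_def] by measurable
  show "q2 \<in> borel_measurable borel" unfolding q2_def[abs_def] by measurable
  show "q3 \<in> borel_measurable borel" unfolding q3_def[abs_def] by measurable
  have Pm: "P (-\<xi>) = P \<xi>" for \<xi> by (simp add: P_def)
  show "ph (-\<xi>) = - ph \<xi>" for \<xi> by (simp add: ph_def Pm)
  show "hermitian q1" "hermitian q2" "hermitian q3"
    by (simp_all add: hermitian_def q1_def q2_def q3_def Pm)
  fix \<xi> :: real
  have b: "0 < bracket \<xi>" by (rule bracket_pos)
  have K0: "0 \<le> K" by fact
  show "\<bar>ph \<xi>\<bar> \<le> K * bracket \<xi>"
  proof -
    have "\<bar>1 * \<xi> ^ 1 + (-\<gamma>2) * \<xi> ^ 3 + \<delta>2 * \<xi> ^ 5\<bar> \<le> \<bar>1\<bar> * bracket \<xi> ^ 5 + \<bar>-\<gamma>2\<bar> * bracket \<xi> ^ 5 + \<bar>\<delta>2\<bar> * bracket \<xi> ^ 5"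
      by (intro order_trans[OF abs_triangle_ineq] add_mono abs_mult_power_le) auto
    then have "\<bar>\<xi> * (1 - \<gamma>2 * \<xi>\<^sup>2 + \<delta>2 * \<xi> ^ 4)\<bar> \<le> (1 + \<bar>\<gamma>2\<bar> + \<bar>\<delta>2\<bar>) * bracket \<xi> ^ 5"
      by (simp add: algebra_simps power2_eq_square eval_nat_numeral)
    from symbol_le[OF this] show ?thesis
      using b by (simp add: ph_def eval_nat_numeral)
  qed
  show "norm (q1 \<xi>) \<le> K / bracket \<xi>"
  proof -
    have "\<bar>(3/4) * \<xi> ^ 1 + (-\<gamma>) * \<xi> ^ 3\<bar> \<le> \<bar>3/4\<bar> * bracket \<xi> ^ 3 + \<bar>-\<gamma>\<bar> * bracket \<xi> ^ 3"
      by (intro order_trans[OF abs_triangle_ineq] add_mono abs_mult_power_le) auto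
    then have "\<bar>\<xi> * (3/4 - \<gamma> * \<xi>\<^sup>2)\<bar> \<le> (3/4 + \<bar>\<gamma>\<bar>) * bracket \<xi> ^ 3"
      by (simp add: algebra_simps power2_eq_square eval_nat_numeral)
    from symbol_le[OF this] have "\<bar>\<xi> * (3/4 - \<gamma> * \<xi>\<^sup>2) / P \<xi>\<bar> \<le> K * bracket \<xi> ^ 3 / bracket \<xi> ^ 4" by simp
    also have "\<dots> = K / bracket \<xi>" using b by (simp add: eval_nat_numeral)
    finally show ?thesis unfolding q1_def norm_mult norm_of_real by simp
  qed
  have small: "\<bar>c * \<xi> / P \<xi>\<bar> \<le> K / (bracket \<xi>)\<^sup>2" if "0 \<le> c" "c \<le> 1" for c
  proof -
    have "\<bar>c * \<xi> ^ 1\<bar> \<le> \<bar>c\<bar> * bracket \<xi> ^ 2" by (rule abs_mult_power_le) simp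
    then have "\<bar>c * \<xi>\<bar> \<le> c * bracket \<xi> ^ 2" using that by simp
    from symbol_le[OF this] have "\<bar>c * \<xi> / P \<xi>\<bar> \<le> K * bracket \<xi> ^ 2 / bracket \<xi> ^ 4" using that by simp
    also have "\<dots> = K / (bracket \<xi>)\<^sup>2" using b by (simp add: eval_nat_numeral)
    finally show ?thesis .
  qed
  show "norm (q2 \<xi>) \<le> K / (bracket \<xi>)\<^sup>2" "norm (q3 \<xi>) \<le> K / (bracket \<xi>)\<^sup>2"
    unfolding q2_def q3_def norm_mult norm_of_real using small[of "7/48"] small[of "1/8"] by simp_all
qed

text \<open>Multiplied by \<open>P\<close>, the ordinary differential equation at frequency \<open>\<xi>\<close> is the transformed equation.\<close>

lemma symbol_identity:
  "rhs v \<xi> + ddx v \<xi> - \<gamma>1 * (ddx ^^ 2) (rhs v) \<xi> + \<gamma>2 * (ddx ^^ 3) v \<xi>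
    + \<delta>1 * (ddx ^^ 4) (rhs v) \<xi> + \<delta>2 * (ddx ^^ 5) v \<xi> + (3/4) * ddx (conv v v) \<xi>
    + \<gamma> * (ddx ^^ 3) (conv v v) \<xi> - (7/48) * ddx (conv (ddx v) (ddx v)) \<xi>
    - (1/8) * ddx (conv v (conv v v)) \<xi> = 0" (is "?Z = 0")
proof -
  define p where "p = complex_of_real (P \<xi>)"
  define x where "x = complex_of_real \<xi>"
  have p0: "p \<noteq> 0" using P_pos[of \<xi>] by (simp add: p_def)
  have p: "p = 1 + \<gamma>1 * x\<^sup>2 + \<delta>1 * x ^ 4" by (simp add: p_def P_def x_def)
  have ph: "complex_of_real (ph \<xi>) = x * (1 - \<gamma>2 * x\<^sup>2 + \<delta>2 * x ^ 4) / p"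
    by (simp add: ph_def p_def x_def)
  have q: "q1 \<xi> = - \<i> * (x * (3/4 - \<gamma> * x\<^sup>2)) / p" "q2 \<xi> = \<i> * (7/48 * x) / p" "q3 \<xi> = \<i> * (1/8 * x) / p"
    by (simp_all add: q1_def q2_def q3_def p_def x_def)
  have prhs: "p * rhs v \<xi> = - \<i> * x * (1 - \<gamma>2 * x\<^sup>2 + \<delta>2 * x ^ 4) * v \<xi>
      - \<i> * x * (3/4 - \<gamma> * x\<^sup>2) * conv v v \<xi> + (7/48) * \<i> * x * conv (ddx v) (ddx v) \<xi>
      + (1/8) * \<i> * x * conv v (conv v v) \<xi>"
    using p0 unfolding rhs_def N_def ph q by (simp add: field_simps)
  have i: "(\<i> * x)\<^sup>2 = - x\<^sup>2" "(\<i> * x) ^ 3 = - \<i> * x ^ 3" "(\<i> * x) ^ 4 = x ^ 4" "(\<i> * x) ^ 5 = \<i> * x ^ 5"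
  proof -
    have "\<i>\<^sup>2 = -1" "\<i> ^ 3 = - \<i>" "\<i> ^ 4 = 1" "\<i> ^ 5 = \<i>" by (simp_all add: eval_nat_numeral)
    then show "(\<i> * x)\<^sup>2 = - x\<^sup>2" "(\<i> * x) ^ 3 = - \<i> * x ^ 3" "(\<i> * x) ^ 4 = x ^ 4" "(\<i> * x) ^ 5 = \<i> * x ^ 5"
      by (simp_all add: power_mult_distrib)
  qed
  have "?Z = p * rhs v \<xi> + \<i> * x * (1 - \<gamma>2 * x\<^sup>2 + \<delta>2 * x ^ 4) * v \<xi>
      + \<i> * x * (3/4 - \<gamma> * x\<^sup>2) * conv v v \<xi> - (7/48) * \<i> * x * conv (ddx v) (ddx v) \<xi>
      - (1/8) * \<i> * x * conv v (conv v v) \<xi>"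
    unfolding ddx_funpow ddx_def[of _ \<xi>] x_def[symmetric] i p
    by (simp add: algebra_simps power2_eq_square eval_nat_numeral)
  also have "\<dots> = 0" unfolding prhs by (simp add: algebra_simps)
  finally show ?thesis .
qed

text \<open>Every term of the equation is an oscillatory integral, by differentiation under the integral and by the
product formula, and the sum of the integrands vanishes identically. The term \<open>\<eta> \<eta>\<^sub>x\<close> is
first written as half the derivative of \<open>\<eta>\<^sup>2\<close>.\<close>

theorem solution_of_fourier_side:
  assumes v: "\<And>t. weighted_L2_le w (v t) M" and majorant: "weighted_L2_le w m a"
    and le: "\<And>t \<xi>. norm (v t \<xi>) \<le> norm (m \<xi>)"
    and der: "\<And>t \<xi>. t \<in> {0..T} \<Longrightarrow> ((\<lambda>t. v t \<xi>) has_vector_derivative rhs (v t) \<xi>) (at t within {0..T})"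
    and T: "0 < T"
  shows "kdv_bbm_solution \<gamma>1 \<gamma>2 \<delta>1 \<delta>2 \<gamma> T (\<lambda>t. osc (v t))"
  unfolding kdv_bbm_solution_def
proof (intro ballI allI)
  fix t x assume t: "t \<in> {0..T}"
  define q where "q = v t"
  have q: "weighted_L2_le w q M" unfolding q_def by (rule v)
  have rv: "rapid (v r)" for r by (rule rapid_weighted[OF v])
  have Rq: "rapid q" unfolding q_def by (rule rv)
  have Rr: "rapid (rhs q)" by (rule rapid_rhs[OF q])
  note Rc = rapid_conv[OF q]
  have dt: "((\<lambda>r. Dx n (osc (v r)) x) has_vector_derivative osc ((ddx ^^ n) (rhs q)) x) (at t within {0..T})" for n
    unfolding Dx_osc[OF rv] q_def by (rule osc_time_derivative[OF v majorant le der t])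
  have Dtn: "Dt T (\<lambda>r. Dx n (osc (v r))) t x = osc ((ddx ^^ n) (rhs q)) x" for n
    unfolding Dt_def by (rule vector_derivative_within_closed_interval[OF T t dt])
  have Dt0: "Dt T (\<lambda>r. osc (v r)) t x = osc (rhs q) x"
    using Dtn[of 0] by (simp add: Dx_def)
  have Dxq: "Dx n (osc q) = osc ((ddx ^^ n) q)" for n by (rule Dx_osc[OF Rq])
  have Dx1: "Dx 1 (osc q) = osc (ddx q)" using Dxq[of 1] by simp
  have sq: "(\<lambda>y. (osc q y)\<^sup>2) = osc (conv q q)"
    by (simp add: power2_eq_square osc_product rapid_integrable[OF Rq] fun_eq_iff)
  have sqx: "(\<lambda>y. (osc (ddx q) y)\<^sup>2) = osc (conv (ddx q) (ddx q))"
    by (simp add: power2_eq_square osc_product rapid_integrable[OF rapid_ddx[OF Rq]] fun_eq_iff)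
  have cube: "(\<lambda>y. (osc q y) ^ 3) = osc (conv q (conv q q))"
  proof
    fix y
    have "(osc q y) ^ 3 = osc q y * (osc q y * osc q y)" by (simp add: power3_eq_cube)
    then show "(osc q y) ^ 3 = osc (conv q (conv q q)) y"
      by (simp only: osc_product rapid_integrable[OF Rq] rapid_integrable[OF Rc(1)])
  qed
  have Dx1': "Dx 1 (osc f) x = osc (ddx f) x" if "rapid f" for f using Dx_osc[OF that, of 1] by simp
  have leibniz: "(3/2) * (osc q x * osc (ddx q) x) = (3/4) * osc (ddx (conv q q)) x"
  proof -
    have "((\<lambda>y. osc q y * osc q y) has_vector_derivative osc q x * osc (ddx q) x + osc (ddx q) x * osc q x) (at x)"
      by (intro has_vector_derivative_mult osc_has_vector_derivative Rq)
    moreover have "((\<lambda>y. osc q y * osc q y) has_vector_derivative osc (ddx (conv q q)) x) (at x)"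
      using osc_has_vector_derivative[OF Rc(1), of x] unfolding sq[symmetric] by (simp add: power2_eq_square)
    ultimately have "osc q x * osc (ddx q) x + osc (ddx q) x * osc q x = osc (ddx (conv q q)) x"
      by (rule vector_derivative_unique_at)
    then show ?thesis by (simp add: field_simps)
  qed
  define Z where "Z = (\<lambda>\<xi>. rhs q \<xi> + ddx q \<xi> - \<gamma>1 * (ddx ^^ 2) (rhs q) \<xi> + \<gamma>2 * (ddx ^^ 3) q \<xi>
    + \<delta>1 * (ddx ^^ 4) (rhs q) \<xi> + \<delta>2 * (ddx ^^ 5) q \<xi> + (3/4) * ddx (conv q q) \<xi>
    + \<gamma> * (ddx ^^ 3) (conv q q) \<xi> - (7/48) * ddx (conv (ddx q) (ddx q)) \<xi>
    - (1/8) * ddx (conv q (conv q q)) \<xi>)"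
  have I: "integrable lborel ((ddx ^^ n) (rhs q))" "integrable lborel ((ddx ^^ n) q)" "integrable lborel ((ddx ^^ n) (conv q q))"
    "integrable lborel (rhs q)" "integrable lborel (ddx q)" "integrable lborel (ddx (conv q q))"
    "integrable lborel (ddx (conv (ddx q) (ddx q)))" "integrable lborel (ddx (conv q (conv q q)))" for n
    by (intro rapid_integrable rapid_ddx_funpow rapid_ddx Rr Rq Rc)+
  have oscZ: "osc Z x = osc (rhs q) x + osc (ddx q) x - \<gamma>1 * osc ((ddx ^^ 2) (rhs q)) x + \<gamma>2 * osc ((ddx ^^ 3) q) x
    + \<delta>1 * osc ((ddx ^^ 4) (rhs q)) x + \<delta>2 * osc ((ddx ^^ 5) q) x + (3/4) * osc (ddx (conv q q)) x
    + \<gamma> * osc ((ddx ^^ 3) (conv q q)) x - (7/48) * osc (ddx (conv (ddx q) (ddx q))) x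
    - (1/8) * osc (ddx (conv q (conv q q))) x"
    unfolding Z_def
    by (simp only: osc_add osc_diff osc_cmult I Bochner_Integration.integrable_add Bochner_Integration.integrable_diff integrable_mult_right)
  have "osc Z x = 0"
    unfolding Z_def symbol_identity by (simp add: osc_def)
  note pde = this[unfolded oscZ]
  show "(\<forall>n<5. Dx n (osc (v t)) differentiable (at x)) \<and>
        (\<forall>n\<in>{0,2,4}. (\<lambda>r. Dx n (osc (v r)) x) differentiable (at t within {0..T})) \<and>
        Dt T (\<lambda>t. osc (v t)) t x + Dx 1 (osc (v t)) x
        - \<gamma>1 *\<^sub>R Dt T (\<lambda>r. Dx 2 (osc (v r))) t x
        + \<gamma>2 *\<^sub>R Dx 3 (osc (v t)) x
        + \<delta>1 *\<^sub>R Dt T (\<lambda>r. Dx 4 (osc (v r))) t x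
        + \<delta>2 *\<^sub>R Dx 5 (osc (v t)) x
        + (3/2) * (osc (v t) x * Dx 1 (osc (v t)) x)
        + \<gamma> *\<^sub>R Dx 3 (\<lambda>y. (osc (v t) y)\<^sup>2) x
        - (7/48) * Dx 1 (\<lambda>y. (Dx 1 (osc (v t)) y)\<^sup>2) x
        - (1/8) * Dx 1 (\<lambda>y. (osc (v t) y)^3) x = 0"
  proof (intro conjI allI ballI impI)
    show "Dx n (osc (v t)) differentiable (at x)" for n
      unfolding Dx_osc[OF rv] by (intro osc_differentiable rapid_ddx_funpow rv)
    show "(\<lambda>r. Dx n (osc (v r)) x) differentiable (at t within {0..T})" for n
      using dt by (rule differentiableI_vector)
  qed (use pde in \<open>simp only: q_def[symmetric] Dt0 Dtn Dx1 sq sqx cube leibniz Dx1'[OF Rc(1)] Dx1'[OF Rc(2)] Dx1'[OF Rc(3)]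
      Dx_osc[OF Rc(1)] Dxq[of 3] Dxq[of 5] scaleR_conv_of_real\<close>)
qed

end


section \<open>Gevrey norms and the initial profile\<close>

lemma gevrey_density_eq:
  "gevrey_density \<sigma> s f \<xi> = (gweight \<sigma> s \<xi> * norm (fourier f \<xi>))\<^sup>2"
proof -
  have "bracket \<xi> powr (2 * s) = (bracket \<xi> powr s)\<^sup>2"
    by (simp add: power2_eq_square flip: powr_add)
  moreover have "exp (2 * \<sigma> * bracket \<xi>) = (exp (\<sigma> * bracket \<xi>))\<^sup>2"
    by (simp add: power2_eq_square flip: exp_add)
  ultimately show ?thesis by (simp add: gevrey_density_def gweight_def power_mult_distrib)
qed

lemma fourier_measurable: "f \<in> L2 \<Longrightarrow> fourier f \<in> borel_measurable borel"
  using has_fourier_fourier[of f] by (auto simp: has_fourier_def dest: L2_borel_measurable)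

text \<open>The transform of a real function has the symmetry only almost everywhere. Averaging it with its
reflected conjugate gives a representative that has it everywhere, which is what the pointwise
iteration preserves.\<close>

lemma real_data_hermitian_representative:
  assumes v: "integrable lborel v" and real: "AE x in lborel. osc v x \<in> \<real>"
  shows "\<exists>v'. v' \<in> borel_measurable borel \<and> (AE \<xi> in lborel. v' \<xi> = v \<xi>) \<and> hermitian v'"
proof -
  have [measurable]: "v \<in> borel_measurable borel" using v by auto
  have vr: "integrable lborel (\<lambda>\<xi>. cnj (v (-\<xi>)))"
    using lborel_integrable_real_affine[OF v, of "-1" 0] by simp
  have "AE \<xi> in lborel. v \<xi> - cnj (v (-\<xi>)) = 0"
  proof (rule osc_AE_eq_0_imp_AE)
    show "integrable lborel (\<lambda>\<xi>. v \<xi> - cnj (v (-\<xi>)))" using v vr by simp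
    have "osc (\<lambda>\<xi>. v \<xi> - cnj (v (-\<xi>))) x = osc v x - cnj (osc v x)" for x
      using osc_diff[OF v vr, of x] osc_reflect[of "\<lambda>y. cnj (v y)" x] by (simp add: cnj_osc)
    then show "AE x in lborel. osc (\<lambda>\<xi>. v \<xi> - cnj (v (-\<xi>))) x = 0"
      using real by (auto simp: Reals_cnj_iff elim: AE_mp)
  qed
  then have "AE \<xi> in lborel. (v \<xi> + cnj (v (-\<xi>))) / 2 = v \<xi>"
    by eventually_elim simp
  moreover have "hermitian (\<lambda>\<xi>. (v \<xi> + cnj (v (-\<xi>))) / 2)"
    by (simp add: hermitian_def add.commute)
  ultimately show ?thesis by (intro exI[of _ "\<lambda>\<xi>. (v \<xi> + cnj (v (-\<xi>))) / 2"]) auto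
qed

lemma osc_cong_AE:
  assumes "AE \<xi> in lborel. f \<xi> = g \<xi>" and [measurable]: "f \<in> borel_measurable borel" "g \<in> borel_measurable borel"
  shows "osc f x = osc g x"
  unfolding osc_def by (rule integral_cong_AE) (use assms(1) in auto)

context gevrey_flow begin

lemma weighted_L2_le_imp_L2:
  assumes f: "weighted_L2_le w f a" shows "f \<in> L2"
proof -
  have "weighted_L2_le (\<lambda>_. 1) f a"
  proof (rule weighted_L2_le_mono[OF f])
    fix \<xi>
    have "1 \<le> exp (\<sigma> * bracket \<xi>)" using \<sigma> by (simp add: bracket_nonneg)
    also have "\<dots> \<le> w \<xi>" using s by (intro gweight_ge_exp) simp
    finally show "1 * norm (f \<xi>) \<le> w \<xi> * norm (f \<xi>)" by (intro mult_right_mono) auto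
  qed (use weighted_L2_leD(1)[OF f] in auto)
  from weighted_L2_leD[OF this] show ?thesis
    by (auto simp: L2_iff intro: le_less_trans)
qed

lemma fourier_osc_weighted:
  assumes f: "weighted_L2_le w f a"
  shows "AE \<xi> in lborel. gevrey_density \<sigma> s (osc f) \<xi> = 2 * pi * (w \<xi> * norm (f \<xi>))\<^sup>2"
  using fourier_osc[OF rapid_integrable[OF rapid_weighted[OF f]] weighted_L2_le_imp_L2[OF f]]
  by eventually_elim (simp add: gevrey_density_eq norm_mult power_mult_distrib)

lemma integrable_weighted:
  assumes f: "weighted_L2_le w f a" shows "integrable lborel (\<lambda>\<xi>. (w \<xi> * norm (f \<xi>))\<^sup>2)"
  using W.weighted_L2[OF f] by (simp add: L2_def norm_mult power_mult_distrib)

lemma gevrey_density_osc_measurable: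
  assumes f: "weighted_L2_le w f a" shows "gevrey_density \<sigma> s (osc f) \<in> borel_measurable borel"
proof -
  have [measurable]: "fourier (osc f) \<in> borel_measurable borel"
    by (intro fourier_measurable osc_L2 rapid_integrable rapid_weighted[OF f] weighted_L2_le_imp_L2[OF f])
  show ?thesis unfolding gevrey_density_eq[abs_def] by measurable
qed

lemma osc_in_gevrey:
  assumes f: "weighted_L2_le w f a" shows "osc f \<in> gevrey \<sigma> s"
proof -
  have [measurable]: "f \<in> borel_measurable borel" using f by (rule weighted_L2_leD)
  have "osc f \<in> L2"
    by (intro osc_L2 rapid_integrable rapid_weighted[OF f] weighted_L2_le_imp_L2[OF f])
  moreover have "integrable lborel (gevrey_density \<sigma> s (osc f))"
  proof (subst integrable_cong_AE[OF _ _ fourier_osc_weighted[OF f]])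
    show "integrable lborel (\<lambda>\<xi>. 2 * pi * (w \<xi> * norm (f \<xi>))\<^sup>2)"
      using integrable_weighted[OF f] by simp
  qed (use gevrey_density_osc_measurable[OF f] in auto)
  ultimately show ?thesis by (simp add: gevrey_def)
qed

lemma gevrey_norm_osc:
  assumes f: "weighted_L2_le w f a"
  shows "gevrey_norm \<sigma> s (osc f) = sqrt (2 * pi * (LINT \<xi>|lborel. (w \<xi> * norm (f \<xi>))\<^sup>2))"
proof -
  have [measurable]: "f \<in> borel_measurable borel" using f by (rule weighted_L2_leD)
  have "(LINT \<xi>|lborel. gevrey_density \<sigma> s (osc f) \<xi>) = (LINT \<xi>|lborel. 2 * pi * (w \<xi> * norm (f \<xi>))\<^sup>2)"
    by (rule integral_cong_AE) (use gevrey_density_osc_measurable[OF f] fourier_osc_weighted[OF f] in auto)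
  then show ?thesis by (simp add: gevrey_norm_def)
qed

text \<open>The norm of a difference is an explicit integral of the profiles, to which dominated convergence applies.\<close>

lemma gevrey_continuous_osc:
  assumes v: "\<And>t. weighted_L2_le w (v t) M" and majorant: "weighted_L2_le w m a"
    and le: "\<And>t \<xi>. norm (v t \<xi>) \<le> norm (m \<xi>)"
    and cont: "\<And>\<xi>. continuous_on UNIV (\<lambda>t. v t \<xi>)"
  shows "gevrey_continuous \<sigma> s T (\<lambda>t. osc (v t))"
  unfolding gevrey_continuous_def
proof (intro ballI conjI)
  fix t
  let ?d = "\<lambda>r \<xi>. (w \<xi> * norm (v r \<xi> - v t \<xi>))\<^sup>2"
  show "osc (v t) \<in> gevrey \<sigma> s" by (rule osc_in_gevrey[OF v])
  have [measurable]: "v r \<in> borel_measurable borel" for r using v by (rule weighted_L2_leD)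
  have diff: "weighted_L2_le w (\<lambda>\<xi>. v r \<xi> - v t \<xi>) (2 * (M + M))" for r
    using weighted_L2_le_add[OF v[of r] weighted_L2_le_cmult[OF v[of t], of "-1"] W.weight_measurable] W.weight_pos
    by (simp add: less_imp_le)
  have norm: "gevrey_norm \<sigma> s (\<lambda>x. osc (v r) x - osc (v t) x)
     = sqrt (2 * pi * (LINT \<xi>|lborel. ?d r \<xi>))" for r
  proof -
    have "(\<lambda>x. osc (v r) x - osc (v t) x) = osc (\<lambda>\<xi>. v r \<xi> - v t \<xi>)"
      by (rule ext) (simp add: osc_diff rapid_integrable[OF rapid_weighted[OF v]])
    then show ?thesis using gevrey_norm_osc[OF diff] by simp
  qed
  have m: "integrable lborel (\<lambda>\<xi>. 4 * (w \<xi> * norm (m \<xi>))\<^sup>2)"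
    using integrable_weighted[OF majorant] by simp
  show "((\<lambda>r. gevrey_norm \<sigma> s (\<lambda>x. osc (v r) x - osc (v t) x)) \<longlongrightarrow> 0) (at t within {0..T})"
    unfolding tendsto_at_iff_sequentially comp_def norm
  proof (intro allI impI)
    fix X :: "nat \<Rightarrow> real" assume X: "X \<longlonglongrightarrow> t"
    have "(\<lambda>n. LINT \<xi>|lborel. ?d (X n) \<xi>) \<longlonglongrightarrow> (LINT \<xi>|(lborel::real measure). 0::real)"
    proof (rule integral_dominated_convergence[OF _ _ m])
      show "AE \<xi> in lborel. (\<lambda>n. ?d (X n) \<xi>) \<longlonglongrightarrow> 0"
      proof (rule AE_I2)
        fix \<xi>
        have "(\<lambda>n. v (X n) \<xi>) \<longlonglongrightarrow> v t \<xi>"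
          by (rule continuous_on_tendsto_compose[OF cont X]) auto
        then have "(\<lambda>n. ?d (X n) \<xi>) \<longlonglongrightarrow> (w \<xi> * norm (v t \<xi> - v t \<xi>))\<^sup>2"
          by (intro tendsto_intros)
        then show "(\<lambda>n. ?d (X n) \<xi>) \<longlonglongrightarrow> 0" by simp
      qed
      show "AE \<xi> in lborel. norm (?d (X n) \<xi>) \<le> 4 * (w \<xi> * norm (m \<xi>))\<^sup>2" for n
      proof (rule AE_I2)
        fix \<xi>
        have "norm (v (X n) \<xi> - v t \<xi>) \<le> 2 * norm (m \<xi>)"
          using norm_triangle_ineq4[of "v (X n) \<xi>" "v t \<xi>"] le[of "X n" \<xi>] le[of t \<xi>] by simp
        then have "?d (X n) \<xi> \<le> (w \<xi> * (2 * norm (m \<xi>)))\<^sup>2"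
          using W.weight_pos[of \<xi>] by (intro power_mono mult_left_mono) auto
        then show "norm (?d (X n) \<xi>) \<le> 4 * (w \<xi> * norm (m \<xi>))\<^sup>2"
          by (simp add: power_mult_distrib)
      qed
    qed measurable
    then have "(\<lambda>n. sqrt (2 * pi * (LINT \<xi>|lborel. ?d (X n) \<xi>))) \<longlonglongrightarrow> sqrt (2 * pi * 0)"
      by (intro tendsto_intros) simp
    then show "(\<lambda>n. sqrt (2 * pi * (LINT \<xi>|lborel. ?d (X n) \<xi>))) \<longlonglongrightarrow> 0" by simp
  qed
qed

text \<open>Elements of the Gevrey class have an integrable transform, so inversion represents them as oscillatory
integrals. Their normalised transform is a profile of no larger weighted norm, which fixes the dependence
of the existence time on the Gevrey norm alone.\<close>

lemma gevrey_data_profile: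
  assumes f: "f \<in> gevrey \<sigma> s"
  shows "\<exists>v0. weighted_L2_le w v0 (gevrey_norm \<sigma> s f) \<and> (AE x in lborel. osc v0 x = f x) \<and>
    ((AE x in lborel. f x \<in> \<real>) \<longrightarrow> hermitian v0)"
proof -
  have fL: "f \<in> L2" and int: "integrable lborel (gevrey_density \<sigma> s f)" using f by (auto simp: gevrey_def)
  note [measurable] = fourier_measurable[OF fL]
  define v1 where "v1 \<xi> = fourier f \<xi> / sqrt (2 * pi)" for \<xi>
  have [measurable]: "v1 \<in> borel_measurable borel" unfolding v1_def[abs_def] by measurable
  have "(LINT \<xi>|lborel. gevrey_density \<sigma> s f \<xi>) = (gevrey_norm \<sigma> s f)\<^sup>2"
    unfolding gevrey_norm_def
    by (subst real_sqrt_pow2) (auto intro!: Bochner_Integration.integral_nonneg simp: gevrey_density_eq)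
  then have "(\<integral>\<^sup>+ \<xi>. ennreal ((w \<xi> * norm (fourier f \<xi>))\<^sup>2) \<partial>lborel) = ennreal ((gevrey_norm \<sigma> s f)\<^sup>2)"
    using int unfolding gevrey_density_eq[abs_def] by (subst nn_integral_eq_integral) auto
  then have wf: "weighted_L2_le w (fourier f) (gevrey_norm \<sigma> s f)"
    by (simp add: weighted_L2_le_def gevrey_norm_def Bochner_Integration.integral_nonneg gevrey_density_eq)
  have "norm (complex_of_real (1 / sqrt (2 * pi))) \<le> 1"
  proof -
    have "1 \<le> 2 * pi" using pi_ge_two by simp
    then show ?thesis unfolding norm_of_real by simp
  qed
  from weighted_L2_le_cmult[OF wf this] W.weight_pos
  have v1: "weighted_L2_le w v1 (gevrey_norm \<sigma> s f)"
    unfolding v1_def[abs_def] by (simp add: less_imp_le)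
  have v1i: "integrable lborel v1" by (intro rapid_integrable rapid_weighted[OF v1])
  have fi: "integrable lborel (fourier f)" by (intro rapid_integrable rapid_weighted[OF wf])
  have inv: "AE x in lborel. f x = osc v1 x"
    using fourier_inversion[OF fL has_fourier_fourier[OF fL] fi] unfolding v1_def[abs_def] .
  obtain v0 where v0m[measurable]: "v0 \<in> borel_measurable borel" and v0: "AE \<xi> in lborel. v0 \<xi> = v1 \<xi>"
    and herm: "(AE x in lborel. f x \<in> \<real>) \<longrightarrow> hermitian v0"
  proof (cases "AE x in lborel. f x \<in> \<real>")
    case True
    have "AE x in lborel. osc v1 x \<in> \<real>" using True inv by eventually_elim simp
    from real_data_hermitian_representative[OF v1i this] that show ?thesis by blast
  next
    case False
    then show ?thesis using that[of v1] by simp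
  qed
  have "(\<integral>\<^sup>+ \<xi>. ennreal ((w \<xi> * norm (v0 \<xi>))\<^sup>2) \<partial>lborel) = (\<integral>\<^sup>+ \<xi>. ennreal ((w \<xi> * norm (v1 \<xi>))\<^sup>2) \<partial>lborel)"
    by (rule nn_integral_cong_AE) (use v0 in auto)
  then have "weighted_L2_le w v0 (gevrey_norm \<sigma> s f)"
    using v1 by (simp add: weighted_L2_le_def)
  moreover have "AE x in lborel. osc v0 x = f x"
    using inv osc_cong_AE[OF v0] by auto
  ultimately show ?thesis using herm by blast
qed

end

theorem theorem1p3:
  fixes a b c d a1 b1 c1 d1 \<rho> \<gamma>1 \<gamma>2 \<delta>1 \<delta>2 \<gamma> :: real
    and s \<sigma> :: real
  assumes "\<rho> = b + d - 1/6"
    and "\<gamma>1 = 1/2 * (b + d - \<rho>)"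
    and "\<gamma>2 = 1/2 * (a + c + \<rho>)"
    and "\<delta>1 = 1/4 * (2 * (b1 + d1) - (b - d + \<rho>) * (1/6 - a - d) - d * (c - a + \<rho>))"
    and "\<delta>2 = 1/4 * (2 * (a1 + c1) - (c - a + \<rho>) * (1/6 - a) + 1/3 * \<rho>)"
    and "\<gamma> = 1/24 * (5 - 9 * (b + d) + 9 * \<rho>)"
    and "a + b + c + d = 1/3"
    and "\<gamma>1 + \<gamma>2 = 1/6"
    and "\<gamma> = 1/24 * (5 - 18 * \<gamma>1)"
    and "\<delta>2 - \<delta>1 = 19/360 - 1/6 * \<gamma>1"
    and "\<gamma>1 > 0" and "\<delta>1 > 0"
    and "s \<ge> 1" and "\<sigma> > 0"
  shows "\<exists>T :: real \<Rightarrow> real. (\<forall>r\<ge>0. T r > 0) \<and>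
    (\<forall>\<eta>0 \<in> gevrey \<sigma> s. \<exists>\<eta> :: real \<Rightarrow> real \<Rightarrow> complex.
       gevrey_continuous \<sigma> s (T (gevrey_norm \<sigma> s \<eta>0)) \<eta> \<and>
       kdv_bbm_solution \<gamma>1 \<gamma>2 \<delta>1 \<delta>2 \<gamma> (T (gevrey_norm \<sigma> s \<eta>0)) \<eta> \<and>
       (AE x in lborel. \<eta> 0 x = \<eta>0 x) \<and>
       ((AE x in lborel. \<eta>0 x \<in> \<real>) \<longrightarrow>
          (\<forall>t\<in>{0..T (gevrey_norm \<sigma> s \<eta>0)}. \<forall>x. \<eta> t x \<in> \<real>)))"
proof -
  interpret kdv_bbm \<gamma>1 \<gamma>2 \<delta>1 \<delta>2 \<gamma> s \<sigma>
    by unfold_locales (use assms in auto)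
  show ?thesis
  proof (intro exI[of _ existence_time] conjI allI impI ballI)
    show "0 < existence_time r" if "0 \<le> r" for r using that by (rule existence_time_pos)
    fix \<eta>0 assume \<eta>0: "\<eta>0 \<in> gevrey \<sigma> s"
    obtain v0 where v0: "weighted_L2_le w v0 (gevrey_norm \<sigma> s \<eta>0)"
      and osc_v0: "AE x in lborel. osc v0 x = \<eta>0 x"
      and real: "(AE x in lborel. \<eta>0 x \<in> \<real>) \<longrightarrow> hermitian v0"
      using gevrey_data_profile[OF \<eta>0] by blast
    interpret gevrey_data \<sigma> s K ph q1 q2 q3 v0 "gevrey_norm \<sigma> s \<eta>0"
      by unfold_locales (rule v0)
    obtain v where v: "\<And>t. weighted_L2_le w (v t) M" and le: "\<And>t \<xi>. norm (v t \<xi>) \<le> norm (majorant \<xi>)"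
      and cont: "\<And>\<xi>. continuous_on UNIV (\<lambda>t. v t \<xi>)" and init: "\<And>\<xi>. v 0 \<xi> = v0 \<xi>"
      and der: "\<And>t \<xi>. t \<in> {0..T} \<Longrightarrow> ((\<lambda>t. v t \<xi>) has_vector_derivative rhs (v t) \<xi>) (at t within {0..T})"
      and herm: "\<And>t. hermitian v0 \<Longrightarrow> hermitian (v t)"
      using local_existence unfolding rhs_def by blast
    have T: "existence_time (gevrey_norm \<sigma> s \<eta>0) = T" by (simp add: T_def)
    show "\<exists>\<eta>. gevrey_continuous \<sigma> s (existence_time (gevrey_norm \<sigma> s \<eta>0)) \<eta> \<and>
       kdv_bbm_solution \<gamma>1 \<gamma>2 \<delta>1 \<delta>2 \<gamma> (existence_time (gevrey_norm \<sigma> s \<eta>0)) \<eta> \<and>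
       (AE x in lborel. \<eta> 0 x = \<eta>0 x) \<and>
       ((AE x in lborel. \<eta>0 x \<in> \<real>) \<longrightarrow>
          (\<forall>t\<in>{0..existence_time (gevrey_norm \<sigma> s \<eta>0)}. \<forall>x. \<eta> t x \<in> \<real>))"
      unfolding T
    proof (intro exI[of _ "\<lambda>t. osc (v t)"] conjI impI ballI allI)
      show "gevrey_continuous \<sigma> s T (\<lambda>t. osc (v t))"
        by (rule gevrey_continuous_osc[OF v weighted_majorant le cont])
      show "kdv_bbm_solution \<gamma>1 \<gamma>2 \<delta>1 \<delta>2 \<gamma> T (\<lambda>t. osc (v t))"
        by (rule solution_of_fourier_side[OF v weighted_majorant le der T_pos])
      have "v 0 = v0" using init by (rule ext)
      then show "AE x in lborel. osc (v 0) x = \<eta>0 x" using osc_v0 by simp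
      show "osc (v t) x \<in> \<real>" if "AE x in lborel. \<eta>0 x \<in> \<real>" for t x
        using that real herm by (intro osc_hermitian_real) blast
    qed
  qed
qed

end
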